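(* There is a constant $C>0$, independent of the mesh size $h$ and of the interface position relative to the mesh (but possibly depending on $\mu^\pm$), such that for all $T\in\mathcal T_h^\Gamma$, all $F\in\mathcal F_h^\Gamma$ and all $(\mathbf v_h,q_h)\in\widetilde{\boldsymbol VQ_h}(\Omega)$: $$\|\nabla\mathbf v_h\|_{L^2(\partial T)}\le Ch_T^{-1/2}|\mathbf v_h|_{H^1(T)},$$ $$|\mathbf v_h|_{H^1(T)}\le Ch_T^{-1}\|\mathbf v_h\|_{L^2(T)},$$ $$|I_{h,T}\mathbf v_h|_{H^1(T)}\le C|\mathbf v_h|_{H^1(T)},$$ $$h_T^{1/2}\|\mathbf v_h-I_h^B\mathbf v_h\|_{L^2(\Gamma_{h,T})}+h_T^m|\mathbf v_h-I_h^B\mathbf v_h|_{H^m(T)}\le Ch_T|\mathbf v_h|_{H^1(T)},\quad m=0,1,$$ $$\|[\![q_h^\pm]\!]\|_{L^2(\Gamma_{h,T})}\le Ch_T^{-1/2}|\mathbf v_h|_{H^1(T)},$$ $$\|q_h\|_{L^2(\partial T)}\le Ch_T^{-1/2}\big(\|q_h\|_{L^2(T)}+|\mathbf v_h|_{H^1(T)}\big),$$ $$h_F\|[q_h]_F\|^2_{L^2(F)}+h_F^{-1}\|[\mathbf v_h]_F\|^2_{L^2(F)}\le C\sum_{T'\in\mathcal T_h^F}|\mathbf v_h|^2_{H^1(T')}.$$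
   Context: Setting. $N\in\{2,3\}$; $\Omega\subset\mathbb R^N$ is an open rectangle ($N=2$) or cuboid ($N=3$); $\Gamma\subset\Omega$ is a closed $C^2$ hypersurface dividing $\Omega$ into $\Omega^-$ (the inclusion, $\partial\Omega^-=\Gamma$) and $\Omega^+$; $\mu^\pm>0$ are constants. $d$ is the signed distance, $d=\pm\mathrm{dist}(\cdot,\Gamma)$ in $\Omega^\pm$. $\{\mathcal T_h\}$ is a shape-regular family of Cartesian simplicial meshes of $\Omega$, not fitted to $\Gamma$: $\Omega$ is divided into rectangles/cuboids by a tensor-product grid; for $N=2$ each rectangle is split into two triangles by a diagonal, for $N=3$ each cuboid is split into six tetrahedra sharing a space diagonal (Kuhn subdivision), in the same manner in every cell. Elements $T$ and faces $F$ (edges if $N=2$) are open; $h_T,h_F$ are diameters, $h=\max_Th_T$. $\mathcal N_h,\mathcal F_h$ are the sets of nodes and faces, $\mathcal T_h^\Gamma=\{T\in\mathcal T_h:T\cap\Gamma\neq\emptyset\}$, $\mathcal F_h^\Gamma=\{F\in\mathcal F_h:F\cap\Gamma\ne\emptyset\}$, $\mathcal T_h^{non}=\mathcal T_h\setminus\mathcal T_h^\Gamma$; $\mathcal T_h^F$ is the set of elements sharing the face $F$. $h$ is smaller than a fixed threshold (so that the interface is resolved). $I_h$ is continuous piecewise linear nodal interpolation, $I_{h,T}$ linear nodal interpolation on $T$. $\Gamma_h=\{I_hd=0\}$, $\Omega_h^\pm=\{\pm I_hd>0\}$, $T_h^\pm=T\cap\Omega_h^\pm$, $\mu_h|_{\Omega_h^\pm}=\mu^\pm$.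 For $T\in\mathcal T_h^\Gamma$: $\Gamma_{h,T}=\Gamma_h\cap T$ (assumed nonempty), $\mathbf n_h$ is the unit normal to $\Gamma_{h,T}$ pointing from $\Omega_h^-$ to $\Omega_h^+$, $\mathbf x_T^*$ is a fixed point of $\Gamma_{h,T}$; $[v]_{\Gamma_{h,T}}$ is the value from $\Omega_h^+$ minus that from $\Omega_h^-$. Vertex values of functions discontinuous across $\Gamma_h$ at a vertex on $\Gamma_h$ are taken from the minus side. IFE space. $\sigma(\mu,\mathbf v,q)=\mu(\nabla\mathbf v+(\nabla\mathbf v)^T)-q\mathbb I$. $P_1(\cup T_h^\pm)$ is the set of functions on $T$ whose restrictions to $T_h^+$ and $T_h^-$ are polynomials of degree $\le1$, $\boldsymbol P_1(\cup T_h^\pm)=P_1(\cup T_h^\pm)^N$. For $T\in\mathcal T_h^\Gamma$, $\widetilde{\boldsymbol P_1P_1}(T)$ is the set of $(\mathbf v,q)\in(\boldsymbol P_1(\cup T_h^\pm),P_1(\cup T_h^\pm))$ with $[\sigma(\mu_h,\mathbf v,q)\mathbf n_h]_{\Gamma_{h,T}}(\mathbf x_T^* )=\mathbf 0$, $[\mathbf v]_{\Gamma_{h,T}}=\mathbf 0$, $[\nabla\cdot\mathbf v]_{\Gamma_{h,T}}=0$, $[\nabla q]_{\Gamma_{h,T}}=\mathbf 0$. $b_T$ is the standard polynomial bubble function of $T$ (product of barycentric coordinates, vanishing on $\partial T$). $\widetilde{\boldsymbol VQ_h}(\Omega)$ is the set of $(\mathbf v,q)$ with $(\mathbf v,q)|_T\in(P_1(T)^N,P_1(T))\oplus(\mathrm{span}\{b_T\}^N,\{0\})$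 for $T\in\mathcal T_h^{non}$, $(\mathbf v,q)|_T\in\widetilde{\boldsymbol P_1P_1}(T)\oplus(\mathrm{span}\{b_T\}^N,\{0\})$ for $T\in\mathcal T_h^\Gamma$, and $\mathbf v,q$ continuous at every node. Accordingly each $\mathbf v_h$ decomposes as $\mathbf v_h=\mathbf v_L+\mathbf v_b$ with $\mathbf v_b|_T\in\mathrm{span}\{b_T\}^N$ and $\mathbf v_L$ the (piecewise linear) remainder; $I_h^B\mathbf v_h:=I_h\mathbf v_L+\mathbf v_b$. Notation. $[v]_F=v|_{T_1}-v|_{T_2}$ for $F$ shared by $T_1,T_2$. On $T\in\mathcal T_h^\Gamma$, $q_h^\pm$ are the polynomial extensions of $q_h|_{T_h^\pm}$ and $[\![q_h^\pm]\!]=q_h^+-q_h^-$. Gradients of functions piecewise smooth on $T_h^\pm$ are taken piecewise; traces on $\partial T$ and $F$ are from inside the element. Constants may depend on $\Omega,\Gamma,\mu^\pm$ and the shape regularity. *)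

theory Defs
  imports "HOL-Analysis.Analysis"
begin

section \<open>Surface measure and \<open>L\<^sup>2\<close> norms\<close>

text \<open>The \<open>k\<close>-dimensional Hausdorff outer measure, with the usual normalisation, for \<open>k \<ge> 1\<close>
  (so that empty covering sets cost \<open>0\<close>).  Boundedness is required explicitly because
  \<^const>\<open>diameter\<close> is meaningless on unbounded sets.\<close>

definition hausdorff_content :: "nat \<Rightarrow> real \<Rightarrow> 'a::metric_space set \<Rightarrow> ennreal" where
  "hausdorff_content k \<delta> A =
     (INF U\<in>{U :: nat \<Rightarrow> 'a set. A \<subseteq> (\<Union>i. U i) \<and> (\<forall>i. bounded (U i) \<and> diameter (U i) \<le> \<delta>)}.
        \<Sum>i. ennreal (unit_ball_vol (real k) * (diameter (U i) / 2) ^ k))"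

definition hausdorff_outer :: "nat \<Rightarrow> 'a::metric_space set \<Rightarrow> ennreal" where
  "hausdorff_outer k A = (SUP \<delta>\<in>{0<..}. hausdorff_content k \<delta> A)"

text \<open>Restriction of the outer measure to its Caratheodory-measurable sets.  Since
  \<^const>\<open>measure_of\<close> is the null measure unless given a measure, it is shown below
  that this is one.\<close>

definition hausdorff_measure :: "nat \<Rightarrow> 'a::metric_space measure" where
  "hausdorff_measure k =
     measure_of UNIV (lambda_system UNIV (Pow UNIV) (hausdorff_outer k)) (hausdorff_outer k)"

lemma hausdorff_content_UN:
  "hausdorff_content k \<delta> (\<Union>i. A i) \<le> (\<Sum>i. hausdorff_content k \<delta> (A (i::nat)))"
proof (rule ennreal_le_epsilon)
  fix e :: real assume e: "e > 0" and fin: "(\<Sum>i. hausdorff_content k \<delta> (A i)) < top"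
  let ?w = "\<lambda>S::'a set. ennreal (unit_ball_vol (real k) * (diameter S / 2) ^ k)"
  let ?c = "\<lambda>i. ennreal (e * (1/2) ^ Suc i)"
  have "\<exists>U::nat \<Rightarrow> 'a set. (A i \<subseteq> (\<Union>j. U j) \<and> (\<forall>j. bounded (U j) \<and> diameter (U j) \<le> \<delta>)) \<and>
          (\<Sum>j. ?w (U j)) < hausdorff_content k \<delta> (A i) + ?c i" for i
  proof -
    have "hausdorff_content k \<delta> (A i) < top"
      using fin ennreal_suminf_lessD by blast
    then have "hausdorff_content k \<delta> (A i) < hausdorff_content k \<delta> (A i) + ?c i"
      using e by (simp add: ennreal_add_left_cancel_less less_top ennreal_zero_less_mult_iff)
    then show ?thesis
      unfolding hausdorff_content_def[of k \<delta> "A i"] INF_less_iff by blast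
  qed
  then obtain U where U: "\<And>i. A i \<subseteq> (\<Union>j. U i j)"
      "\<And>i j. bounded (U i j) \<and> diameter (U i j) \<le> \<delta>"
      "\<And>i. (\<Sum>j. ?w (U i j)) < hausdorff_content k \<delta> (A i) + ?c i" by metis
  define V where "V = case_prod U \<circ> prod_decode"
  have "(\<Union>i. A i) \<subseteq> (\<Union>n. V n)"
  proof
    fix x assume "x \<in> (\<Union>i. A i)"
    then obtain i j where "x \<in> U i j" using U(1) by blast
    then have "x \<in> V (prod_encode (i, j))" by (simp add: V_def)
    then show "x \<in> (\<Union>n. V n)" by blast
  qed
  moreover have "bounded (V n) \<and> diameter (V n) \<le> \<delta>" for n
    using U(2) by (auto simp: V_def split: prod.splits)
  ultimately have "hausdorff_content k \<delta> (\<Union>i. A i) \<le> (\<Sum>n. ?w (V n))"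
    unfolding hausdorff_content_def by (intro INF_lower) auto
  also have "(\<Sum>n. ?w (V n)) = (\<Sum>n. (\<lambda>(i,j). ?w (U i j)) (prod_decode n))"
    by (simp add: V_def case_prod_unfold)
  also have "\<dots> = (\<Sum>i. \<Sum>j. ?w (U i j))"
    by (rule suminf_ennreal_2dimen) (simp only: prod.case)
  also have "\<dots> \<le> (\<Sum>i. hausdorff_content k \<delta> (A i) + ?c i)"
    by (intro suminf_le less_imp_le U(3)) auto
  also have "\<dots> = (\<Sum>i. hausdorff_content k \<delta> (A i)) + (\<Sum>i. ?c i)"
    by (rule suminf_add[symmetric]) auto
  also have "(\<Sum>i. ?c i) = ennreal e"
  proof (rule suminf_ennreal_eq)
    show "(\<lambda>i. e * (1/2) ^ Suc i) sums e"
      using sums_mult[OF power_half_series, of e] by (simp only: mult_1_right)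
  qed (use e in simp)
  finally show "hausdorff_content k \<delta> (\<Union>i. A i) \<le> (\<Sum>i. hausdorff_content k \<delta> (A i)) + ennreal e" .
qed

lemma outer_measure_space_hausdorff:
  assumes "k \<ge> 1"
  shows "outer_measure_space (Pow UNIV) (hausdorff_outer k :: 'a::metric_space set \<Rightarrow> ennreal)"
  unfolding outer_measure_space_def
proof (intro conjI)
  have "hausdorff_content k \<delta> ({} :: 'a set) = 0" if "\<delta> > 0" for \<delta>
  proof -
    have "hausdorff_content k \<delta> ({} :: 'a set) \<le>
        (\<Sum>i::nat. ennreal (unit_ball_vol (real k) * (diameter ({}::'a set) / 2) ^ k))"
      unfolding hausdorff_content_def
      by (rule INF_lower2[where i="\<lambda>_. {}"]) (use that in auto)
    also have "\<dots> = 0" using assms by (simp add: power_0_left)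
    finally show ?thesis by simp
  qed
  then show "positive (Pow UNIV) (hausdorff_outer k :: 'a set \<Rightarrow> ennreal)"
    by (auto simp: positive_def hausdorff_outer_def)
next
  show "increasing (Pow UNIV) (hausdorff_outer k :: 'a set \<Rightarrow> ennreal)"
    unfolding increasing_def hausdorff_outer_def hausdorff_content_def
    by (intro ballI impI SUP_mono' INF_superset_mono) auto
next
  show "countably_subadditive (Pow UNIV) (hausdorff_outer k :: 'a set \<Rightarrow> ennreal)"
    unfolding countably_subadditive_def
  proof (intro allI impI)
    fix A :: "nat \<Rightarrow> 'a set"
    show "hausdorff_outer k (\<Union>i. A i) \<le> (\<Sum>i. hausdorff_outer k (A i))"
      unfolding hausdorff_outer_def[of k "\<Union>i. A i"]
    proof (rule SUP_least)
      fix \<delta> :: real assume "\<delta> \<in> {0<..}"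
      then have "hausdorff_content k \<delta> (A i) \<le> hausdorff_outer k (A i)" for i
        unfolding hausdorff_outer_def by (intro SUP_upper)
      then show "hausdorff_content k \<delta> (\<Union>i. A i) \<le> (\<Sum>i. hausdorff_outer k (A i))"
        by (intro order_trans[OF hausdorff_content_UN] suminf_le) auto
    qed
  qed
qed

lemma
  fixes A :: "'a::metric_space set"
  assumes "k \<ge> 1"
  shows sets_hausdorff_measure:
      "sets (hausdorff_measure k :: 'a measure) =
        lambda_system UNIV (Pow UNIV) (hausdorff_outer k)" (is ?s)
    and emeasure_hausdorff_measure:
      "A \<in> sets (hausdorff_measure k) \<Longrightarrow> emeasure (hausdorff_measure k) A = hausdorff_outer k A"
proof -
  have ms: "measure_space UNIV (lambda_system UNIV (Pow UNIV) (hausdorff_outer k))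
      (hausdorff_outer k :: 'a set \<Rightarrow> ennreal)"
    using sigma_algebra.caratheodory_lemma[OF sigma_algebra_Pow outer_measure_space_hausdorff[OF assms]] .
  then interpret sigma_algebra UNIV "lambda_system UNIV (Pow UNIV) (hausdorff_outer k :: 'a set \<Rightarrow> ennreal)"
    by (simp add: measure_space_def)
  show s: ?s
    unfolding hausdorff_measure_def
    by (rule trans[OF sets_measure_of sigma_sets_eq]) simp
  show "emeasure (hausdorff_measure k) A = hausdorff_outer k A" if "A \<in> sets (hausdorff_measure k)"
    unfolding hausdorff_measure_def
  proof (rule emeasure_measure_of_sigma)
    show "sigma_algebra UNIV (lambda_system UNIV (Pow UNIV) (hausdorff_outer k :: 'a set \<Rightarrow> ennreal))"
      "positive (lambda_system UNIV (Pow UNIV) (hausdorff_outer k)) (hausdorff_outer k :: 'a set \<Rightarrow> ennreal)"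
      "countably_additive (lambda_system UNIV (Pow UNIV) (hausdorff_outer k)) (hausdorff_outer k :: 'a set \<Rightarrow> ennreal)"
      using ms unfolding measure_space_def by blast+
    show "A \<in> lambda_system UNIV (Pow UNIV) (hausdorff_outer k)"
      using that s by blast
  qed
qed

definition L2norm :: "'a measure \<Rightarrow> 'a set \<Rightarrow> ('a \<Rightarrow> 'b::real_normed_vector) \<Rightarrow> real" where
  "L2norm M S f = sqrt (LINT x:S|M. (norm (f x))\<^sup>2)"

abbreviation L2vol :: "(real^'n) set \<Rightarrow> (real^'n \<Rightarrow> 'b::real_normed_vector) \<Rightarrow> real" where
  "L2vol S f \<equiv> L2norm lebesgue S f"

abbreviation L2surf :: "(real^'n) set \<Rightarrow> (real^'n \<Rightarrow> 'b::real_normed_vector) \<Rightarrow> real" where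
  "L2surf S f \<equiv> L2norm (hausdorff_measure (CARD('n) - 1)) S f"


section \<open>Pointwise differential operators, traces, jumps\<close>

definition jac :: "(real^'n \<Rightarrow> real^'n) \<Rightarrow> real^'n \<Rightarrow> real^'n^'n" where
  "jac v x = jacobian v (at x)"

definition grad :: "(real^'n \<Rightarrow> real) \<Rightarrow> real^'n \<Rightarrow> real^'n" where
  "grad q x = (\<chi> i. frechet_derivative q (at x) (axis i 1))"

definition divg :: "(real^'n \<Rightarrow> real^'n) \<Rightarrow> real^'n \<Rightarrow> real" where
  "divg v x = trace (jac v x)"

text \<open>The seminorms of \<open>H\<^sup>m(S)\<close>, used only for \<open>m = 0, 1\<close>.  The gradient is the pointwise
  one; for piecewise smooth functions it exists off a null set and is the piecewise gradient.
  The norm of a matrix is the Frobenius norm.\<close>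

definition Hsemi :: "nat \<Rightarrow> (real^'n) set \<Rightarrow> (real^'n \<Rightarrow> real^'n) \<Rightarrow> real" where
  "Hsemi m S v = (if m = 0 then L2vol S v else L2vol S (jac v))"

definition trace_from :: "'a::metric_space set \<Rightarrow> ('a \<Rightarrow> 'b::t2_space) \<Rightarrow> 'a \<Rightarrow> 'b" where
  "trace_from S f x = Lim (at x within S) f"


section \<open>The interface\<close>

definition C2_hypersurface :: "(real^'n) set \<Rightarrow> bool" where
  "C2_hypersurface \<Gamma> \<longleftrightarrow>
     (\<forall>x\<in>\<Gamma>. \<exists>U (\<phi> :: real^'n \<Rightarrow> real) g H. open U \<and> x \<in> U \<and>
        (\<forall>y\<in>U. (\<phi> has_derivative (\<lambda>h. g y \<bullet> h)) (at y)) \<and>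
        (\<forall>y\<in>U. (g has_derivative (\<lambda>h. H y *v h)) (at y)) \<and>
        continuous_on U H \<and>
        (\<forall>y\<in>U. g y \<noteq> 0) \<and>
        \<Gamma> \<inter> U = {y\<in>U. \<phi> y = 0})"

text \<open>\<open>\<Gamma>\<close> divides \<open>\<Omega>\<close> into the inclusion \<open>\<Omega>m\<close> and \<open>\<Omega> - (\<Omega>m \<union> \<Gamma>)\<close>; the last conjunct says
  that the latter touches all of \<open>\<Gamma>\<close>, so that \<open>\<Omega>m\<close> lies on only one side of \<open>\<Gamma>\<close>.\<close>

definition C2_interface :: "(real^'n) set \<Rightarrow> (real^'n) set \<Rightarrow> (real^'n) set \<Rightarrow> bool" where
  "C2_interface \<Omega> \<Gamma> \<Omega>m \<longleftrightarrow>
     compact \<Gamma> \<and> \<Gamma> \<subseteq> \<Omega> \<and> C2_hypersurface \<Gamma> \<and>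
     open \<Omega>m \<and> \<Omega>m \<noteq> {} \<and> \<Omega>m \<subseteq> \<Omega> \<and> frontier \<Omega>m = \<Gamma> \<and>
     \<Gamma> \<subseteq> frontier (\<Omega> - (\<Omega>m \<union> \<Gamma>))"

definition signed_dist :: "(real^'n) set \<Rightarrow> (real^'n) set \<Rightarrow> real^'n \<Rightarrow> real" where
  "signed_dist \<Omega>m \<Gamma> x = (if x \<in> \<Omega>m then - infdist x \<Gamma> else infdist x \<Gamma>)"


section \<open>Cartesian simplicial meshes\<close>

text \<open>Elements and faces are represented by their vertex sets; the open element or face itself
  is the open simplex spanned by these.\<close>

definition open_simplex :: "(real^'n) set \<Rightarrow> (real^'n) set" where
  "open_simplex V = rel_interior (convex hull V)"

definition hdiam :: "(real^'n) set \<Rightarrow> real" where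
  "hdiam V = diameter (open_simplex V)"

text \<open>Kuhn simplex in the cell with lower corner \<open>(X i (k i))\<^sub>i\<close>: the vertices are those of the
  edge path that starts at one endpoint of the chosen space diagonal (the corner whose coordinates
  in \<open>D\<close> are the upper ones) and changes the coordinates one after another in the order \<open>is\<close>
  until the opposite corner is reached.  For two dimensions this yields the two triangles
  on either side of a diagonal.\<close>

definition kuhn_simplex ::
  "('n::finite \<Rightarrow> nat \<Rightarrow> real) \<Rightarrow> ('n \<Rightarrow> nat) \<Rightarrow> 'n set \<Rightarrow> 'n list \<Rightarrow> (real^'n) set" where
  "kuhn_simplex X k D is =
     (\<lambda>j. \<chi> i. X i (if (i \<in> set (take j is)) \<noteq> (i \<in> D) then Suc (k i) else k i)) ` {0..CARD('n)}"

definition cartesian_mesh :: "real^'n \<Rightarrow> real^'n \<Rightarrow> (real^'n) set set \<Rightarrow> bool" where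
  "cartesian_mesh a b \<T> \<longleftrightarrow>
     (\<exists>(X :: 'n \<Rightarrow> nat \<Rightarrow> real) m D.
        (\<forall>i. X i 0 = a $ i \<and> X i (m i) = b $ i \<and> strict_mono_on {0..m i} (X i)) \<and>
        \<T> = {kuhn_simplex X k D is | k is.
               (\<forall>i. k i < m i) \<and> distinct is \<and> set is = UNIV})"

definition mesh_size :: "(real^'n) set set \<Rightarrow> real" where
  "mesh_size \<T> = Max (hdiam ` \<T>)"

definition shape_regular :: "real \<Rightarrow> (real^'n) set set \<Rightarrow> bool" where
  "shape_regular \<rho> \<T> \<longleftrightarrow> (\<forall>T\<in>\<T>. \<exists>x r. 0 < r \<and> ball x r \<subseteq> open_simplex T \<and> hdiam T \<le> \<rho> * r)"

definition nodes :: "(real^'n) set set \<Rightarrow> (real^'n) set" where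
  "nodes \<T> = \<Union>\<T>"

definition faces :: "(real^'n) set set \<Rightarrow> (real^'n) set set" where
  "faces \<T> = {T - {x} | T x. T \<in> \<T> \<and> x \<in> T}"

definition face_elems :: "(real^'n) set set \<Rightarrow> (real^'n) set \<Rightarrow> (real^'n) set set" where
  "face_elems \<T> F = {T\<in>\<T>. F \<subseteq> T}"

text \<open>Interface elements \<open>\<T>\<^sub>h\<^sup>\<Gamma>\<close> and, applied to \<^term>\<open>faces \<T>\<close>, interface faces \<open>\<F>\<^sub>h\<^sup>\<Gamma>\<close>.\<close>

definition cut_by :: "(real^'n) set \<Rightarrow> (real^'n) set set \<Rightarrow> (real^'n) set set" where
  "cut_by \<Gamma> \<S> = {S\<in>\<S>. open_simplex S \<inter> \<Gamma> \<noteq> {}}"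


section \<open>Linear polynomials and interpolation\<close>

definition P1 :: "('a::real_vector \<Rightarrow> 'b::real_vector) \<Rightarrow> bool" where
  "P1 p \<longleftrightarrow> (\<exists>L c. linear L \<and> (\<forall>x. p x = L x + c))"

definition P1_on :: "'a::real_vector set \<Rightarrow> ('a \<Rightarrow> 'b::real_vector) \<Rightarrow> bool" where
  "P1_on S f \<longleftrightarrow> (\<exists>p. P1 p \<and> (\<forall>x\<in>S. f x = p x))"

definition P1_ext :: "'a::real_vector set \<Rightarrow> ('a \<Rightarrow> 'b::real_vector) \<Rightarrow> 'a \<Rightarrow> 'b" where
  "P1_ext S f = (THE p. P1 p \<and> (\<forall>x\<in>S. f x = p x))"

definition bary :: "(real^'n) set \<Rightarrow> real^'n \<Rightarrow> real^'n \<Rightarrow> real" where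
  "bary T z = (THE l. P1 l \<and> l z = 1 \<and> (\<forall>y\<in>T - {z}. l y = 0))"

definition bubble :: "(real^'n) set \<Rightarrow> real^'n \<Rightarrow> real" where
  "bubble T x = (\<Prod>z\<in>T. bary T z x)"

text \<open>Linear interpolation of the nodal values \<open>g\<close>; the restriction to \<open>T\<close> of the
  continuous piecewise linear interpolant on the whole mesh.\<close>

definition interp :: "(real^'n) set \<Rightarrow> (real^'n \<Rightarrow> 'b::real_vector) \<Rightarrow> real^'n \<Rightarrow> 'b" where
  "interp T g x = (\<Sum>z\<in>T. bary T z x *\<^sub>R g z)"


section \<open>The discrete interface\<close>

text \<open>From here on \<open>d\<close> is the signed distance; \<open>elem_plus\<close>, \<open>elem_minus\<close> and \<open>Gam\<close> are
  \<open>T\<^sub>h\<^sup>+\<close>, \<open>T\<^sub>h\<^sup>-\<close> and \<open>\<Gamma>\<^sub>h \<inter> T\<close>.\<close>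

definition elem_plus :: "(real^'n \<Rightarrow> real) \<Rightarrow> (real^'n) set \<Rightarrow> (real^'n) set" where
  "elem_plus d T = {x\<in>open_simplex T. interp T d x > 0}"

definition elem_minus :: "(real^'n \<Rightarrow> real) \<Rightarrow> (real^'n) set \<Rightarrow> (real^'n) set" where
  "elem_minus d T = {x\<in>open_simplex T. interp T d x < 0}"

definition Gam :: "(real^'n \<Rightarrow> real) \<Rightarrow> (real^'n) set \<Rightarrow> (real^'n) set" where
  "Gam d T = {x\<in>open_simplex T. interp T d x = 0}"

definition normal_h :: "(real^'n \<Rightarrow> real) \<Rightarrow> (real^'n) set \<Rightarrow> real^'n" where
  "normal_h d T = (THE n. norm n = 1 \<and>
     (\<forall>x\<in>Gam d T. \<forall>y\<in>Gam d T. n \<bullet> (y - x) = 0) \<and>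
     (\<forall>x\<in>Gam d T. \<exists>e>0. \<forall>t. 0 < t \<and> t < e \<longrightarrow>
        x + t *\<^sub>R n \<in> elem_plus d T \<and> x - t *\<^sub>R n \<in> elem_minus d T))"

definition mu_h ::
  "(real^'n \<Rightarrow> real) \<Rightarrow> real \<Rightarrow> real \<Rightarrow> (real^'n) set \<Rightarrow> real^'n \<Rightarrow> real" where
  "mu_h d \<mu>p \<mu>m T x = (if x \<in> elem_plus d T then \<mu>p else \<mu>m)"

definition jump_h ::
  "(real^'n \<Rightarrow> real) \<Rightarrow> (real^'n) set \<Rightarrow> (real^'n \<Rightarrow> 'b::real_normed_vector) \<Rightarrow> real^'n \<Rightarrow> 'b" where
  "jump_h d T f x = trace_from (elem_plus d T) f x - trace_from (elem_minus d T) f x"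

text \<open>Values on \<open>\<Gamma>\<^sub>h\<close> of functions given piecewise on \<open>T\<^sub>h\<^sup>\<plusminus>\<close> carry no information, so traces
  from inside \<open>T\<close> are taken along \<open>T - \<Gamma>\<^sub>h\<close>.  On \<open>\<partial>T \<inter> \<Gamma>\<^sub>h\<close>, which has no surface measure,
  the trace of a discontinuous function is an irrelevant default value.\<close>

definition inner_trace ::
  "(real^'n \<Rightarrow> real) \<Rightarrow> (real^'n) set \<Rightarrow> (real^'n \<Rightarrow> 'b::t2_space) \<Rightarrow> real^'n \<Rightarrow> 'b" where
  "inner_trace d T f x = trace_from (open_simplex T - Gam d T) f x"

text \<open>Value from \<open>T\<close> at its vertex \<open>z\<close>.  The vertex lies on \<open>\<Gamma>\<^sub>h\<close> iff \<open>d z = 0\<close>, and then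
  the minus side decides if there is one in \<open>T\<close>.\<close>

definition nodal_value ::
  "(real^'n \<Rightarrow> real) \<Rightarrow> (real^'n) set \<Rightarrow> (real^'n \<Rightarrow> 'b::t2_space) \<Rightarrow> real^'n \<Rightarrow> 'b" where
  "nodal_value d T f z =
     (if d z = 0 \<and> elem_minus d T \<noteq> {} then trace_from (elem_minus d T) f z
      else inner_trace d T f z)"

abbreviation nodal_interp ::
  "(real^'n \<Rightarrow> real) \<Rightarrow> (real^'n) set \<Rightarrow> (real^'n \<Rightarrow> 'b::{t2_space,real_vector}) \<Rightarrow> real^'n \<Rightarrow> 'b"
  where "nodal_interp d T f \<equiv> interp T (nodal_value d T f)"


section \<open>The immersed finite element space\<close>

definition stress ::
  "(real^'n \<Rightarrow> real) \<Rightarrow> (real^'n \<Rightarrow> real^'n) \<Rightarrow> (real^'n \<Rightarrow> real) \<Rightarrow> real^'n \<Rightarrow> real^'n^'n" where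
  "stress \<mu> v q x = \<mu> x *\<^sub>R (jac v x + transpose (jac v x)) - mat (q x)"

text \<open>The local space on an interface element; \<open>xs\<close> is the point \<open>x\<^sub>T\<^sup>*\<close>.\<close>

definition IFE_local ::
  "(real^'n \<Rightarrow> real) \<Rightarrow> real \<Rightarrow> real \<Rightarrow> real^'n \<Rightarrow> (real^'n) set \<Rightarrow>
   ((real^'n \<Rightarrow> real^'n) \<times> (real^'n \<Rightarrow> real)) set" where
  "IFE_local d \<mu>p \<mu>m xs T = {(v, q).
     P1_on (elem_plus d T) v \<and> P1_on (elem_minus d T) v \<and>
     P1_on (elem_plus d T) q \<and> P1_on (elem_minus d T) q \<and>
     jump_h d T (\<lambda>x. stress (mu_h d \<mu>p \<mu>m T) v q x *v normal_h d T) xs = 0 \<and>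
     (\<forall>x\<in>Gam d T. jump_h d T v x = 0) \<and>
     (\<forall>x\<in>Gam d T. jump_h d T (divg v) x = 0) \<and>
     (\<forall>x\<in>Gam d T. jump_h d T (grad q) x = 0)}"

definition VQ_space ::
  "(real^'n \<Rightarrow> real) \<Rightarrow> (real^'n) set \<Rightarrow> real \<Rightarrow> real \<Rightarrow> ((real^'n) set \<Rightarrow> real^'n) \<Rightarrow>
   (real^'n) set set \<Rightarrow> ((real^'n \<Rightarrow> real^'n) \<times> (real^'n \<Rightarrow> real)) set" where
  "VQ_space d \<Gamma> \<mu>p \<mu>m xs \<T> = {(v, q).
     (\<forall>T\<in>\<T> - cut_by \<Gamma> \<T>. \<exists>\<beta>.
        P1_on (open_simplex T) (\<lambda>x. v x - bubble T x *\<^sub>R \<beta>) \<and> P1_on (open_simplex T) q) \<and>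
     (\<forall>T\<in>cut_by \<Gamma> \<T>. \<exists>\<beta>.
        ((\<lambda>x. v x - bubble T x *\<^sub>R \<beta>), q) \<in> IFE_local d \<mu>p \<mu>m (xs T) T) \<and>
     (\<forall>z\<in>nodes \<T>. \<forall>T\<in>\<T>. \<forall>T'\<in>\<T>. z \<in> T \<and> z \<in> T' \<longrightarrow>
        nodal_value d T v z = nodal_value d T' v z \<and>
        nodal_value d T q z = nodal_value d T' q z)}"

text \<open>The decomposition \<open>v = v\<^sub>L + v\<^sub>b\<close> on \<open>T\<close>; the bubble coefficient is unique since the
  bubble is not linear on any nonempty open set.\<close>

definition bubble_coeff ::
  "(real^'n \<Rightarrow> real) \<Rightarrow> (real^'n) set \<Rightarrow> (real^'n \<Rightarrow> real^'n) \<Rightarrow> real^'n" where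
  "bubble_coeff d T v = (THE \<beta>.
     P1_on (elem_plus d T) (\<lambda>x. v x - bubble T x *\<^sub>R \<beta>) \<and>
     P1_on (elem_minus d T) (\<lambda>x. v x - bubble T x *\<^sub>R \<beta>))"

definition bubble_part ::
  "(real^'n \<Rightarrow> real) \<Rightarrow> (real^'n) set \<Rightarrow> (real^'n \<Rightarrow> real^'n) \<Rightarrow> real^'n \<Rightarrow> real^'n" where
  "bubble_part d T v x = bubble T x *\<^sub>R bubble_coeff d T v"

definition linear_part ::
  "(real^'n \<Rightarrow> real) \<Rightarrow> (real^'n) set \<Rightarrow> (real^'n \<Rightarrow> real^'n) \<Rightarrow> real^'n \<Rightarrow> real^'n" where
  "linear_part d T v x = v x - bubble_part d T v x"

definition IhB ::
  "(real^'n \<Rightarrow> real) \<Rightarrow> (real^'n) set \<Rightarrow> (real^'n \<Rightarrow> real^'n) \<Rightarrow> real^'n \<Rightarrow> real^'n" where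
  "IhB d T v x = nodal_interp d T (linear_part d T v) x + bubble_part d T v x"

definition ext_jump ::
  "(real^'n \<Rightarrow> real) \<Rightarrow> (real^'n) set \<Rightarrow> (real^'n \<Rightarrow> real) \<Rightarrow> real^'n \<Rightarrow> real" where
  "ext_jump d T q x = P1_ext (elem_plus d T) q x - P1_ext (elem_minus d T) q x"

definition face_jump ::
  "(real^'n \<Rightarrow> real) \<Rightarrow> (real^'n) set \<Rightarrow> (real^'n) set \<Rightarrow>
   (real^'n \<Rightarrow> 'b::real_normed_vector) \<Rightarrow> real^'n \<Rightarrow> 'b" where
  "face_jump d T1 T2 f x = inner_trace d T1 f x - inner_trace d T2 f x"

end

theory Submission
  imports Defs
begin

text \<open>On an interface element \<open>T\<close> the two linear pieces of a velocity differ by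
  \<open>(n \<bullet> (x - x\<^sup>*)) c\<close> with \<open>c \<bullet> n = 0\<close>, and those of a pressure by a constant \<open>\<kappa>\<close>.
  Multiplying the stress condition by \<open>n\<close> gives \<open>\<bar>\<kappa>\<bar> + \<bar>c\<bar> \<le> C \<bar>\<nabla>v\<^sub>L\<bar>\<close> with the gradient taken on either
  side, so it suffices to control the coefficients of \<open>(v, q)\<close> on one side.  The side containing the
  centroid of \<open>T\<close> also contains a neighbourhood of some vertex that is described by barycentric
  coordinates alone.  There, second differences along an edge isolate the bubble coefficient, and
  all coefficients are bounded by the maximum of \<open>v\<close> or \<open>\<nabla>v\<close>, hence by the \<open>L\<^sup>2\<close> norm, since the
  Lipschitz constant is controlled by the same maximum.  Left-hand sides need only upper
  bounds for surface measures of pieces of hyperplanes.  Traces on a face differ from the linear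
  interpolant of the shared nodal values by at most \<open>\<bar>\<kappa>\<bar>\<close> or \<open>h\<^sub>T \<bar>c\<bar>\<close> for each neighbour.\<close>

section \<open>Hausdorff measure and norms\<close>

text \<open>The obstacle is that one side of T may be an arbitrarily thin sliver, on which no norm
  controls the coefficients uniformly. So they are bounded on one favourable side, selected by the
  sign of the sum of the nodal values of \<open>d\<close>, and carried to the other at the price of
  a factor \<open>1 + J\<close> that depends on the viscosities alone. Which side this is varies
  with the element; hence the jumps are bounded by the gradient of either side. The region near a
  vertex is where its barycentric coordinate exceeds N/(N+1): there a linear function with
  nonnegative sum of vertex values is positive, if the vertex is one of maximal value.
  \<open>margin\<close> is a step size that leaves room for two steps in this region. The regularity
  of the interface serves to exclude that \<open>d\<close> vanishes at all vertices of an element,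
  since then its interpolant would be 0 and T would have no sides; the threshold \<open>h0\<close>
  stems from this. Dividing an L2 norm over T by \<open>sqrt (h ^ N)\<close> turns it into a mean
  size of the function. The other powers of \<open>h\<close> come from surface measures of order
  \<open>h ^ (N - 1)\<close> and from gradients of barycentric coordinates of order
  \<open>1 / h\<close>.\<close>

lemma hausdorff_content_finite_cover:
  fixes A :: "'a::metric_space set"
  assumes "k \<ge> 1" "finite \<U>" "A \<subseteq> \<Union>\<U>" "e \<ge> 0" "e \<le> \<delta>"
    and diam: "\<And>U. U \<in> \<U> \<Longrightarrow> bounded U \<and> diameter U \<le> e"
  shows "hausdorff_content k \<delta> A \<le> ennreal (real (card \<U>) * (unit_ball_vol (real k) * (e / 2) ^ k))"
proof -
  let ?w = "\<lambda>S::'a set. unit_ball_vol (real k) * (diameter S / 2) ^ k"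
  obtain f where f: "bij_betw f {0..<card \<U>} \<U>"
    using ex_bij_betw_nat_finite[OF \<open>finite \<U>\<close>] by blast
  \<comment> \<open>A content is an infimum over sequences of sets; the finite cover is padded with
    empty sets, which cost nothing because \<open>k >= 1\<close> makes
    \<open>0 ^ k = 0\<close>.\<close>
  define U where "U i = (if i < card \<U> then f i else {})" for i
  have fU: "f i \<in> \<U>" if "i < card \<U>" for i
    using f that by (auto simp: bij_betw_def)
  have "A \<subseteq> (\<Union>i. U i)"
  proof
    fix x assume "x \<in> A"
    then obtain V where "V \<in> \<U>" "x \<in> V" using assms(3) by blast
    moreover from this have "V \<in> f ` {0..<card \<U>}" using bij_betw_imp_surj_on[OF f] by simp
    then obtain i where "i < card \<U>" "f i = V" by auto
    ultimately show "x \<in> (\<Union>i. U i)" by (auto simp: U_def)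
  qed
  moreover have "bounded (U i) \<and> diameter (U i) \<le> \<delta>" for i
  proof (cases "i < card \<U>")
    case True
    then show ?thesis using diam[OF fU[OF True]] \<open>e \<le> \<delta>\<close> by (simp add: U_def)
  next
    case False
    then show ?thesis using \<open>e \<le> \<delta>\<close> \<open>e \<ge> 0\<close> by (simp add: U_def)
  qed
  ultimately have "hausdorff_content k \<delta> A \<le> (\<Sum>i. ennreal (?w (U i)))"
    unfolding hausdorff_content_def by (intro INF_lower) auto
  also have "\<dots> = (\<Sum>i<card \<U>. ennreal (?w (U i)))"
    by (rule suminf_finite) (use \<open>k \<ge> 1\<close> in \<open>auto simp: U_def power_0_left\<close>)
  also have "\<dots> \<le> (\<Sum>i<card \<U>. ennreal (unit_ball_vol (real k) * (e / 2) ^ k))"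
  proof (intro sum_mono ennreal_leI mult_left_mono power_mono)
    fix i assume "i \<in> {..<card \<U>}"
    then show "diameter (U i) / 2 \<le> e / 2" using diam[OF fU] by (auto simp: U_def)
    show "0 \<le> diameter (U i) / 2"
      using diam[OF fU[of i]] \<open>i \<in> _\<close> by (simp add: U_def diameter_ge_0)
  qed auto
  also have "\<dots> = ennreal (real (card \<U>) * (unit_ball_vol (real k) * (e / 2) ^ k))"
    using \<open>e \<ge> 0\<close> by (simp add: ennreal_mult ennreal_of_nat_eq_real_of_nat)
  finally show ?thesis .
qed

text \<open>The interval from -R to R is cut into n cells of half-length R/n; the i-th one has its
  midpoint at \<open>- R + (2 * i + 1) * R / n\<close>.\<close>

lemma interval_subdivision:
  fixes t R :: real and n :: nat
  assumes "\<bar>t\<bar> \<le> R" "n \<ge> 1"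
  shows "\<exists>i<n. \<bar>t - (- R + (2 * real i + 1) * R / n)\<bar> \<le> R / n"
proof (cases "R = 0 \<or> t = R")
  case True
  then show ?thesis
  proof
    assume "R = 0" then show ?thesis using assms by (intro exI[of _ 0]) auto
  next
    \<comment> \<open>The right endpoint is treated apart because the floor formula below would put
      it into a cell with index n.\<close>
    assume t: "t = R"
    have "t - (- R + (2 * real (n-1) + 1) * R / n) = R / n"
      using \<open>n \<ge> 1\<close> t by (simp add: field_simps of_nat_diff)
    moreover have "R \<ge> 0" using assms by auto
    ultimately show ?thesis using \<open>n \<ge> 1\<close> by (intro exI[of _ "n-1"]) auto
  qed
next
  case False
  then have R: "R > 0" "t < R" "-R \<le> t" using assms by auto
  define s where "s = (t + R) * n / (2 * R)"
  define i where "i = nat \<lfloor>s\<rfloor>"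
  have "(t + R) * n \<ge> 0" "(t + R) * n < 2 * R * n"
    using R assms(2) by (auto intro!: mult_strict_right_mono)
  then have "s \<ge> 0" "s < n" using R by (auto simp: s_def field_simps)
  then have i: "real i \<le> s" "s < real i + 1" by (auto simp: i_def)
  have t: "t = 2 * R * s / n - R" using R assms(2) by (simp add: s_def)
  have "\<bar>t - (- R + (2 * real i + 1) * R / n)\<bar> = \<bar>2 * (s - i) - 1\<bar> * R / n"
  proof -
    have "t - (- R + (2 * real i + 1) * R / n) = (2 * (s - i) - 1) * (R / n)"
      unfolding t by (simp add: field_simps add_divide_distrib diff_divide_distrib)
    then show ?thesis using R by (simp add: abs_mult)
  qed
  also have "\<dots> \<le> 1 * R / n"
    using i R by (intro divide_right_mono mult_right_mono) auto
  finally show ?thesis using i \<open>s < n\<close> by (intro exI[of _ i]) auto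
qed

text \<open>The cells are cubes of side \<open>2 * R / n\<close> in orthonormal coordinates of
  \<open>S\<close>. Their diameter is estimated by the sum of the coordinate differences, hence the
  factor \<open>dim S\<close> where \<open>sqrt (dim S)\<close> would be sharp.\<close>

lemma grid_cover:
  fixes A :: "'a::euclidean_space set"
  assumes S: "subspace S" and A: "\<And>x. x \<in> A \<Longrightarrow> x - p \<in> S \<and> norm (x - p) \<le> R"
    and n: "n \<ge> 1"
  shows "\<exists>\<U>. finite \<U> \<and> card \<U> \<le> n ^ dim S \<and> A \<subseteq> \<Union>\<U> \<and>
           (\<forall>U\<in>\<U>. bounded U \<and> diameter U \<le> 2 * (real (dim S) * R) / n)"
proof (cases "A = {}")
  case True
  then show ?thesis by (intro exI[of _ "{}"]) auto
next
  case False
  then have R: "R \<ge> 0" using A norm_ge_zero order_trans by blast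
  obtain B where B: "B \<subseteq> S" "pairwise orthogonal B" "\<And>x. x \<in> B \<Longrightarrow> norm x = 1"
      "independent B" "card B = dim S" "span B = S"
    using orthonormal_basis_subspace[OF S] by blast
  have fB: "finite B" using B(4) by (rule independent_imp_finite)
  define cell where "cell c = {y\<in>A. \<forall>b\<in>B. \<bar>(y - p) \<bullet> b - (- R + (2 * real (c b) + 1) * R / n)\<bar> \<le> R / n}"
    for c :: "'a \<Rightarrow> nat"
  let ?\<U> = "cell ` (PiE B (\<lambda>_. {..<n}))"
  have fin: "finite (PiE B (\<lambda>_. {..<n}))" using fB by (intro finite_PiE) auto
  have "card ?\<U> \<le> card (PiE B (\<lambda>_. {..<n}))" by (rule card_image_le[OF fin])
  also have "\<dots> = n ^ dim S" using fB B(5) by (simp add: card_PiE)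
  finally have card: "card ?\<U> \<le> n ^ dim S" .
  have cover: "A \<subseteq> \<Union>?\<U>"
  proof
    fix y assume y: "y \<in> A"
    have "\<exists>i<n. \<bar>(y - p) \<bullet> b - (- R + (2 * real i + 1) * R / n)\<bar> \<le> R / n" if "b \<in> B" for b
    proof (rule interval_subdivision[OF _ n])
      have "\<bar>(y - p) \<bullet> b\<bar> \<le> norm (y - p) * norm b" by (rule Cauchy_Schwarz_ineq2)
      then show "\<bar>(y - p) \<bullet> b\<bar> \<le> R" using A[OF y] B(3)[OF that] by simp
    qed
    then obtain c where c: "\<And>b. b \<in> B \<Longrightarrow> c b < n \<and>
        \<bar>(y - p) \<bullet> b - (- R + (2 * real (c b) + 1) * R / n)\<bar> \<le> R / n" by metis
    then have "y \<in> cell (restrict c B)" using y by (simp add: cell_def)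
    moreover have "restrict c B \<in> PiE B (\<lambda>_. {..<n})" using c by auto
    ultimately show "y \<in> \<Union>?\<U>" by blast
  qed
  have diam: "bounded (cell c) \<and> diameter (cell c) \<le> 2 * (real (dim S) * R) / n" for c
  proof
    have "norm (x - y) \<le> 2 * (real (dim S) * R) / n" if "x \<in> cell c" "y \<in> cell c" for x y
    proof -
      have xy: "x \<in> A" "y \<in> A" using that by (auto simp: cell_def)
      have "x - y = (x - p) - (y - p)" by simp
      also have "\<dots> \<in> S" by (rule subspace_diff[OF S]) (use A xy in blast)+
      finally have "x - y \<in> span B" using B(6) by simp
      then have "norm (x - y) = norm (\<Sum>b\<in>B. ((x - y) \<bullet> b) *\<^sub>R b)"
        using orthonormal_basis_expand[OF B(2) B(3) _ fB] by metis
      also have "\<dots> \<le> (\<Sum>b\<in>B. 2 * R / n)"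
      proof (rule sum_norm_le)
        fix b assume b: "b \<in> B"
        let ?m = "- R + (2 * real (c b) + 1) * R / n"
        have "\<bar>(x - p) \<bullet> b - ?m\<bar> \<le> R / n" "\<bar>(y - p) \<bullet> b - ?m\<bar> \<le> R / n"
          using that b by (auto simp: cell_def)
        moreover have "(x - y) \<bullet> b = (x - p) \<bullet> b - (y - p) \<bullet> b" by (simp add: inner_diff_left)
        ultimately have "\<bar>(x - y) \<bullet> b\<bar> \<le> R / n + R / n" by (simp only: abs_le_iff) argo
        then show "norm (((x - y) \<bullet> b) *\<^sub>R b) \<le> 2 * R / n" using B(3)[OF b] by simp
      qed
      also have "\<dots> = 2 * (real (dim S) * R) / n" using B(5) by simp
      finally show ?thesis .
    qed
    then have d: "dist x y \<le> 2 * (real (dim S) * R) / n" if "x \<in> cell c" "y \<in> cell c" for x y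
      using that by (simp add: dist_norm)
    show "bounded (cell c)"
      by (rule bounded_subset[of "cball p R"]) (use A
          in \<open>auto simp: cell_def dist_norm norm_minus_commute\<close>)
    show "diameter (cell c) \<le> 2 * (real (dim S) * R) / n"
      by (rule diameter_le) (use d R in \<open>auto simp: dist_norm\<close>)
  qed
  show ?thesis using fin card cover diam by (intro exI[of _ ?\<U>]) auto
qed

text \<open>A grid with \<open>n ^ dim S\<close> cells of diameter of order R/n costs at most a
  multiple of \<open>n ^ dim S / n ^ k\<close>. This is bounded if \<open>dim S <= k\<close> and
  tends to 0 if \<open>dim S < k\<close>.\<close>

lemma hausdorff_outer_subspace:
  fixes A :: "'a::euclidean_space set"
  assumes S: "subspace S" and A: "\<And>x. x \<in> A \<Longrightarrow> x - p \<in> S \<and> norm (x - p) \<le> R"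
    and k: "k \<ge> 1" and R: "R \<ge> 0"
  shows hausdorff_outer_subspace_le:
      "dim S \<le> k \<Longrightarrow> hausdorff_outer k A \<le> ennreal (unit_ball_vol (real k) * (real k * R) ^ k)"
    and hausdorff_outer_subspace_zero: "dim S < k \<Longrightarrow> hausdorff_outer k A = 0"
proof -
  let ?K = "unit_ball_vol (real k) * (real k * R) ^ k"
  have content: "hausdorff_content k \<delta> A \<le> ennreal (real n ^ dim S / real n ^ k * ?K)"
    if "dim S \<le> k" "n \<ge> 1" "2 * (real k * R) / n \<le> \<delta>" for \<delta> n
  proof -
    have "\<exists>\<U>. finite \<U> \<and> card \<U> \<le> n ^ dim S \<and> A \<subseteq> \<Union>\<U> \<and>
        (\<forall>U\<in>\<U>. bounded U \<and> diameter U \<le> 2 * (real (dim S) * R) / n)"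
      by (rule grid_cover[of S A p R n]) (fact S A that)+
    then obtain \<U> where *: "finite \<U> \<and> card \<U> \<le> n ^ dim S \<and> A \<subseteq> \<Union>\<U> \<and>
        (\<forall>U\<in>\<U>. bounded U \<and> diameter U \<le> 2 * (real (dim S) * R) / n)" by (elim exE)
    then have \<U>: "finite \<U>" "card \<U> \<le> n ^ dim S" "A \<subseteq> \<Union>\<U>"
        "\<And>U. U \<in> \<U> \<Longrightarrow> bounded U \<and> diameter U \<le> 2 * (real (dim S) * R) / n" by auto
    have le: "2 * (real (dim S) * R) / n \<le> 2 * (real k * R) / n"
      using that R by (intro divide_right_mono mult_left_mono mult_right_mono) auto
    have "hausdorff_content k \<delta> A \<le>
        ennreal (real (card \<U>) * (unit_ball_vol (real k) * ((2 * (real k * R) / n) / 2) ^ k))"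
      by (rule hausdorff_content_finite_cover[OF k \<U>(1,3)])
        (use \<U>(4) le that R in \<open>fastforce+\<close>)
    also have "\<dots> \<le> ennreal (real n ^ dim S * (unit_ball_vol (real k) * ((2 * (real k * R) / n) / 2) ^ k))"
      using \<U>(2) R by (intro ennreal_leI mult_right_mono) (auto simp flip: of_nat_power)
    also have "real n ^ dim S * (unit_ball_vol (real k) * ((2 * (real k * R) / n) / 2) ^ k)
        = real n ^ dim S / real n ^ k * ?K"
      by (simp add: power_divide)
    finally show ?thesis .
  qed
  have ex: "\<exists>n\<ge>1. n \<ge> m \<and> 2 * (real k * R) / real n \<le> \<delta>" if "\<delta> > 0" for \<delta> and m :: nat
  proof -
    obtain n0 :: nat where "2 * (real k * R) / \<delta> \<le> n0" using real_arch_simple by blast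
    then have "2 * (real k * R) \<le> real (max 1 (max m n0)) * \<delta>"
      using that R by (simp add: field_simps)
        (smt (verit, best) max.cobounded2 mult_left_mono of_nat_max)
    then show ?thesis using that by (intro exI[of _ "max 1 (max m n0)"]) (auto simp: field_simps)
  qed
  show "hausdorff_outer k A \<le> ennreal ?K" if "dim S \<le> k"
    unfolding hausdorff_outer_def
  proof (rule SUP_least)
    fix \<delta> :: real assume "\<delta> \<in> {0<..}"
    then obtain n where n: "n \<ge> 1" "2 * (real k * R) / real n \<le> \<delta>" using ex by auto
    have "hausdorff_content k \<delta> A \<le> ennreal (real n ^ dim S / real n ^ k * ?K)"
      by (rule content[OF that n])
    also have "\<dots> \<le> ennreal (1 * ?K)"
      using n that R by (intro ennreal_leI mult_right_mono) (auto intro: power_increasing)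
    finally show "hausdorff_content k \<delta> A \<le> ennreal ?K" by simp
  qed
  show "hausdorff_outer k A = 0" if less: "dim S < k"
  proof -
    have "hausdorff_content k \<delta> A \<le> 0" if \<delta>: "\<delta> > 0" for \<delta>
    proof (rule ennreal_le_epsilon)
      fix e :: real assume e: "e > 0"
      obtain m :: nat where m: "?K / e \<le> m" using real_arch_simple by blast
      obtain n where n: "n \<ge> 1" "n \<ge> m" "2 * (real k * R) / real n \<le> \<delta>" using ex[OF \<delta>] by blast
      have K0: "?K \<ge> 0" using R by simp
      have "hausdorff_content k \<delta> A \<le> ennreal (real n ^ dim S / real n ^ k * ?K)"
        by (rule content) (use less n in auto)
      also have "\<dots> \<le> ennreal e"
      proof (rule ennreal_leI)
        have "real n ^ dim S * real n \<le> real n ^ k"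
          using power_increasing[of "Suc (dim S)" k "real n"] n less by (simp add: mult.commute)
        then have "real n ^ dim S / real n ^ k \<le> 1 / real n"
          using n by (simp add: field_simps)
        then have "real n ^ dim S / real n ^ k * ?K \<le> 1 / real n * ?K"
          using K0 by (rule mult_right_mono)
        also have "\<dots> \<le> e"
        proof -
          have "?K \<le> e * m" using m e by (simp add: field_simps)
          also have "\<dots> \<le> e * n" using n e by simp
          finally show ?thesis using n by (simp add: field_simps)
        qed
        finally show "real n ^ dim S / real n ^ k * ?K \<le> e" .
      qed
      finally show "hausdorff_content k \<delta> A \<le> 0 + ennreal e" by simp
    qed
    then show ?thesis
      unfolding hausdorff_outer_def by (intro antisym SUP_least) auto
  qed
qed

lemma hausdorff_outer_mono: "A \<subseteq> B \<Longrightarrow> hausdorff_outer k A \<le> hausdorff_outer k B"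
  unfolding hausdorff_outer_def hausdorff_content_def
  by (intro SUP_mono' INF_superset_mono) auto

lemma hausdorff_outer_empty: "k \<ge> 1 \<Longrightarrow> hausdorff_outer k ({} :: 'a::metric_space set) = 0"
  using outer_measure_space_hausdorff[of k] by (auto simp: outer_measure_space_def positive_def)

lemma hausdorff_outer_Un_le:
  assumes k: "k \<ge> 1"
  shows "hausdorff_outer k (A \<union> B) \<le> hausdorff_outer k A + hausdorff_outer k (B :: 'a::metric_space set)"
proof -
  define f where "f = (\<lambda>i::nat. if i = 0 then A else if i = 1 then B else {})"
  have "countably_subadditive (Pow UNIV) (hausdorff_outer k :: 'a set \<Rightarrow> ennreal)"
    using outer_measure_space_hausdorff[OF k] by (auto simp: outer_measure_space_def)
  \<comment> \<open>\<open>countably_subadditive\<close> speaks of disjoint families only, hence the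
    detour through \<open>disjointed\<close>.\<close>
  then have "hausdorff_outer k (\<Union>i. disjointed f i) \<le> (\<Sum>i. hausdorff_outer k (disjointed f i))"
    unfolding countably_subadditive_def using disjoint_family_disjointed by auto
  also have "\<dots> \<le> (\<Sum>i. hausdorff_outer k (f i))"
    by (intro suminf_le hausdorff_outer_mono disjointed_subset) auto
  also have "\<dots> = (\<Sum>i<2. hausdorff_outer k (f i))"
    by (rule suminf_finite) (auto simp: f_def hausdorff_outer_empty[OF k])
  also have "\<dots> = hausdorff_outer k A + hausdorff_outer k B"
    by (simp add: f_def numeral_2_eq_2)
  also have "(\<Union>i. disjointed f i) = A \<union> B"
    by (auto simp: UN_disjointed_eq f_def split: if_splits)
  finally show ?thesis .
qed

lemma hausdorff_outer_UN_le:
  fixes A :: "'i \<Rightarrow> 'a::metric_space set"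
  assumes k: "k \<ge> 1" and "finite I"
  shows "hausdorff_outer k (\<Union>i\<in>I. A i) \<le> (\<Sum>i\<in>I. hausdorff_outer k (A i))"
  using \<open>finite I\<close>
proof (induction I)
  case (insert i I)
  have "hausdorff_outer k (\<Union>j\<in>insert i I. A j) \<le> hausdorff_outer k (A i) + hausdorff_outer k (\<Union>j\<in>I. A j)"
    using hausdorff_outer_Un_le[OF k] by simp
  also have "\<dots> \<le> hausdorff_outer k (A i) + (\<Sum>j\<in>I. hausdorff_outer k (A j))"
    using insert.IH by (rule add_left_mono)
  finally show ?case using insert.hyps by simp
qed (simp add: hausdorff_outer_empty[OF k])

section \<open>Upper and lower bounds for L2 norms\<close>

lemma L2norm_nonneg: "0 \<le> L2norm M S f"
  unfolding L2norm_def set_lebesgue_integral_def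
  by (intro real_sqrt_ge_zero Bochner_Integration.integral_nonneg) simp

text \<open>Neither \<open>S\<close> nor the exceptional set has to be measurable, which spares proving that
  surfaces are Caratheodory measurable.\<close>

lemma L2norm_le:
  assumes K: "\<And>E. E \<in> sets M \<Longrightarrow> E \<subseteq> S \<Longrightarrow> emeasure M E \<le> ennreal K"
    and null: "\<And>E. E \<in> sets M \<Longrightarrow> E \<subseteq> {x\<in>S. norm (f x) > B} \<Longrightarrow> emeasure M E = 0"
    and "0 \<le> B" "0 \<le> K"
  shows "L2norm M S f \<le> B * sqrt K"
proof (cases "set_integrable M S (\<lambda>x. (norm (f x))\<^sup>2)")
  \<comment> \<open>The Bochner integral of a non-integrable function is 0, so the norm is 0 and the
    bound is trivial.\<close>
  case False
  then show ?thesis using assms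
    by (simp add: L2norm_def set_lebesgue_integral_def set_integrable_def not_integrable_integral_eq)
next
  case True
  let ?g = "\<lambda>x. indicator S x *\<^sub>R (norm (f x))\<^sup>2"
  have g: "integrable M ?g" using True by (simp add: set_integrable_def)
  then have [measurable]: "?g \<in> borel_measurable M" by auto
  \<comment> \<open>\<open>E\<close> replaces \<open>S\<close>: it is measurable because the
    integrand is, and the integrand vanishes off it.\<close>
  define E where "E = {x\<in>space M. ?g x > 0}"
  have E: "E \<in> sets M" unfolding E_def by measurable
  have ES: "E \<subseteq> S" by (auto simp: E_def indicator_def split: if_splits)
  have EK: "emeasure M E \<le> ennreal K" using K[OF E ES] .
  define N where "N = {x\<in>space M. ?g x > B\<^sup>2}"
  have N: "N \<in> sets M" unfolding N_def by measurable
  have "N \<subseteq> {x\<in>S. norm (f x) > B}"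
  proof
    fix x assume "x \<in> N"
    then have x: "?g x > B\<^sup>2" by (simp add: N_def)
    then have "x \<in> S" by (cases "x \<in> S") (auto simp: not_less)
    moreover from this x have "B\<^sup>2 < (norm (f x))\<^sup>2" by simp
    then have "B < norm (f x)" by (rule power_less_imp_less_base) simp
    ultimately show "x \<in> {x\<in>S. norm (f x) > B}" by simp
  qed
  then have "N \<in> null_sets M" using null[OF N] N by (auto simp: null_sets_def)
  then have "AE x in M. x \<notin> N" by (rule AE_not_in)
  with AE_space have ae: "AE x in M. ?g x \<le> B\<^sup>2 * indicator E x"
  proof eventually_elim
    case (elim x)
    then have "?g x \<le> B\<^sup>2" "x \<notin> E \<Longrightarrow> ?g x \<le> 0" by (auto simp: N_def E_def not_less)
    then show ?case by (cases "x \<in> E") simp_all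
  qed
  have iE: "integrable M (\<lambda>x. B\<^sup>2 * indicator E x :: real)"
    using E EK by (intro integrable_mult_right integrable_real_indicator)
      (auto intro: order.strict_trans1)
  have "integral\<^sup>L M ?g \<le> integral\<^sup>L M (\<lambda>x. B\<^sup>2 * indicator E x)"
    by (rule integral_mono_AE[OF g iE ae])
  also have "\<dots> = B\<^sup>2 * measure M E" using E by (simp add: sets.Int_space_eq2)
  also have "\<dots> \<le> B\<^sup>2 * K"
    using EK \<open>0 \<le> K\<close> by (intro mult_left_mono) (auto simp: measure_def enn2real_leI)
  finally have "L2norm M S f \<le> sqrt (B\<^sup>2 * K)"
    unfolding L2norm_def set_lebesgue_integral_def by (rule real_sqrt_le_mono)
  then show ?thesis using \<open>0 \<le> B\<close> by (simp add: real_sqrt_mult)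
qed

text \<open>On its measurable sets \<open>hausdorff_measure\<close> is the outer measure, and a
  measurable subset of \<open>S\<close> has at most the outer measure of \<open>S\<close>. So bounds
  for outer measures are enough. On the null set \<open>Z\<close> a trace may be an arbitrary
  default value.\<close>

lemma L2surf_le:
  fixes S :: "(real^'n) set"
  assumes N: "CARD('n) \<ge> 2"
    and K: "hausdorff_outer (CARD('n) - 1) S \<le> ennreal K"
    and Z: "hausdorff_outer (CARD('n) - 1) Z = 0"
    and f: "\<And>x. x \<in> S \<Longrightarrow> x \<notin> Z \<Longrightarrow> norm (f x) \<le> B" and "0 \<le> B" "0 \<le> K"
  shows "L2surf S f \<le> B * sqrt K"
proof (rule L2norm_le)
  have k: "CARD('n) - 1 \<ge> 1" using N by simp
  fix E :: "(real^'n) set" assume E: "E \<in> sets (hausdorff_measure (CARD('n) - 1))"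
  show "emeasure (hausdorff_measure (CARD('n) - 1)) E \<le> ennreal K" if "E \<subseteq> S"
    using hausdorff_outer_mono[OF that] K
        unfolding emeasure_hausdorff_measure[OF k E] by (rule order_trans)
  show "emeasure (hausdorff_measure (CARD('n) - 1)) E = 0" if "E \<subseteq> {x\<in>S. norm (f x) > B}"
  proof -
    have "E \<subseteq> Z" using that f by force
    then have "hausdorff_outer (CARD('n) - 1) E \<le> 0" using hausdorff_outer_mono Z by metis
    then show ?thesis unfolding emeasure_hausdorff_measure[OF k E] by simp
  qed
qed (use assms in auto)

lemma L2vol_le:
  fixes S :: "(real^'n) set"
  assumes S: "S \<subseteq> cball x0 r" "r \<ge> 0" and Z: "negligible Z"
    and f: "\<And>x. x \<in> S \<Longrightarrow> x \<notin> Z \<Longrightarrow> norm (f x) \<le> B" and "0 \<le> B"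
  shows "L2vol S f \<le> B * sqrt (unit_ball_vol CARD('n) * r ^ CARD('n))"
proof (rule L2norm_le)
  fix E :: "(real^'n) set" assume E: "E \<in> sets lebesgue"
  show "emeasure lebesgue E \<le> ennreal (unit_ball_vol CARD('n) * r ^ CARD('n))" if "E \<subseteq> S"
  proof -
    have "emeasure lebesgue E \<le> emeasure lebesgue (cball x0 r)"
      using that S(1) by (intro emeasure_mono) auto
    also have "\<dots> = ennreal (unit_ball_vol CARD('n) * r ^ CARD('n))"
      using emeasure_cball[OF S(2), of x0] by simp
    finally show ?thesis .
  qed
  show "emeasure lebesgue E = 0" if "E \<subseteq> {x\<in>S. norm (f x) > B}"
  proof -
    have "E \<subseteq> Z" using that f by force
    then have "negligible E" using Z negligible_subset by blast
    then show ?thesis using negligible_iff_null_sets by auto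
  qed
qed (use assms in auto)

text \<open>A non-integrable integrand would give norm 0, so a lower bound, unlike an upper one,
  requires integrability. It is inherited from the continuous representatives \<open>f1\<close> and
  \<open>f2\<close>, which are square integrable on bounded open sets.\<close>

lemma L2vol_ge:
  fixes S :: "(real^'n) set"
  assumes "open S1" "open S2" "bounded S1" "bounded S2" "S1 \<inter> S2 = {}" "S1 \<union> S2 \<subseteq> S"
    and neg: "negligible (S - (S1 \<union> S2))"
    and f1: "\<And>x. x \<in> S1 \<Longrightarrow> f x = f1 x" and f2: "\<And>x. x \<in> S2 \<Longrightarrow> f x = f2 x"
    and cont: "continuous_on UNIV f1" "continuous_on UNIV f2"
    and ball: "ball x0 r \<subseteq> S1" "0 \<le> r" and m: "\<And>x. x \<in> ball x0 r \<Longrightarrow> m \<le> norm (f1 x)" "0 \<le> m"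
  shows "m * sqrt (unit_ball_vol CARD('n) * r ^ CARD('n)) \<le> L2vol S f"
proof -
  have int: "integrable lebesgue (\<lambda>x. indicator U x *\<^sub>R (norm (g x))\<^sup>2)"
    if "open U" "bounded U" "continuous_on UNIV g" for U and g :: "real^'n \<Rightarrow> 'a"
  proof -
    have "set_integrable lborel (closure U) (\<lambda>x. (norm (g x))\<^sup>2)"
      unfolding set_integrable_def using that(2)
      by (intro borel_integrable_compact) (auto simp: compact_closure
          intro!: continuous_intros continuous_on_subset[OF that(3)])
    then have "set_integrable lborel U (\<lambda>x. (norm (g x))\<^sup>2)"
      by (rule set_integrable_subset) (use that closure_subset in auto)
    then show ?thesis unfolding set_integrable_def
      by (subst integrable_completion) auto
  qed
  let ?h = "\<lambda>x. indicator S1 x *\<^sub>R (norm (f1 x))\<^sup>2 + indicator S2 x *\<^sub>R (norm (f2 x))\<^sup>2"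
  have h: "integrable lebesgue ?h"
    by (intro Bochner_Integration.integrable_add int assms)
  have "AE x in lebesgue. x \<notin> S - (S1 \<union> S2)"
    using neg by (intro AE_not_in) (simp add: negligible_iff_null_sets)
  then have ae: "AE x in lebesgue. indicator S x *\<^sub>R (norm (f x))\<^sup>2 = ?h x"
    by eventually_elim (use assms(5,6) f1 f2 in \<open>auto simp: indicator_def\<close>)
  have eq: "(LINT x:S|lebesgue. (norm (f x))\<^sup>2) = integral\<^sup>L lebesgue ?h"
  proof -
    have meas: "?h \<in> borel_measurable lebesgue" using h by auto
    \<comment> \<open>On the leftover of \<open>S\<close> the function is arbitrary. It is
      measurable nevertheless: Lebesgue measure is complete, so every subset of the negligible
      leftover is measurable.\<close>
    have "(\<lambda>x. indicator S x *\<^sub>R (norm (f x))\<^sup>2) \<in> borel_measurable lebesgue"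
    proof (rule measurableI)
      fix A :: "real set" assume "A \<in> sets borel"
      then have A: "?h -` A \<in> sets lebesgue" using measurable_sets[OF meas] by simp
      let ?Z = "S - (S1 \<union> S2)" and ?k = "\<lambda>x. indicator S x *\<^sub>R (norm (f x))\<^sup>2"
      have Z: "U \<in> sets lebesgue" if "U \<subseteq> ?Z" for U
        using neg that negligible_imp_sets negligible_subset by blast
      have "?k x = ?h x" if "x \<notin> ?Z" for x
        using that assms(5,6) f1 f2 by (auto simp: indicator_def)
      then have "?k -` A \<inter> space lebesgue = (?h -` A - ?Z) \<union> (?k -` A \<inter> ?Z)" by force
      also have "\<dots> \<in> sets lebesgue" by (intro sets.Un sets.Diff A Z) auto
      finally show "?k -` A \<inter> space lebesgue \<in> sets lebesgue" .
    qed simp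
    then show ?thesis unfolding set_lebesgue_integral_def
      using meas ae by (intro integral_cong_AE) auto
  qed
  have fin: "emeasure lebesgue (ball x0 r) < \<infinity>" using emeasure_ball[OF ball(2), of x0] by simp
  have "m\<^sup>2 * (unit_ball_vol CARD('n) * r ^ CARD('n))
      = integral\<^sup>L lebesgue (\<lambda>x. m\<^sup>2 * indicator (ball x0 r) x)"
    using emeasure_ball[OF ball(2), of x0] ball(2)
    by (simp add: measure_def)
  also have "\<dots> \<le> integral\<^sup>L lebesgue ?h"
  proof (rule integral_mono[OF _ h])
    show "integrable lebesgue (\<lambda>x. m\<^sup>2 * indicator (ball x0 r) x)"
      using fin by (intro integrable_mult_right integrable_real_indicator) auto
    fix x
    show "m\<^sup>2 * indicator (ball x0 r) x \<le> ?h x"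
      using ball(1) m by (auto simp: indicator_def intro!: power_mono add_increasing2)
  qed
  finally have "sqrt (m\<^sup>2 * (unit_ball_vol CARD('n) * r ^ CARD('n))) \<le> L2vol S f"
    unfolding L2norm_def eq by (rule real_sqrt_le_mono)
  then show ?thesis using m(2) by (simp add: real_sqrt_mult)
qed

section \<open>Shape-regular simplices\<close>

lemma P1_affine_sum:
  assumes "P1 p" "sum u S = 1"
  shows "p (\<Sum>x\<in>S. u x *\<^sub>R x) = (\<Sum>x\<in>S. u x *\<^sub>R p x)"
proof -
  obtain L c where L: "linear L" and p: "\<And>x. p x = L x + c" using assms(1) by (auto simp: P1_def)
  have "p (\<Sum>x\<in>S. u x *\<^sub>R x) = (\<Sum>x\<in>S. u x *\<^sub>R L x) + sum u S *\<^sub>R c"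
    using assms(2) by (simp add: p linear_sum[OF L] linear_cmul[OF L])
  also have "\<dots> = (\<Sum>x\<in>S. u x *\<^sub>R p x)"
    by (simp add: p scaleR_right_distrib sum.distrib scaleR_left.sum)
  finally show ?thesis .
qed

lemma P1_const: "P1 (\<lambda>x. c)"
  unfolding P1_def by (rule exI[of _ "\<lambda>x. 0"]) (auto simp: linear_zero)

lemma P1_add: "P1 p \<Longrightarrow> P1 q \<Longrightarrow> P1 (\<lambda>x. p x + q x)"
proof -
  assume "P1 p" "P1 q"
  then obtain L c L' c' where *: "linear L" "\<forall>x. p x = L x + c" "linear L'" "\<forall>x. q x = L' x + c'"
    unfolding P1_def by blast
  then show ?thesis unfolding P1_def
    by (intro exI[of _ "\<lambda>x. L x + L' x"] exI[of _ "c + c'"]) (auto intro: linear_compose_add)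
qed

lemma P1_linear_comp: "P1 p \<Longrightarrow> linear f \<Longrightarrow> P1 (\<lambda>x. f (p x))"
proof -
  assume "P1 p" and f: "linear f"
  then obtain L c where *: "linear L" "\<forall>x. p x = L x + c"
    unfolding P1_def by blast
  show ?thesis unfolding P1_def
    by (intro exI[of _ "\<lambda>x. f (L x)"] exI[of _ "f c"])
      (use * f linear_compose[OF *(1) f] in \<open>auto simp: linear_add comp_def\<close>)
qed

lemma P1_minus: "P1 p \<Longrightarrow> P1 (\<lambda>x. - p x)"
  by (rule P1_linear_comp[where f = uminus]) (auto intro!: linearI)

lemma P1_diff: "P1 p \<Longrightarrow> P1 q \<Longrightarrow> P1 (\<lambda>x. p x - q x)"
  using P1_add[OF _ P1_minus] by fastforce

lemma P1_scaleR_const: "P1 l \<Longrightarrow> P1 (\<lambda>x. l x *\<^sub>R c)"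
  by (rule P1_linear_comp[where f = "\<lambda>t. t *\<^sub>R c"]) (auto intro!: linearI simp: scaleR_left_distrib)

lemma P1_sum: "(\<And>i. i \<in> I \<Longrightarrow> P1 (p i)) \<Longrightarrow> P1 (\<lambda>x. \<Sum>i\<in>I. p i x)"
  by (induction I rule: infinite_finite_induct) (auto intro: P1_const P1_add)

lemma P1_add_diff: "P1 p \<Longrightarrow> p (x + u) - p x = p (y + u) - p y"
  unfolding P1_def by (auto simp: linear_add)

lemma continuous_on_P1:
  fixes p :: "'a::euclidean_space \<Rightarrow> 'b::real_normed_vector"
  assumes "P1 p" shows "continuous_on S p"
proof -
  obtain L c where L: "linear L" and p: "\<And>x. p x = L x + c" using assms by (auto simp: P1_def)
  have "p = (\<lambda>x. L x + c)" using p by blast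
  then show ?thesis using linear_continuous_on[OF linear_conv_bounded_linear[THEN iffD1, OF L], of S]
    by (auto intro!: continuous_intros)
qed

lemma isCont_P1:
  fixes p :: "'a::euclidean_space \<Rightarrow> 'b::real_normed_vector"
  shows "P1 p \<Longrightarrow> isCont p x"
  using continuous_on_P1[of p UNIV] by (simp add: continuous_on_eq_continuous_at)

lemma P1_real_gradient:
  fixes l :: "real^'n \<Rightarrow> real"
  assumes "P1 l"
  shows "\<exists>g. (\<forall>x y. l x - l y = g \<bullet> (x - y)) \<and> (\<forall>x. (l has_derivative (\<lambda>h. g \<bullet> h)) (at x))"
proof -
  obtain L c where L: "linear L" and l: "\<And>x. l x = L x + c" using assms by (auto simp: P1_def)
  have L': "L x = adjoint L 1 \<bullet> x" for x
    using adjoint_works[OF L, of x 1] by (simp add: inner_commute)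
  have "l = (\<lambda>x. adjoint L 1 \<bullet> x + c)" using l L' by auto
  then show ?thesis
    by (intro exI[of _ "adjoint L 1"]) (auto simp: inner_diff_right intro!: derivative_eq_intros)
qed

lemma P1_matrix:
  fixes p :: "real^'n \<Rightarrow> real^'m"
  assumes "P1 p" shows "\<exists>A c. \<forall>x. p x = A *v x + c"
proof -
  obtain L c where L: "linear L" and p: "\<And>x. p x = L x + c" using assms by (auto simp: P1_def)
  then show ?thesis by (intro exI[of _ "matrix L"] exI[of _ c]) (simp add: matrix_works)
qed

lemma P1_inner:
  fixes p :: "real^'n \<Rightarrow> real"
  assumes "P1 p" shows "\<exists>g c. \<forall>x. p x = g \<bullet> x + c"
proof -
  obtain g where "\<forall>x y. p x - p y = g \<bullet> (x - y)" using P1_real_gradient[OF assms] by blast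
  then have "p x = g \<bullet> x + p 0" for x by (metis add.commute diff_add_cancel diff_zero)
  then show ?thesis by blast
qed

lemma P1_convex_combination:
  assumes "P1 p" shows "p ((1 - t) *\<^sub>R x + t *\<^sub>R y) = (1 - t) *\<^sub>R p x + t *\<^sub>R p y"
  using assms by (auto simp: P1_def linear_add linear_diff linear_cmul algebra_simps)

section \<open>Barycentric coordinates and the bubble function\<close>

locale regular_simplex =
  fixes T :: "(real^'n) set" and \<rho> :: real
  assumes fin: "finite T" and card_le: "card T \<le> Suc CARD('n)"
    and regular: "\<exists>x r. 0 < r \<and> ball x r \<subseteq> open_simplex T \<and> hdiam T \<le> \<rho> * r"
begin

text \<open>The inscribed ball has affine dimension N, and at most N+1 points can span this only if
  there are exactly N+1 of them and they are affinely independent. This excludes coinciding or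
  degenerate Kuhn vertices, of which only a bound on the number is known beforehand.\<close>

lemma affine_independent: "\<not> affine_dependent T"
  and card_T: "card T = Suc CARD('n)"
  and affine_hull_T: "affine hull T = UNIV"
proof -
  obtain x r where r: "0 < r" "ball x r \<subseteq> open_simplex T" using regular by blast
  have sub: "ball x r \<subseteq> convex hull T"
    using r(2) rel_interior_subset unfolding open_simplex_def by blast
  have "aff_dim (ball x r) = int CARD('n)"
    using aff_dim_open[of "ball x r"] r(1) by simp
  then have ge: "int CARD('n) \<le> aff_dim T"
    using aff_dim_subset[OF sub] by (simp add: aff_dim_convex_hull)
  moreover have "aff_dim T \<le> int (card T) - 1" by (rule aff_dim_le_card[OF fin])
  ultimately show c: "card T = Suc CARD('n)" using card_le by linarith
  have "aff_dim T \<le> int CARD('n)" using aff_dim_le_DIM[of T] by simp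
  then have d: "aff_dim T = int CARD('n)" using ge by linarith
  show "\<not> affine_dependent T" unfolding affine_independent_iff_card using fin c d by simp
  show "affine hull T = UNIV" using d aff_dim_eq_full[of T] by simp
qed

lemma ex_other_vertex:
  assumes "z \<in> T" obtains w where "w \<in> T" "w \<noteq> z"
proof -
  have "T \<noteq> {z}" using card_T by auto
  then show ?thesis using that assms by blast
qed

text \<open>Existence: the differences to another vertex \<open>z0\<close> are linearly independent,
  so a linear form can be prescribed on them, and the constant \<open>L (- z0)\<close> moves its
  zero to \<open>z0\<close>. Uniqueness: an affine function is determined on the affine hull of T,
  which is the whole space.\<close>

lemma ex1_bary:
  assumes z: "z \<in> T"
  shows "\<exists>!l. P1 l \<and> l z = (1::real) \<and> (\<forall>y\<in>T - {z}. l y = 0)"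
proof (rule ex_ex1I)
  obtain z0 where z0: "z0 \<in> T" "z0 \<noteq> z" using ex_other_vertex[OF z] .
  have "independent ((\<lambda>x. - z0 + x) ` (T - {z0}))"
    using affine_independent affine_dependent_iff_dependent2[OF z0(1)] by blast
  then obtain L where L: "linear L" and
    Lv: "\<forall>x\<in>(\<lambda>x. - z0 + x) ` (T - {z0}). L x = (if x = - z0 + z then 1 else 0 :: real)"
    using linear_independent_extend[of _ "\<lambda>x. if x = - z0 + z then 1 else 0 :: real"] by blast
  let ?l = "\<lambda>x. L x + L (- z0)"
  have "P1 ?l" using L unfolding P1_def by blast
  moreover have val: "?l y = (if y = z then 1 else 0)" if "y \<in> T" for y
  proof (cases "y = z0")
    case True
    then show ?thesis using z0 linear_add[OF L, of y "- z0"] linear_0[OF L] by simp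
  next
    case False
    then have "L (- z0 + y) = (if y = z then 1 else 0)" using Lv that by auto
    then show ?thesis using linear_add[OF L, of "- z0" y] by simp
  qed
  ultimately show "\<exists>l. P1 l \<and> l z = (1::real) \<and> (\<forall>y\<in>T - {z}. l y = 0)"
    using z by (intro exI[of _ ?l]) auto
next
  fix l m :: "real^'n \<Rightarrow> real"
  assume l: "P1 l \<and> l z = 1 \<and> (\<forall>y\<in>T - {z}. l y = 0)" and m: "P1 m \<and> m z = 1 \<and> (\<forall>y\<in>T - {z}. m y = 0)"
  show "l = m"
  proof
    fix x
    have "x \<in> affine hull T" by (simp add: affine_hull_T)
    then obtain u where u: "sum u T = 1" "(\<Sum>v\<in>T. u v *\<^sub>R v) = x"
      unfolding affine_hull_finite[OF fin] by blast
    have "l y = m y" if "y \<in> T" for y using l m that by (cases "y = z") auto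
    then show "l x = m x"
      using P1_affine_sum[of l u T] P1_affine_sum[of m u T] l m u by auto
  qed
qed

lemma P1_bary: "z \<in> T \<Longrightarrow> P1 (bary T z)"
  and bary_vertex: "z \<in> T \<Longrightarrow> w \<in> T \<Longrightarrow> bary T z w = (if w = z then 1 else 0)"
  using theI'[OF ex1_bary] unfolding bary_def by auto

lemma bary_affine_sum:
  assumes "sum u T = 1" "z \<in> T"
  shows "bary T z (\<Sum>v\<in>T. u v *\<^sub>R v) = u z"
proof -
  have "bary T z (\<Sum>v\<in>T. u v *\<^sub>R v) = (\<Sum>v\<in>T. u v * (if v = z then 1 else 0))"
    using P1_affine_sum[OF P1_bary[OF assms(2)] assms(1)] bary_vertex[OF assms(2)] by simp
  also have "\<dots> = u z" using fin assms(2) by (simp add: if_distrib cong: if_cong)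
  finally show ?thesis .
qed

lemma bary_sum: "(\<Sum>z\<in>T. bary T z x) = 1"
  and bary_combination: "(\<Sum>z\<in>T. bary T z x *\<^sub>R z) = x"
proof -
  have "x \<in> affine hull T" by (simp add: affine_hull_T)
  then obtain u where u: "sum u T = 1" "(\<Sum>v\<in>T. u v *\<^sub>R v) = x"
    unfolding affine_hull_finite[OF fin] by blast
  then have "bary T z x = u z" if "z \<in> T" for z using bary_affine_sum[OF u(1) that] by simp
  then show "(\<Sum>z\<in>T. bary T z x) = 1" "(\<Sum>z\<in>T. bary T z x *\<^sub>R z) = x" using u by auto
qed

lemma P1_expand: "P1 p \<Longrightarrow> p x = (\<Sum>z\<in>T. bary T z x *\<^sub>R p z)"
  using P1_affine_sum[OF _ bary_sum, of p x] by (simp add: bary_combination)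

lemma open_simplex_iff: "x \<in> open_simplex T \<longleftrightarrow> (\<forall>z\<in>T. 0 < bary T z x)"
  unfolding open_simplex_def rel_interior_convex_hull_explicit[OF affine_independent]
  using bary_affine_sum bary_sum bary_combination by (fastforce intro!: exI[of _ "\<lambda>z. bary T z x"])

lemma convex_hull_iff: "x \<in> convex hull T \<longleftrightarrow> (\<forall>z\<in>T. 0 \<le> bary T z x)"
  unfolding convex_hull_finite[OF fin]
  using bary_affine_sum bary_sum bary_combination by (fastforce intro!: exI[of _ "\<lambda>z. bary T z x"])

lemma open_open_simplex: "open (open_simplex T)"
proof -
  have "open (\<Inter>z\<in>T. {x. 0 < bary T z x})"
    using fin by (intro open_INT ballI open_Collect_less continuous_on_P1 P1_bary continuous_on_const)
  also have "(\<Inter>z\<in>T. {x. 0 < bary T z x}) = open_simplex T" using open_simplex_iff by auto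
  finally show ?thesis .
qed

lemma closure_open_simplex: "closure (open_simplex T) = convex hull T"
  unfolding open_simplex_def
  using convex_closure_rel_interior[of "convex hull T"] fin
  by (simp add: finite_imp_compact_convex_hull compact_imp_closed)

lemma open_simplex_subset: "open_simplex T \<subseteq> convex hull T"
  unfolding open_simplex_def by (rule rel_interior_subset)

lemma bounded_hull: "bounded (convex hull T)"
  using fin by (simp add: finite_imp_bounded bounded_convex_hull)

lemma T_subset_hull: "z \<in> T \<Longrightarrow> z \<in> convex hull T"
  by (rule hull_inc)

lemma dist_hull_le: "x \<in> convex hull T \<Longrightarrow> y \<in> convex hull T \<Longrightarrow> norm (x - y) \<le> hdiam T"
  unfolding hdiam_def
  using diameter_bounded_bound[OF bounded_hull] diameter_closure[of "open_simplex T"]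
    bounded_subset[OF bounded_hull open_simplex_subset]
  by (simp add: closure_open_simplex dist_norm)

lemma bary_le_1:
  assumes "x \<in> convex hull T" "z \<in> T" shows "bary T z x \<le> 1"
proof -
  have "bary T z x \<le> (\<Sum>w\<in>T. bary T w x)"
    using assms fin by (intro member_le_sum) (auto simp: convex_hull_iff)
  then show ?thesis by (simp add: bary_sum)
qed

text \<open>A barycentric coordinate varies by at most 1 on T, in particular along a segment of
  length \<open>r\<close> in the inscribed ball, so its gradient is at most
  \<open>1 / r <= \<rho> / hdiam T\<close>. On the other hand it changes by 1 along an edge of
  length at most \<open>hdiam T\<close>, which forces \<open>1 <= \<rho>\<close>.\<close>

lemma hdiam_pos: "0 < hdiam T" and rho_ge_1: "1 \<le> \<rho>"
  and bary_gradient_bound: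
    "z \<in> T \<Longrightarrow> (\<And>x y. bary T z x - bary T z y = g \<bullet> (x - y)) \<Longrightarrow> norm g \<le> \<rho> / hdiam T"
proof -
  obtain x r where r: "0 < r" "ball x r \<subseteq> open_simplex T" "hdiam T \<le> \<rho> * r" using regular by blast
  have "T \<noteq> {}" using card_T by auto
  then obtain w where w: "w \<in> T" by blast
  obtain z where z: "z \<in> T" "z \<noteq> w" using ex_other_vertex[OF w] .
  note zw = z(1) w z(2)
  then have "0 < norm (z - w)" by simp
  also have "\<dots> \<le> hdiam T" using zw by (intro dist_hull_le T_subset_hull)
  finally show h: "0 < hdiam T" .
  show grad: "norm g \<le> \<rho> / hdiam T"
    if z: "z \<in> T" and g: "\<And>x y. bary T z x - bary T z y = g \<bullet> (x - y)" for z g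
  proof (cases "g = 0")
    case True
    have "0 < \<rho> * r" using h r(3) by linarith
    then show ?thesis using True h r(1) by (simp add: zero_less_mult_iff)
  next
    case False
    define u where "u = (r / 2 / norm g) *\<^sub>R g"
    have nu: "norm u = r / 2" using False r(1) by (simp add: u_def)
    have "x + u \<in> ball x r" "x - u \<in> ball x r" using nu r(1) by (auto simp: dist_norm)
    then have in_hull: "x + u \<in> convex hull T" "x - u \<in> convex hull T"
      using r(2) open_simplex_subset by blast+
    have "r * norm g = g \<bullet> ((x + u) - (x - u))"
    proof -
      have "(x + u) - (x - u) = (r / norm g) *\<^sub>R g" by (simp add: u_def scaleR_left_distrib[symmetric])
      then show ?thesis using False by (simp add: dot_square_norm power2_eq_square)
    qed
    also have "\<dots> = bary T z (x + u) - bary T z (x - u)" using g by metis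
    also have "\<dots> \<le> 1" using bary_le_1[OF in_hull(1) z] in_hull(2) z by (auto simp: convex_hull_iff)
    finally have "norm g \<le> 1 / r" using r(1) by (simp add: field_simps)
    also have "\<dots> \<le> \<rho> / hdiam T" using r h by (simp add: field_simps)
    finally show ?thesis .
  qed
  obtain g where "\<forall>x y. bary T z x - bary T z y = g \<bullet> (x - y)"
    using P1_real_gradient[OF P1_bary[OF zw(1)]] by (elim exE conjE)
  then have g: "bary T z x - bary T z y = g \<bullet> (x - y)" for x y by simp
  have "1 = g \<bullet> (z - w)" using g[of z w] zw by (simp add: bary_vertex)
  also have "\<dots> \<le> norm g * norm (z - w)" by (rule norm_cauchy_schwarz)
  also have "\<dots> \<le> \<rho> / hdiam T * hdiam T"
    using grad[OF zw(1) g] dist_hull_le[OF T_subset_hull T_subset_hull, OF zw(1,2)]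
    by (intro mult_mono) (auto intro: order_trans[OF norm_ge_zero])
  finally show "1 \<le> \<rho>" using h by simp
qed

lemma bary_lipschitz:
  assumes "z \<in> T" shows "\<bar>bary T z x - bary T z y\<bar> \<le> \<rho> / hdiam T * norm (x - y)"
proof -
  obtain g where "\<forall>x y. bary T z x - bary T z y = g \<bullet> (x - y)"
    using P1_real_gradient[OF P1_bary[OF assms]] by (elim exE conjE)
  then have g: "bary T z x - bary T z y = g \<bullet> (x - y)" for x y by simp
  have "\<bar>bary T z x - bary T z y\<bar> \<le> norm g * norm (x - y)"
    unfolding g by (rule Cauchy_Schwarz_ineq2)
  also have "\<dots> \<le> \<rho> / hdiam T * norm (x - y)"
    by (intro mult_right_mono bary_gradient_bound[OF assms g]) auto
  finally show ?thesis .
qed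

definition bgrad :: "real^'n \<Rightarrow> real^'n" where
  "bgrad z = (SOME g. (\<forall>x y. bary T z x - bary T z y = g \<bullet> (x - y)) \<and>
      (\<forall>x. (bary T z has_derivative (\<lambda>h. g \<bullet> h)) (at x)))"

lemma bgrad:
  assumes "z \<in> T"
  shows bary_diff: "bary T z x - bary T z y = bgrad z \<bullet> (x - y)"
    and has_derivative_bary: "(bary T z has_derivative (\<lambda>h. bgrad z \<bullet> h)) (at x)"
    and norm_bgrad_le: "norm (bgrad z) \<le> \<rho> / hdiam T"
proof -
  have "\<exists>g. (\<forall>x y. bary T z x - bary T z y = g \<bullet> (x - y)) \<and>
      (\<forall>x. (bary T z has_derivative (\<lambda>h. g \<bullet> h)) (at x))"
    by (rule P1_real_gradient[OF P1_bary[OF assms]])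
  from someI_ex[OF this, folded bgrad_def]
  have *: "\<forall>x y. bary T z x - bary T z y = bgrad z \<bullet> (x - y)"
      "\<forall>x. (bary T z has_derivative (\<lambda>h. bgrad z \<bullet> h)) (at x)" by blast+
  then show "bary T z x - bary T z y = bgrad z \<bullet> (x - y)"
    "(bary T z has_derivative (\<lambda>h. bgrad z \<bullet> h)) (at x)" by blast+
  show "norm (bgrad z) \<le> \<rho> / hdiam T" using bary_gradient_bound[OF assms] * by blast
qed

definition bubble_grad :: "real^'n \<Rightarrow> real^'n" where
  "bubble_grad x = (\<Sum>z\<in>T. (\<Prod>w\<in>T - {z}. bary T w x) *\<^sub>R bgrad z)"

lemma has_derivative_bubble: "(bubble T has_derivative (\<lambda>h. bubble_grad x \<bullet> h)) (at x)"
proof -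
  have eq: "bubble T = (\<lambda>x. \<Prod>z\<in>T. bary T z x)" by (auto simp: bubble_def)
  show ?thesis unfolding eq
    by (rule has_derivative_eq_rhs, rule has_derivative_prod, erule has_derivative_bary)
      (auto simp: bubble_grad_def inner_sum_left mult.commute)
qed

lemma continuous_on_bubble: "continuous_on S (bubble T)"
  by (rule has_derivative_continuous_on) (rule has_derivative_at_withinI[OF has_derivative_bubble])

lemma bubble_bounds:
  assumes "x \<in> convex hull T" shows "0 \<le> bubble T x" "bubble T x \<le> 1"
  using assms bary_le_1[OF assms] unfolding bubble_def
  by (auto simp: convex_hull_iff intro!: prod_nonneg prod_le_1)

lemma bubble_zero: "z \<in> T \<Longrightarrow> bary T z x = 0 \<Longrightarrow> bubble T x = 0"
  using fin by (auto simp: bubble_def)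

lemma bubble_vertex: "z \<in> T \<Longrightarrow> bubble T z = 0"
proof -
  assume z: "z \<in> T"
  obtain w where "w \<in> T" "w \<noteq> z" using ex_other_vertex[OF z] .
  then show ?thesis using bubble_zero[of w z] z by (simp add: bary_vertex)
qed

lemma bubble_lipschitz:
  assumes "x \<in> convex hull T" "y \<in> convex hull T"
  shows "\<bar>bubble T x - bubble T y\<bar> \<le> real (Suc CARD('n)) * (\<rho> / hdiam T) * norm (x - y)"
proof -
  have "norm (bubble T x - bubble T y) \<le> (\<Sum>z\<in>T. norm (bary T z x - bary T z y))"
    unfolding bubble_def
    by (rule norm_prod_diff) (use assms bary_le_1 convex_hull_iff in auto)
  also have "\<dots> \<le> (\<Sum>z\<in>T. \<rho> / hdiam T * norm (x - y))"
    using bary_lipschitz by (intro sum_mono) auto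
  finally show ?thesis using card_T by simp
qed

lemma norm_bubble_grad_le:
  assumes "x \<in> convex hull T"
  shows "norm (bubble_grad x) \<le> real (Suc CARD('n)) * (\<rho> / hdiam T)"
proof -
  have "norm (bubble_grad x) \<le> (\<Sum>z\<in>T. \<rho> / hdiam T)"
    unfolding bubble_grad_def
  proof (rule sum_norm_le)
    fix z assume z: "z \<in> T"
    have "(\<Prod>w\<in>T - {z}. bary T w x) \<le> 1" "0 \<le> (\<Prod>w\<in>T - {z}. bary T w x)"
      using assms bary_le_1[OF assms] by (auto simp: convex_hull_iff intro!: prod_le_1 prod_nonneg)
    then have "\<bar>\<Prod>w\<in>T - {z}. bary T w x\<bar> * norm (bgrad z) \<le> 1 * (\<rho> / hdiam T)"
      using norm_bgrad_le[OF z] by (intro mult_mono) auto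
    then show "norm ((\<Prod>w\<in>T - {z}. bary T w x) *\<^sub>R bgrad z) \<le> \<rho> / hdiam T" by simp
  qed
  then show ?thesis using card_T by simp
qed

lemma bubble_grad_lipschitz:
  assumes "x \<in> convex hull T" "y \<in> convex hull T"
  shows "norm (bubble_grad x - bubble_grad y)
    \<le> (real (Suc CARD('n)) * (\<rho> / hdiam T))\<^sup>2 * norm (x - y)"
proof -
  have A: "0 \<le> \<rho> / hdiam T" using hdiam_pos rho_ge_1 by simp
  have "bubble_grad x - bubble_grad y =
      (\<Sum>z\<in>T. ((\<Prod>w\<in>T - {z}. bary T w x) - (\<Prod>w\<in>T - {z}. bary T w y)) *\<^sub>R bgrad z)"
    unfolding bubble_grad_def by (simp add: scaleR_left_diff_distrib sum_subtractf)
  also have "norm \<dots> \<le> (\<Sum>z\<in>T. (real (Suc CARD('n)) * (\<rho> / hdiam T) * norm (x - y)) * (\<rho> / hdiam T))"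
  proof (rule sum_norm_le)
    fix z assume z: "z \<in> T"
    have "norm ((\<Prod>w\<in>T - {z}. bary T w x) - (\<Prod>w\<in>T - {z}. bary T w y))
        \<le> (\<Sum>w\<in>T - {z}. norm (bary T w x - bary T w y))"
      by (rule norm_prod_diff) (use assms bary_le_1 convex_hull_iff in auto)
    also have "\<dots> \<le> (\<Sum>w\<in>T. norm (bary T w x - bary T w y))"
      using fin by (intro sum_mono2) auto
    also have "\<dots> \<le> (\<Sum>w\<in>T. \<rho> / hdiam T * norm (x - y))"
      using bary_lipschitz by (intro sum_mono) auto
    also have "\<dots> = real (Suc CARD('n)) * (\<rho> / hdiam T) * norm (x - y)" using card_T by simp
    finally show "norm (((\<Prod>w\<in>T - {z}. bary T w x) - (\<Prod>w\<in>T - {z}. bary T w y)) *\<^sub>R bgrad z)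
      \<le> (real (Suc CARD('n)) * (\<rho> / hdiam T) * norm (x - y)) * (\<rho> / hdiam T)"
      using norm_bgrad_le[OF z] A unfolding norm_scaleR real_norm_def[symmetric]
      by (intro mult_mono) auto
  qed
  also have "\<dots> = (real (Suc CARD('n)) * (\<rho> / hdiam T))\<^sup>2 * norm (x - y)"
    using card_T by (simp add: power2_eq_square)
  finally show ?thesis .
qed

end

section \<open>Control of coefficients near a vertex\<close>

lemma norm_matrix_vector_mult_le: "norm (A *v x) \<le> norm A * norm (x :: real^'n)" for A :: "real^'n^'m"
proof -
  have "norm (A *v x) \<le> L2_set (\<lambda>i. norm (A $ i) * norm x) UNIV"
    unfolding norm_vec_def[of "A *v x"]
    by (intro L2_set_mono) (auto simp: matrix_vector_mul_component Cauchy_Schwarz_ineq2)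
  also have "\<dots> = norm A * norm x"
    unfolding norm_vec_def[of A] by (simp add: L2_set_left_distrib)
  finally show ?thesis .
qed

text \<open>The matrix \<open>b g^T\<close>. It is the Jacobian of a scalar function with gradient
  \<open>g\<close> times the vector \<open>b\<close>, as for the bubble part, and the form of the
  jump of the velocity gradient.\<close>

definition outer :: "real^'m \<Rightarrow> real^'n \<Rightarrow> real^'n^'m" where
  "outer b g = (\<chi> i j. b $ i * g $ j)"

lemma outer_mult_vec: "outer b g *v x = (g \<bullet> x) *\<^sub>R b"
  by (simp add: outer_def vec_eq_iff matrix_vector_mult_def inner_vec_def sum_distrib_left
      sum_distrib_right mult_ac)

lemma norm_outer: "norm (outer b g) = norm b * norm g"
proof -
  have "outer b g $ i = b $ i *\<^sub>R g" for i by (simp add: outer_def vec_eq_iff)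
  then have "norm (outer b g) = L2_set (\<lambda>i. norm (b $ i) * norm g) UNIV"
    by (simp add: norm_vec_def[of "outer b g"])
  also have "\<dots> = norm b * norm g"
    unfolding norm_vec_def[of b] by (simp add: L2_set_left_distrib)
  finally show ?thesis .
qed

lemma outer_diff: "outer b (g - g') = outer b g - outer b g'"
  by (simp add: outer_def vec_eq_iff right_diff_distrib)

text \<open>Chosen so that \<open>2 * (N + 1) * margin N = 1 / (2 * N) <= 1 / (N + 1)\<close>. The
  coordinate of \<open>core_point z\<close> at \<open>z\<close> is
  \<open>1 - 2 * N * margin N\<close>; after two steps of size \<open>margin N\<close> it is still
  at least \<open>N / (N + 1)\<close>, the threshold of \<open>vertex_region\<close>, while the
  other coordinates remain nonnegative.\<close>

definition margin :: "nat \<Rightarrow> real" where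
  "margin N = 1 / (4 * real N * (real N + 1))"

text \<open>For a step \<open>margin\<close> along an edge, starting at \<open>core_point z\<close>,
  the second difference of the bubble is \<open>- 2 * margin * bubble_lower\<close>, and its
  derivative along the edge changes by \<open>- 2 * bubble_lower\<close>.\<close>

definition bubble_lower :: "nat \<Rightarrow> real" where
  "bubble_lower N = margin N * (2 * margin N) ^ (N - 1)"

text \<open>\<open>B\<close> is the factor in \<open>norm \<beta> <= B * M\<close>. The first
  summand bounds the slope of the affine part and the second that of the bubble part, both in units
  of \<open>\<rho> / hdiam T * M\<close>.\<close>

definition value_const :: "nat \<Rightarrow> real" where
  "value_const N = (let B = 2 / (margin N * bubble_lower N) in
     2 * (1 + B) / margin N + B * (real N + 1))"

text \<open>\<open>2 / margin N\<close> meets the condition on \<open>D\<close> in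
  \<open>core_max\<close>; the other summands cover the bubble coefficient, the constant matrix and
  the Lipschitz constant of the bubble gradient.\<close>

definition grad_const :: "nat \<Rightarrow> real \<Rightarrow> real" where
  "grad_const N \<rho> = 2 / margin N + 1 + (1 + (real N + 1)\<^sup>2 * \<rho>) / bubble_lower N"

section \<open>Core points, regions near a vertex and the bubble along an edge\<close>

context regular_simplex
begin

lemma margin_pos: "0 < margin CARD('n)" and margin_le_1: "margin CARD('n) \<le> 1"
proof -
  have "1 \<le> real CARD('n)" by (simp add: Suc_leI)
  then have "1 * 1 * 1 \<le> 4 * real CARD('n) * (real CARD('n) + 1)" by (intro mult_mono) auto
  then show "0 < margin CARD('n)" "margin CARD('n) \<le> 1" by (auto simp: margin_def)
qed

lemma bubble_lower_pos: "0 < bubble_lower CARD('n)"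
  using margin_pos by (simp add: bubble_lower_def)

text \<open>All barycentric coordinates of \<open>core_point z\<close> are at least \<open>2 * margin\<close>; a step of size
  \<open>margin\<close> in each of them stays in \<open>core z\<close>, and a further one in \<open>vertex_region z\<close>, which
  for a suitable \<open>z\<close> lies on one side of the interface (\<open>half_simplex\<close>).\<close>

definition core_point :: "real^'n \<Rightarrow> real^'n" where
  "core_point z = (\<Sum>w\<in>T. (if w = z then 1 - 2 * real CARD('n) * margin CARD('n) else 2 * margin CARD('n)) *\<^sub>R w)"

definition core :: "real^'n \<Rightarrow> (real^'n) set" where
  "core z = {x. \<forall>w\<in>T. \<bar>bary T w x - bary T w (core_point z)\<bar> \<le> margin CARD('n)}"

definition vertex_region :: "real^'n \<Rightarrow> (real^'n) set" where
  "vertex_region z = {x \<in> open_simplex T. real CARD('n) / (real CARD('n) + 1) < bary T z x}"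

lemma bary_core_point:
  assumes z: "z \<in> T" and "w \<in> T"
  shows "bary T w (core_point z) = (if w
      = z then 1 - 2 * real CARD('n) * margin CARD('n) else 2 * margin CARD('n))"
  unfolding core_point_def
proof (rule bary_affine_sum[OF _ assms(2)])
  have "(\<Sum>w\<in>T. if w = z then 1 - 2 * real CARD('n) * margin CARD('n) else 2 * margin CARD('n)) =
      (1 - 2 * real CARD('n) * margin CARD('n)) + (\<Sum>w\<in>T - {z}. 2 * margin CARD('n))"
    by (subst sum.remove[OF fin z]) auto
  also have "\<dots> = 1" using card_T z fin by simp
  finally show "(\<Sum>w\<in>T. if w = z then 1 - 2 * real CARD('n) * margin CARD('n) else 2 * margin CARD('n)) = 1" .
qed

lemma core_ball:
  assumes z: "z \<in> T" and x: "x \<in> core z" and y: "\<rho> / hdiam T * norm (y - x) < margin CARD('n)"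
  shows "y \<in> vertex_region z"
proof -
  have d: "bary T w (core_point z) - 2 * margin CARD('n) < bary T w y" if "w \<in> T" for w
    using bary_lipschitz[OF that, of y x] y x that by (auto simp: core_def abs_le_iff; fastforce)
  have N1: "1 \<le> real CARD('n)" by (simp add: Suc_leI)
  have "2 * (real CARD('n) + 1) * margin CARD('n) = 1 / (2 * real CARD('n))"
  proof -
    have "2 * (real CARD('n) + 1) * margin CARD('n) =
        (2 * (real CARD('n) + 1)) / ((2 * (real CARD('n) + 1)) * (2 * real CARD('n)))"
      by (simp add: margin_def mult_ac)
    moreover have "0 < 2 * (real CARD('n) + 1)" by (intro mult_pos_pos add_nonneg_pos) auto
    then have "2 * (real CARD('n) + 1) \<noteq> 0" by (rule less_imp_neq[symmetric])
    ultimately show ?thesis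
      using nonzero_divide_mult_cancel_left[of "2 * (real CARD('n) + 1)" "2 * real CARD('n)"] by argo
  qed
  also have "\<dots> \<le> 1 / (real CARD('n) + 1)" using N1 by (intro divide_left_mono) auto
  finally have le: "2 * (real CARD('n) + 1) * margin CARD('n) \<le> 1 / (real CARD('n) + 1)" .
  have eq: "real CARD('n) / (real CARD('n) + 1) = 1 - 1 / (real CARD('n) + 1)" by (simp add: field_simps)
  have big: "real CARD('n) / (real CARD('n) + 1) < bary T z y"
    using d[OF z] le z unfolding eq by (simp add: bary_core_point algebra_simps)
  have "0 \<le> real CARD('n) / (real CARD('n) + 1)" by simp
  with big have "0 < bary T z y" by (rule order.strict_trans1[rotated])
  then have "0 < bary T w y" if "w \<in> T" for w
    using d[OF that] z that by (cases "w = z") (auto simp: bary_core_point)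
  then show ?thesis using big by (simp add: vertex_region_def open_simplex_iff)
qed

lemma core_subset_hull: "z \<in> T \<Longrightarrow> core z \<subseteq> convex hull T"
  using core_ball[of z x x for x] margin_pos open_simplex_subset by (auto simp: vertex_region_def)

lemma core_point_in_core: "core_point z \<in> core z"
  using margin_pos by (simp add: core_def)

lemma core_point_ball:
  "\<rho> / hdiam T * norm u \<le> margin CARD('n) \<Longrightarrow> core_point z + u \<in> core z"
  using bary_lipschitz[of _ "core_point z + u" "core_point z"] by (fastforce simp: core_def)

lemma compact_core: "z \<in> T \<Longrightarrow> compact (core z)"
proof -
  assume z: "z \<in> T"
  have "core z = (\<Inter>w\<in>T. {x. \<bar>bary T w x - bary T w (core_point z)\<bar> \<le> margin CARD('n)})"
    by (auto simp: core_def)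
  moreover have "closed \<dots>"
    by (intro closed_INT ballI closed_Collect_le continuous_intros continuous_on_P1 P1_bary)
  ultimately show ?thesis
    using bounded_subset[OF bounded_hull core_subset_hull[OF z]] by (simp add: compact_eq_bounded_closed)
qed

lemma bary_exchange:
  assumes "z \<in> T" "w \<in> T" "z \<noteq> w" "u \<in> T"
  shows "bary T u (x + s *\<^sub>R (z - w)) = bary T u x + (if u = z then s else if u = w then - s else 0)"
proof -
  have "bary T u (x + s *\<^sub>R (z - w)) - bary T u x = s * (bgrad u \<bullet> (z - w))"
    by (simp add: bary_diff[OF assms(4)])
  also have "\<dots> = s * (bary T u z - bary T u w)" by (simp add: bary_diff[OF assms(4)])
  also have "\<dots> = (if u = z then s else if u = w then - s else 0)"
    using assms by (simp add: bary_vertex)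
  finally show ?thesis by simp
qed

lemma core_exchange:
  assumes "z \<in> T" "w \<in> T" "z \<noteq> w" "\<bar>s\<bar> \<le> margin CARD('n)"
  shows "core_point z + s *\<^sub>R (z - w) \<in> core z"
  using assms margin_pos by (auto simp: core_def bary_exchange)

lemma prod_bary_exchange:
  assumes zw: "z \<in> T" "w \<in> T" "z \<noteq> w"
  shows "(\<Prod>u\<in>T - {z, w}. bary T u (x + s *\<^sub>R (z - w))) = (\<Prod>u\<in>T - {z, w}. bary T u x)"
  by (rule prod.cong) (use zw in \<open>auto simp: bary_exchange\<close>)

lemma bubble_exchange:
  assumes zw: "z \<in> T" "w \<in> T" "z \<noteq> w"
  shows "bubble T (x + s *\<^sub>R (z - w)) =
    (bary T z x + s) * (bary T w x - s) * (\<Prod>u\<in>T - {z, w}. bary T u x)"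
proof -
  have "bubble T (x + s *\<^sub>R (z - w)) = bary T z (x + s *\<^sub>R (z - w)) *
      (bary T w (x + s *\<^sub>R (z - w)) * (\<Prod>u\<in>T - {z} - {w}. bary T u (x + s *\<^sub>R (z - w))))"
    unfolding bubble_def using fin zw
    by (subst prod.remove[of _ z], simp, simp, subst prod.remove[of _ w]) auto
  also have "T - {z} - {w} = T - {z, w}" by auto
  finally show ?thesis
    unfolding prod_bary_exchange[OF zw] using zw by (simp add: bary_exchange)
qed

text \<open>Only the coordinates of \<open>z\<close> and \<open>w\<close> vary along the edge, so
  the bubble is quadratic in \<open>s\<close>, with minus the product of the other coordinates as
  leading coefficient.\<close>

lemma bubble_second_difference:
  assumes zw: "z \<in> T" "w \<in> T" "z \<noteq> w"
  shows "bubble T (x + s *\<^sub>R (z - w)) - 2 * bubble T x + bubble T (x - s *\<^sub>R (z - w)) =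
    - 2 * s\<^sup>2 * (\<Prod>u\<in>T - {z, w}. bary T u x)"
  using bubble_exchange[OF zw, of x s] bubble_exchange[OF zw, of x 0] bubble_exchange[OF zw, of x "- s"]
  by (simp add: algebra_simps power2_eq_square)

lemma prod_core_point:
  assumes zw: "z \<in> T" "w \<in> T" "z \<noteq> w"
  shows "(\<Prod>u\<in>T - {z, w}. bary T u (core_point z)) = (2 * margin CARD('n)) ^ (CARD('n) - 1)"
proof -
  have "(\<Prod>u\<in>T - {z, w}. bary T u (core_point z)) = (\<Prod>u\<in>T - {z, w}. 2 * margin CARD('n))"
    by (rule prod.cong) (use zw in \<open>auto simp: bary_core_point\<close>)
  also have "card (T - {z, w}) = CARD('n) - 1"
    using zw fin card_T by (subst card_Diff_subset) auto
  then have "(\<Prod>u\<in>T - {z, w}. 2 * margin CARD('n)) = (2 * margin CARD('n)) ^ (CARD('n) - 1)" by simp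
  finally show ?thesis .
qed

text \<open>This is the derivative in \<open>s\<close> of the quadratic from
  \<open>bubble_exchange\<close>. It is affine in \<open>s\<close>, so the difference of two values
  recovers the product of the other coordinates.\<close>

lemma bubble_grad_exchange:
  assumes zw: "z \<in> T" "w \<in> T" "z \<noteq> w"
  shows "bubble_grad (core_point z + s *\<^sub>R (z - w)) \<bullet> (z - w) =
    (2 * margin CARD('n) - s - (1 - 2 * real CARD('n) * margin CARD('n)
        + s)) * (2 * margin CARD('n)) ^ (CARD('n) - 1)"
proof -
  let ?x = "core_point z + s *\<^sub>R (z - w)"
  let ?P = "\<lambda>u. \<Prod>v\<in>T - {u}. bary T v ?x"
  have "bubble_grad ?x \<bullet> (z - w) = (\<Sum>u\<in>T. ?P u * (if u = z then 1 else if u = w then - 1 else 0))"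
    unfolding bubble_grad_def inner_sum_left
  proof (rule sum.cong)
    fix u assume u: "u \<in> T"
    have "bgrad u \<bullet> (z - w) = bary T u z - bary T u w" by (simp add: bary_diff[OF u])
    then show "(?P u *\<^sub>R bgrad u) \<bullet> (z - w) = ?P u * (if u = z then 1 else if u = w then - 1 else 0)"
      using u zw by (simp add: bary_vertex)
  qed simp
  also have "\<dots> = ?P z + (- ?P w + (\<Sum>u\<in>T - {z} - {w}. 0))"
  proof -
    have "(\<Sum>u\<in>T. ?P u * (if u = z then 1 else if u = w then - 1 else 0)) =
      ?P z + (- ?P w + (\<Sum>u\<in>T - {z} - {w}. ?P u * (if u = z then 1 else if u = w then - 1 else 0)))"
      using fin zw by (subst sum.remove[of _ z], simp, simp, subst sum.remove[of _ w]) auto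
    moreover have "(\<Sum>u\<in>T - {z} - {w}. ?P u * (if u = z then 1 else if u = w then - 1 else 0)) = 0"
      by (rule sum.neutral) auto
    ultimately show ?thesis by simp
  qed
  also have "?P z = bary T w ?x * (\<Prod>u\<in>T - {z, w}. bary T u ?x)"
    using fin zw by (subst prod.remove[of _ w]) (auto intro!: arg_cong2[where f = times] prod.cong)
  also have "?P w = bary T z ?x * (\<Prod>u\<in>T - {z, w}. bary T u ?x)"
    using fin zw by (subst prod.remove[of _ z]) (auto intro!: arg_cong2[where f = times] prod.cong)
  finally show ?thesis
    unfolding prod_bary_exchange[OF zw] prod_core_point[OF zw]
    using zw by (simp add: bary_exchange bary_core_point) (simp add: algebra_simps)
qed

text \<open>Let \<open>z\<close> be a vertex with maximal value. As the sum is nonnegative, all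
  values are at least \<open>- N * l z\<close>, hence
  \<open>l x >= l z * ((N + 1) * bary T z x - N)\<close>, which is positive once
  \<open>bary T z x > N / (N + 1)\<close>. The sum is N+1 times the value at the centroid.\<close>

lemma half_simplex:
  assumes l: "P1 l" and nz: "\<exists>z\<in>T. l z \<noteq> (0::real)" and sum: "0 \<le> (\<Sum>z\<in>T. l z)"
  obtains z where "z \<in> T" "\<And>x. x \<in> vertex_region z \<Longrightarrow> 0 < l x"
proof -
  have "finite (l ` T)" "l ` T \<noteq> {}" using fin nz by auto
  then have "Max (l ` T) \<in> l ` T" by (rule Max_in)
  then obtain z where z: "z \<in> T" "l z = Max (l ` T)" by auto
  have max: "l w \<le> l z" if "w \<in> T" for w unfolding z(2) using that fin by simp
  have pos: "0 < l z"
  proof (rule ccontr)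
    assume "\<not> 0 < l z"
    then have np: "l w \<le> 0" if "w \<in> T" for w using max[OF that] by linarith
    then have "(\<Sum>z\<in>T. l z) = 0" using sum sum_nonpos[of T l] by auto
    then show False
      using sum_nonneg_eq_0_iff[OF fin, of "\<lambda>w. - l w"] np nz by (auto simp: sum_negf)
  qed
  have low: "- real CARD('n) * l z \<le> l w" if w: "w \<in> T" for w
  proof -
    have "(\<Sum>v\<in>T. l v) = l w + (\<Sum>v\<in>T - {w}. l v)" by (rule sum.remove[OF fin w])
    also have "(\<Sum>v\<in>T - {w}. l v) \<le> (\<Sum>v\<in>T - {w}. l z)" using max by (intro sum_mono) auto
    also have "\<dots> = real CARD('n) * l z" using card_T fin w by simp
    finally show ?thesis using sum by simp
  qed
  have "0 < l x" if x: "x \<in> vertex_region z" for x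
  proof -
    have b: "0 \<le> bary T w x" if "w \<in> T" for w
      using x that open_simplex_iff by (force simp: vertex_region_def)
    have "(real CARD('n) + 1) * bary T z x > real CARD('n)"
      using x by (simp add: vertex_region_def field_simps)
    then have "0 < l z * ((real CARD('n) + 1) * bary T z x - real CARD('n))" using pos by simp
    also have "\<dots> = bary T z x * l z + (1 - bary T z x) * (- real CARD('n) * l z)"
      by (simp add: algebra_simps)
    also have "1 - bary T z x = (\<Sum>w\<in>T - {z}. bary T w x)"
      using bary_sum[of x] sum.remove[OF fin z(1), of "\<lambda>w. bary T w x"] by simp
    also have "bary T z x * l z + (\<Sum>w\<in>T - {z}. bary T w x) * (- real CARD('n) * l z) \<le>
        bary T z x * l z + (\<Sum>w\<in>T - {z}. bary T w x * l w)"
      unfolding sum_distrib_right using low b by (intro add_left_mono sum_mono mult_left_mono) auto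
    also have "\<dots> = l x"
      using P1_expand[OF l, of x] sum.remove[OF fin z(1), of "\<lambda>w. bary T w x * l w"] by simp
    finally show ?thesis .
  qed
  then show ?thesis using z(1) that by blast
qed

text \<open>A bound by the maximum over \<open>core z\<close> is turned into one by an integral mean: a function
  whose Lipschitz constant is controlled by its maximum is at least half as large near a
  maximum point.\<close>

lemma core_max:
  fixes g :: "real^'n \<Rightarrow> 'b::real_normed_vector"
  assumes z: "z \<in> T" and D: "1 / margin CARD('n) \<le> 2 * D"
    and lip: "\<And>M. 0 \<le> M \<Longrightarrow> (\<And>x. x \<in> core z \<Longrightarrow> norm (g x) \<le> M) \<Longrightarrow>
      (\<And>x y. x \<in> convex hull T \<Longrightarrow> y \<in> convex hull T \<Longrightarrow>
         norm (g x - g y) \<le> D * (\<rho> / hdiam T) * M * norm (x - y))"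
    and cont: "continuous_on (core z) g"
  obtains x1 M where "0 \<le> M" "\<And>x. x \<in> core z \<Longrightarrow> norm (g x) \<le> M"
    "ball x1 (hdiam T / (2 * \<rho> * D)) \<subseteq> vertex_region z"
    "\<And>y. y \<in> ball x1 (hdiam T / (2 * \<rho> * D)) \<Longrightarrow> M / 2 \<le> norm (g y)"
proof -
  have "\<exists>x\<in>core z. \<forall>y\<in>core z. norm (g y) \<le> norm (g x)"
    using compact_core[OF z] core_point_in_core cont
    by (intro continuous_attains_sup continuous_intros) auto
  then obtain x1 where x1: "x1 \<in> core z" and max: "\<And>y. y \<in> core z \<Longrightarrow> norm (g y) \<le> norm (g x1)"
    by blast
  let ?M = "norm (g x1)"
  have "0 < 2 * D" using D margin_pos by (smt (verit) divide_pos_pos)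
  then have D0: "0 < D" by simp
  have \<rho>: "0 < \<rho>" using rho_ge_1 by simp
  \<comment> \<open>In barycentric coordinates the ball has radius at most
    \<open>1 / (2 * D) <= margin\<close>, so it stays in \<open>vertex_region z\<close>; on it the
    Lipschitz bound loses at most \<open>D * M / (2 * D) = M / 2\<close>.\<close>
  have *: "\<rho> / hdiam T * norm (y - x1) < 1 / (2 * D)"
    if "y \<in> ball x1 (hdiam T / (2 * \<rho> * D))" for y
  proof -
    have "norm (y - x1) < hdiam T / (2 * \<rho> * D)" using that by (simp add: dist_norm norm_minus_commute)
    then have "\<rho> / hdiam T * norm (y - x1) < \<rho> / hdiam T * (hdiam T / (2 * \<rho> * D))"
      using \<rho> hdiam_pos by (intro mult_strict_left_mono) auto
    also have "\<dots> = 1 / (2 * D)" using \<rho> hdiam_pos by simp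
    finally show ?thesis .
  qed
  have le: "1 / (2 * D) \<le> margin CARD('n)" using D D0 margin_pos by (simp add: field_simps)
  have sub: "ball x1 (hdiam T / (2 * \<rho> * D)) \<subseteq> vertex_region z"
    using core_ball[OF z x1] * le by fastforce
  show ?thesis
  proof (rule that[OF norm_ge_zero max sub])
    fix y assume y: "y \<in> ball x1 (hdiam T / (2 * \<rho> * D))"
    have "y \<in> convex hull T" "x1 \<in> convex hull T"
      using sub y open_simplex_subset core_subset_hull[OF z] x1 by (auto simp: vertex_region_def)
    then have "norm (g y - g x1) \<le> D * (\<rho> / hdiam T) * ?M * norm (y - x1)"
      using lip[OF norm_ge_zero max] by simp
    also have "\<dots> = (D * ?M) * (\<rho> / hdiam T * norm (y - x1))" by (simp add: mult_ac)
    also have "\<dots> \<le> (D * ?M) * (1 / (2 * D))"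
      using *[OF y] D0 by (intro mult_left_mono) auto
    also have "\<dots> = ?M / 2" using D0 by simp
    finally show "?M / 2 \<le> norm (g y)"
      using norm_triangle_ineq2[of "g x1" "g y"] by (simp add: norm_minus_commute)
  qed
qed

text \<open>The second difference of \<open>p\<close> vanishes, which leaves \<open>\<beta>\<close>;
  subtracting the bubble bounds \<open>p\<close> on the core, and its values there bound its
  slope.\<close>

lemma core_value_bounds:
  fixes p :: "real^'n \<Rightarrow> 'b::real_normed_vector"
  assumes z: "z \<in> T" and p: "P1 p" and M: "0 \<le> M"
    and f: "\<And>x. x \<in> core z \<Longrightarrow> norm (p x + bubble T x *\<^sub>R \<beta>) \<le> M"
  shows "norm \<beta> \<le> value_const CARD('n) * M"
    and "norm (p (core_point z)) \<le> value_const CARD('n) * M"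
    and "norm (p (x + u) - p x) \<le> value_const CARD('n) * (\<rho> / hdiam T) * M * norm u"
    and "x \<in> convex hull T \<Longrightarrow> y \<in> convex hull T \<Longrightarrow>
      norm ((p x + bubble T x *\<^sub>R \<beta>) - (p y + bubble T y *\<^sub>R \<beta>))
        \<le> value_const CARD('n) * (\<rho> / hdiam T) * M * norm (x - y)"
proof -
  let ?t = "margin CARD('n)" and ?x0 = "core_point z"
  define B where "B = 2 / (?t * bubble_lower CARD('n))"
  have t: "0 < ?t" "?t \<le> 1" by (rule margin_pos margin_le_1)+
  have B: "0 \<le> B" using t bubble_lower_pos by (simp add: B_def)
  have vc: "value_const CARD('n) = 2 * (1 + B) / ?t + B * (real CARD('n) + 1)"
    by (simp add: value_const_def B_def)
  have D1: "2 * (1 + B) / ?t \<le> value_const CARD('n)" unfolding vc using B by simp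
  have "1 + B \<le> 2 * (1 + B) / ?t"
  proof -
    have "(1 + B) * ?t \<le> (1 + B) * 2" using B t by (intro mult_left_mono) auto
    then show ?thesis using t(1) by (simp add: pos_le_divide_eq mult.commute)
  qed
  then have D2: "1 + B \<le> value_const CARD('n)" using D1 by linarith
  obtain w where w: "w \<in> T" "w \<noteq> z" using ex_other_vertex[OF z] .
  let ?e = "z - w" and ?f = "\<lambda>x. p x + bubble T x *\<^sub>R \<beta>"
  have x0: "?x0 + s *\<^sub>R ?e \<in> core z" if "\<bar>s\<bar> \<le> ?t" for s
    by (rule core_exchange) (use z w that in auto)
  have pd: "p (?x0 + ?t *\<^sub>R ?e) - p ?x0 = p (?x0 - ?t *\<^sub>R ?e + ?t *\<^sub>R ?e) - p (?x0 - ?t *\<^sub>R ?e)"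
    by (rule P1_add_diff[OF p])
  let ?b = "\<lambda>s. bubble T (?x0 + s *\<^sub>R ?e)"
  have bd: "?b ?t - 2 * ?b 0 + ?b (- ?t) = - (2 * ?t * bubble_lower CARD('n))"
    using bubble_second_difference[of z w ?x0 ?t] z w
    by (simp add: prod_core_point bubble_lower_def power2_eq_square)
  have "?f (?x0 + ?t *\<^sub>R ?e) - 2 *\<^sub>R ?f (?x0 + 0 *\<^sub>R ?e) + ?f (?x0 + (- ?t) *\<^sub>R ?e)
      = (?b ?t - 2 * ?b 0 + ?b (- ?t)) *\<^sub>R \<beta>"
    using pd by (simp add: scaleR_2 algebra_simps)
  then have "2 * ?t * bubble_lower CARD('n) * norm \<beta> =
      norm (?f (?x0 + ?t *\<^sub>R ?e) - 2 *\<^sub>R ?f (?x0 + 0 *\<^sub>R ?e) + ?f (?x0 + (- ?t) *\<^sub>R ?e))"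
    unfolding bd using t bubble_lower_pos by (simp add: abs_mult)
  also have "\<dots> \<le> norm (?f (?x0 + ?t *\<^sub>R ?e))
      + norm (2 *\<^sub>R ?f (?x0 + 0 *\<^sub>R ?e)) + norm (?f (?x0 + (- ?t) *\<^sub>R ?e))"
    by (intro order_trans[OF norm_triangle_ineq] add_right_mono norm_triangle_ineq4)
  \<comment> \<open>All three points lie in the core; dividing \<open>4 * M\<close> by
    \<open>2 * margin * bubble_lower\<close> gives \<open>B * M\<close>.\<close>
  also have "\<dots> \<le> M + 2 * M + M"
    using f[OF x0[of ?t]] f[OF x0[of 0]] f[OF x0[of "- ?t"]] t by (intro add_mono) auto
  finally have beta: "norm \<beta> \<le> B * M"
    using t bubble_lower_pos by (simp add: B_def field_simps)
  show "norm \<beta> \<le> value_const CARD('n) * M"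
    using beta mult_right_mono[OF _ M, of B "value_const CARD('n)"] D2 by linarith
  have pb: "norm (p x) \<le> (1 + B) * M" if "x \<in> core z" for x
  proof -
    have xh: "x \<in> convex hull T" using core_subset_hull[OF z] that by blast
    have "norm (p x) \<le> norm (?f x) + norm (bubble T x *\<^sub>R \<beta>)"
      using norm_triangle_ineq4[of "?f x" "bubble T x *\<^sub>R \<beta>"] by simp
    also have "norm (bubble T x *\<^sub>R \<beta>) \<le> 1 * norm \<beta>"
      unfolding norm_scaleR using bubble_bounds[OF xh] by (intro mult_right_mono) auto
    finally show ?thesis using f[OF that] beta by (simp add: algebra_simps)
  qed
  show "norm (p (core_point z)) \<le> value_const CARD('n) * M"
    using pb[OF core_point_in_core] mult_right_mono[OF D2 M] by linarith
  have h: "0 < \<rho> / hdiam T" using hdiam_pos rho_ge_1 by simp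
  have lin: "norm (p (x + u) - p x) \<le> 2 * (1 + B) / ?t * (\<rho> / hdiam T) * M * norm u" for x u
  proof (cases "u = 0")
    case False
    \<comment> \<open>The multiple of \<open>u\<close> for which the condition of
      \<open>core_point_ball\<close> holds with equality.\<close>
    define c where "c = ?t / (\<rho> / hdiam T * norm u)"
    have c: "0 < c" unfolding c_def using False h t by (intro divide_pos_pos mult_pos_pos[OF h]) auto
    obtain L a where L: "linear L" "\<And>x. p x = L x + a" using p by (auto simp: P1_def)
    have "norm (c *\<^sub>R u) = c * norm u" using c by simp
    moreover have "\<rho> / hdiam T * (c * norm u) = ?t"
      using False rho_ge_1 hdiam_pos by (simp add: c_def)
    ultimately have "\<rho> / hdiam T * norm (c *\<^sub>R u) \<le> ?t" by (simp only: order_refl)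
    then have "?x0 + c *\<^sub>R u \<in> core z" by (rule core_point_ball)
    then have "norm (p (?x0 + c *\<^sub>R u)) \<le> (1 + B) * M" by (rule pb)
    then have "norm (p (?x0 + c *\<^sub>R u) - p ?x0) \<le> 2 * (1 + B) * M"
      using pb[OF core_point_in_core[of z]] norm_triangle_ineq4[of "p (?x0 + c *\<^sub>R u)"
          "p ?x0"] by linarith
    moreover have "p (?x0 + c *\<^sub>R u) - p ?x0 = c *\<^sub>R (p (x + u) - p x)"
      by (simp add: L(2) linear_add[OF L(1)] linear_cmul[OF L(1)])
    ultimately have "c * norm (p (x + u) - p x) \<le> 2 * (1 + B) * M" using c by simp
    then have "norm (p (x + u) - p x) \<le> 2 * (1 + B) * M / c" using c by (simp add: field_simps)
    also have "\<dots> = 2 * (1 + B) / ?t * (\<rho> / hdiam T) * M * norm u"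
      using t h False by (simp add: c_def)
    finally show ?thesis .
  qed simp
  have "2 * (1 + B) / ?t * (\<rho> / hdiam T) * M * norm u \<le> value_const CARD('n) * (\<rho> / hdiam T) * M * norm u"
    using D1 h M by (intro mult_right_mono) auto
  then show "norm (p (x + u) - p x) \<le> value_const CARD('n) * (\<rho> / hdiam T) * M * norm u"
    using lin[where x = x and u = u] by linarith
  assume xy: "x \<in> convex hull T" "y \<in> convex hull T"
  have "?f x - ?f y = (p (y + (x - y)) - p y) + (bubble T x - bubble T y) *\<^sub>R \<beta>"
    by (simp add: scaleR_left_diff_distrib)
  also have "norm \<dots> \<le> norm (p (y + (x - y)) - p y) + \<bar>bubble T x - bubble T y\<bar> * norm \<beta>"
    by (metis norm_scaleR norm_triangle_ineq)
  also have "\<dots> \<le> 2 * (1 + B) / ?t * (\<rho> / hdiam T) * M * norm (x - y) +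
      (real (Suc CARD('n)) * (\<rho> / hdiam T) * norm (x - y)) * (B * M)"
    using bubble_lipschitz[OF xy] beta by (intro add_mono lin mult_mono) auto
  also have "\<dots> = value_const CARD('n) * (\<rho> / hdiam T) * M * norm (x - y)"
    unfolding vc by (simp add: algebra_simps)
  finally show "norm (?f x - ?f y) \<le> value_const CARD('n) * (\<rho> / hdiam T) * M * norm (x - y)" .
qed

lemma value_const_ge: "1 / margin CARD('n) \<le> 2 * value_const CARD('n)" "1 \<le> value_const CARD('n)"
proof -
  define B where "B = 2 / (margin CARD('n) * bubble_lower CARD('n))"
  have B: "0 \<le> B" using margin_pos bubble_lower_pos by (simp add: B_def)
  have "1 / margin CARD('n) \<le> 2 * (1 + B) / margin CARD('n)"
      using margin_pos B by (intro divide_right_mono) auto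
  also have "\<dots> \<le> value_const CARD('n)" unfolding value_const_def Let_def B_def[symmetric] using B by simp
  finally have *: "1 / margin CARD('n) \<le> value_const CARD('n)" .
  moreover have "1 \<le> 1 / margin CARD('n)" using margin_pos margin_le_1 by simp
  ultimately show "1 \<le> value_const CARD('n)" "1 / margin CARD('n) \<le> 2 * value_const CARD('n)" by linarith+
qed

text \<open>\<open>G\<close> cancels in the difference of the matrices at two points of the core.
  Applied to the edge direction, this difference is \<open>- 2 * bubble_lower\<close> times
  \<open>\<beta>\<close>. The edge has length at most \<open>hdiam T\<close>, hence that factor in
  the first bound.\<close>

lemma core_grad_bounds:
  fixes G :: "real^'n^'n"
  assumes z: "z \<in> T" and M: "0 \<le> M"
    and J: "\<And>x. x \<in> core z \<Longrightarrow> norm (G + outer \<beta> (bubble_grad x)) \<le> M"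
  shows "norm \<beta> \<le> grad_const CARD('n) \<rho> * hdiam T * M"
    and "norm G \<le> grad_const CARD('n) \<rho> * M"
    and "x \<in> convex hull T \<Longrightarrow> y \<in> convex hull T \<Longrightarrow>
      norm ((G + outer \<beta> (bubble_grad x)) - (G + outer \<beta> (bubble_grad y)))
        \<le> grad_const CARD('n) \<rho> * (\<rho> / hdiam T) * M * norm (x - y)"
proof -
  let ?t = "margin CARD('n)" and ?x0 = "core_point z" and ?J = "\<lambda>x. G + outer \<beta> (bubble_grad x)"
  let ?b = "bubble_lower CARD('n)"
  have t: "0 < ?t" "?t \<le> 1" by (rule margin_pos margin_le_1)+
  have b: "0 < ?b" by (rule bubble_lower_pos)
  have h: "0 < hdiam T" by (rule hdiam_pos)
  obtain w where w: "w \<in> T" "w \<noteq> z" using ex_other_vertex[OF z] .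
  let ?e = "z - w"
  have x0: "?x0 + s *\<^sub>R ?e \<in> core z" if "\<bar>s\<bar> \<le> ?t" for s
    by (rule core_exchange) (use z w that in auto)
  have bg: "bubble_grad (?x0 + s *\<^sub>R ?e) \<bullet> ?e =
      (2 * ?t - s - (1 - 2 * real CARD('n) * ?t + s)) * (2 * ?t) ^ (CARD('n) - 1)" for s
    by (rule bubble_grad_exchange) (use z w in auto)
  have "(?J (?x0 + ?t *\<^sub>R ?e) - ?J (?x0 + 0 *\<^sub>R ?e)) *v ?e =
      (bubble_grad (?x0 + ?t *\<^sub>R ?e) \<bullet> ?e - bubble_grad (?x0 + 0 *\<^sub>R ?e) \<bullet> ?e) *\<^sub>R \<beta>"
    by (simp add: matrix_vector_mult_diff_rdistrib outer_mult_vec scaleR_left_diff_distrib)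
  also have "bubble_grad (?x0 + ?t *\<^sub>R ?e) \<bullet> ?e - bubble_grad (?x0 + 0 *\<^sub>R ?e) \<bullet> ?e = - (2 * ?b)"
    unfolding bg by (simp add: bubble_lower_def algebra_simps)
  finally have "2 * ?b * norm \<beta> = norm ((?J (?x0 + ?t *\<^sub>R ?e) - ?J (?x0 + 0 *\<^sub>R ?e)) *v ?e)"
    using b by (simp add: abs_mult)
  also have "\<dots> \<le> norm (?J (?x0 + ?t *\<^sub>R ?e) - ?J (?x0 + 0 *\<^sub>R ?e)) * norm ?e"
    by (rule norm_matrix_vector_mult_le)
  also have "\<dots> \<le> (M + M) * hdiam T"
  proof (rule mult_mono)
    show "norm (?J (?x0 + ?t *\<^sub>R ?e) - ?J (?x0 + 0 *\<^sub>R ?e)) \<le> M + M"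
      using J[OF x0[of ?t]] J[OF x0[of 0]] t
      by (intro order_trans[OF norm_triangle_ineq4] add_mono) auto
    show "norm ?e \<le> hdiam T" by (rule dist_hull_le[OF T_subset_hull T_subset_hull, OF z w(1)])
  qed (use M in auto)
  finally have beta: "norm \<beta> \<le> hdiam T * M / ?b" using b by (simp add: field_simps)
  have vc: "grad_const CARD('n) \<rho> = 2 / ?t + 1 + 1 / ?b + (real CARD('n) + 1)\<^sup>2 * \<rho> / ?b"
    by (simp add: grad_const_def add_divide_distrib)
  have pos: "0 \<le> 2 / ?t" "0 \<le> 1 / ?b" "0 \<le> (real CARD('n) + 1)\<^sup>2 * \<rho> / ?b"
    using t b rho_ge_1 by auto
  have "hdiam T * M / ?b = 1 / ?b * (hdiam T * M)" by simp
  also have "\<dots> \<le> grad_const CARD('n) \<rho> * (hdiam T * M)"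
    using pos M h by (intro mult_right_mono) (auto simp: vc)
  finally show "norm \<beta> \<le> grad_const CARD('n) \<rho> * hdiam T * M" using beta by (simp add: mult_ac)
  have x0h: "?x0 \<in> convex hull T" using core_subset_hull[OF z] core_point_in_core by blast
  have N1: "real CARD('n) + 1 \<le> (real CARD('n) + 1)\<^sup>2" by (simp add: power2_eq_square)
  have "norm G \<le> norm (?J ?x0) + norm (outer \<beta> (bubble_grad ?x0))"
    using norm_triangle_ineq4[of "?J ?x0" "outer \<beta> (bubble_grad ?x0)"] by simp
  also have "\<dots> \<le> M + (hdiam T * M / ?b) * (real (Suc CARD('n)) * (\<rho> / hdiam T))"
    unfolding norm_outer using J[OF core_point_in_core] beta norm_bubble_grad_le[OF x0h]
      h M b by (intro add_mono mult_mono) auto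
  also have "\<dots> = (1 + (real CARD('n) + 1) * \<rho> / ?b) * M"
    using h b by (simp add: divide_simps) (simp add: algebra_simps)
  also have "\<dots> \<le> grad_const CARD('n) \<rho> * M"
  proof (rule mult_right_mono[OF _ M])
    have "(real CARD('n) + 1) * \<rho> / ?b \<le> (real CARD('n) + 1)\<^sup>2 * \<rho> / ?b"
      using N1 rho_ge_1 b by (intro divide_right_mono mult_right_mono) auto
    then show "1 + (real CARD('n) + 1) * \<rho> / ?b \<le> grad_const CARD('n) \<rho>"
        using pos unfolding vc by linarith
  qed
  finally show "norm G \<le> grad_const CARD('n) \<rho> * M" .
  assume xy: "x \<in> convex hull T" "y \<in> convex hull T"
  have "?J x - ?J y = outer \<beta> (bubble_grad x - bubble_grad y)" by (simp add: outer_diff)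
  then have "norm (?J x - ?J y) = norm \<beta> * norm (bubble_grad x - bubble_grad y)" by (simp add: norm_outer)
  also have "\<dots> \<le> (hdiam T * M / ?b) * ((real (Suc CARD('n)) * (\<rho> / hdiam T))\<^sup>2 * norm (x - y))"
    using beta bubble_grad_lipschitz[OF xy] h M b by (intro mult_mono) auto
  also have "\<dots> = ((real CARD('n) + 1)\<^sup>2 * \<rho> / ?b) * ((\<rho> / hdiam T) * M * norm (x - y))"
    using h b by (simp add: divide_simps power2_eq_square) (simp add: algebra_simps)
  also have "\<dots> \<le> grad_const CARD('n) \<rho> * ((\<rho> / hdiam T) * M * norm (x - y))"
    using pos h M rho_ge_1 by (intro mult_right_mono) (auto simp: vc)
  finally show "norm (?J x - ?J y) \<le> grad_const CARD('n) \<rho> * (\<rho> / hdiam T) * M * norm (x - y)"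
    by (simp add: mult_ac)
qed

lemma grad_const_ge: "1 / margin CARD('n) \<le> 2 * grad_const CARD('n) \<rho>" "1 \<le> grad_const CARD('n) \<rho>"
proof -
  have "0 \<le> (1 + (real CARD('n) + 1)\<^sup>2 * \<rho>) / bubble_lower CARD('n)" "0 \<le> 1 / margin CARD('n)"
    using margin_pos bubble_lower_pos rho_ge_1 by (simp_all add: add_nonneg_nonneg)
  moreover have "2 / margin CARD('n) = 1 / margin CARD('n) + 1 / margin CARD('n)" by simp
  ultimately have *: "1 / margin CARD('n) + 1 \<le> grad_const CARD('n) \<rho>"
    unfolding grad_const_def by linarith
  then show "1 \<le> grad_const CARD('n) \<rho>" using \<open>0 \<le> 1 / margin CARD('n)\<close> by linarith
  then show "1 / margin CARD('n) \<le> 2 * grad_const CARD('n) \<rho>" using * by argo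
qed

end

section \<open>Traces on simplices cut by the discrete interface\<close>

lemma trace_from_eq:
  assumes "\<And>y. y \<in> S \<Longrightarrow> f y = F y" "isCont F x" "at x within S \<noteq> bot"
  shows "trace_from S f x = F x"
  unfolding trace_from_def
proof (rule tendsto_Lim)
  have "(F \<longlongrightarrow> F x) (at x within S)"
    using assms(2) unfolding continuous_at by (rule Lim_at_imp_Lim_at_within)
  moreover have "\<forall>\<^sub>F y in at x within S. F y = f y"
    using assms(1) by (auto simp: eventually_at_filter)
  ultimately show "(f \<longlongrightarrow> F x) (at x within S)" by (rule Lim_transform_eventually)
qed (use assms in auto)

lemma jac_eq:
  assumes "open S" "x \<in> S" "\<And>y. y \<in> S \<Longrightarrow> f y = F y" "(F has_derivative (\<lambda>h. A *v h)) (at x)"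
  shows "jac f x = A"
proof -
  have "(f has_derivative (\<lambda>h. A *v h)) (at x)"
    by (rule has_derivative_transform_within_open[OF assms(4,1,2)]) (use assms(3) in auto)
  then have "frechet_derivative f (at x) = (\<lambda>h. A *v h)" using frechet_derivative_at by metis
  then show ?thesis by (simp add: jac_def jacobian_def matrix_of_matrix_vector_mul)
qed

lemma grad_eq:
  assumes "open S" "x \<in> S" "\<And>y. y \<in> S \<Longrightarrow> f y = F y" "(F has_derivative (\<lambda>h. g \<bullet> h)) (at x)"
  shows "grad f x = g"
proof -
  have "(f has_derivative (\<lambda>h. g \<bullet> h)) (at x)"
    by (rule has_derivative_transform_within_open[OF assms(4,1,2)]) (use assms(3) in auto)
  then have "frechet_derivative f (at x) = (\<lambda>h. g \<bullet> h)" using frechet_derivative_at by metis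
  then show ?thesis by (simp add: grad_def vec_eq_iff inner_axis)
qed

lemma has_derivative_affine: "((\<lambda>x. A *v x + a) has_derivative (\<lambda>h. A *v h)) (at x)"
  for A :: "real^'n^'m"
  by (rule has_derivative_eq_rhs)
    (rule derivative_intros bounded_linear.has_derivative[OF matrix_vector_mul_bounded_linear] | simp)+

lemma has_derivative_affine_inner: "((\<lambda>x. g \<bullet> x + c) has_derivative (\<lambda>h. g \<bullet> h)) (at x)"
  by (auto intro!: derivative_eq_intros)

lemma transpose_outer: "transpose (outer b g) = outer g b"
  by (simp add: outer_def transpose_def vec_eq_iff mult.commute)

lemma trace_outer: "trace (outer b g) = b \<bullet> g"
  by (simp add: outer_def trace_def inner_vec_def)

lemma mat_mult_vec: "mat k *v x = k *\<^sub>R (x :: real^'n)"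
proof -
  have "(mat k *v x) $ i = k * x $ i" for i
    by (simp add: matrix_vector_mult_def mat_def if_distrib[of "\<lambda>t. t * _"] cong: if_cong)
  then show ?thesis by (simp add: vec_eq_iff)
qed

lemma norm_transpose_mult_le: "norm (transpose A *v x) \<le> norm A * norm x" for A :: "real^'n^'m"
proof -
  let ?y = "transpose A *v x"
  have "norm ?y * norm ?y = ?y \<bullet> ?y" by (simp add: dot_square_norm power2_eq_square)
  also have "\<dots> = x \<bullet> (A *v ?y)" by (simp add: dot_lmul_matrix)
  also have "\<dots> \<le> norm x * norm (A *v ?y)" by (rule norm_cauchy_schwarz)
  also have "\<dots> \<le> norm x * (norm A * norm ?y)"
    by (intro mult_left_mono norm_matrix_vector_mult_le) auto
  finally show ?thesis by (cases "?y = 0") (auto simp: mult_ac)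
qed

text \<open>The crude factor from \<open>hausdorff_outer_subspace_le\<close> for
  \<open>k = N - 1\<close>; it depends on N alone.\<close>

definition surf_const :: "nat \<Rightarrow> real" where
  "surf_const N = unit_ball_vol (real (N - 1)) * real (N - 1) ^ (N - 1)"

lemma surf_const_nonneg: "0 \<le> surf_const N"
  by (simp add: surf_const_def)

lemma hausdorff_outer_hyperplane_le:
  fixes A :: "(real^'n) set"
  assumes N: "CARD('n) \<ge> 2" and g: "g \<noteq> 0" and A: "\<And>x. x \<in> A \<Longrightarrow> g \<bullet> x = b"
    and R: "\<And>x y. x \<in> A \<Longrightarrow> y \<in> A \<Longrightarrow> norm (x - y) \<le> R" "0 \<le> R"
  shows "hausdorff_outer (CARD('n) - 1) A \<le> ennreal (surf_const CARD('n) * R ^ (CARD('n) - 1))"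
proof (cases "A = {}")
  case True
  then show ?thesis using N by (simp add: hausdorff_outer_empty)
next
  case False
  then obtain p where p: "p \<in> A" by blast
  have "hausdorff_outer (CARD('n) - 1) A \<le>
      ennreal (unit_ball_vol (real (CARD('n) - 1)) * (real (CARD('n) - 1) * R) ^ (CARD('n) - 1))"
  proof (rule hausdorff_outer_subspace_le[of "{x. g \<bullet> x = 0}" _ p])
    show "dim {x. g \<bullet> x = 0} \<le> CARD('n) - 1" using dim_hyperplane[OF g] by simp
  qed (use p A R N in \<open>auto simp: subspace_hyperplane inner_diff_right\<close>)
  then show ?thesis by (simp add: surf_const_def power_mult_distrib mult.assoc)
qed

text \<open>The vector \<open>u\<close> witnesses that \<open>g'\<close> is not a multiple of
  \<open>g\<close>, so the intersection of the two hyperplanes has dimension less than N-1 and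
  measure 0.\<close>

lemma hausdorff_outer_codim2:
  fixes A :: "(real^'n) set"
  assumes N: "CARD('n) \<ge> 2" and g: "g \<noteq> 0" and A: "\<And>x. x \<in> A \<Longrightarrow> g \<bullet> x = b \<and> g' \<bullet> x = b'"
    and u: "g \<bullet> u = 0" "g' \<bullet> u \<noteq> 0" and bdd: "bounded A"
  shows "hausdorff_outer (CARD('n) - 1) A = 0"
proof (cases "A = {}")
  case True
  then show ?thesis using N by (simp add: hausdorff_outer_empty)
next
  case False
  then obtain p where p: "p \<in> A" by blast
  obtain R where R: "0 < R" "\<And>x. x \<in> A \<Longrightarrow> norm (x - p) \<le> R"
    using bounded_subset_cball[of A] bdd
    by (metis bounded_pos bounded_translation_minus imageI)
  let ?S = "{x. g \<bullet> x = 0} \<inter> {x. g' \<bullet> x = 0}"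
  have S: "subspace ?S" by (intro subspace_inter subspace_hyperplane)
  have "?S \<subset> {x. g \<bullet> x = 0}" using u by auto
  then have "dim ?S < dim {x. g \<bullet> x = 0}"
    by (intro dim_psubset) (use S in \<open>simp add: span_eq_iff[THEN iffD2] subspace_hyperplane\<close>)
  then have "dim ?S < CARD('n) - 1" using dim_hyperplane[OF g] by simp
  then show ?thesis
    by (intro hausdorff_outer_subspace_zero[OF S, of A p R])
      (use p A R N in \<open>auto simp: inner_diff_right\<close>)
qed

context regular_simplex
begin

lemma P1_interp: "P1 (interp T g)"
proof -
  have "P1 (\<lambda>x. \<Sum>z\<in>T. bary T z x *\<^sub>R g z)" by (intro P1_sum P1_scaleR_const P1_bary)
  also have "(\<lambda>x. \<Sum>z\<in>T. bary T z x *\<^sub>R g z) = interp T g" by (auto simp: interp_def)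
  finally show ?thesis .
qed

lemma interp_vertex: "z \<in> T \<Longrightarrow> interp T g z = g z"
proof -
  assume z: "z \<in> T"
  have "interp T g z = (\<Sum>w\<in>T. if w = z then g w else 0)"
    unfolding interp_def by (rule sum.cong) (use z in \<open>auto simp: bary_vertex\<close>)
  also have "\<dots> = g z" using z fin by simp
  finally show ?thesis .
qed

lemma interp_minus: "interp T (\<lambda>x. - g x) x = - interp T g x"
  by (simp add: interp_def sum_negf)

text \<open>Reversing the sign of \<open>d\<close> exchanges the sides, so facts about the minus
  side follow from those about the plus side.\<close>

lemma elem_minus_eq: "elem_minus d T = elem_plus (\<lambda>x. - d x) T"
  by (simp add: elem_minus_def elem_plus_def interp_minus)

lemma open_elem_plus: "open (elem_plus d T)"
proof -
  have "elem_plus d T = open_simplex T \<inter> {x. 0 < interp T d x}" by (auto simp: elem_plus_def)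
  then show ?thesis
    using open_open_simplex by (auto intro!: open_Int open_Collect_less continuous_on_P1 P1_interp P1_const)
qed

lemma open_elem_minus: "open (elem_minus d T)"
  unfolding elem_minus_eq by (rule open_elem_plus)

lemma elem_plus_nonempty:
  assumes "x \<in> convex hull T" "0 < interp T d x" shows "elem_plus d T \<noteq> {}"
proof -
  have "open {x. 0 < interp T d x}"
    by (intro open_Collect_less continuous_on_P1 P1_interp P1_const)
  then have "{x. 0 < interp T d x} \<inter> open_simplex T \<noteq> {}"
    using open_Int_closure_eq_empty[of "{x. 0 < interp T d x}" "open_simplex T"] assms
    by (auto simp: closure_open_simplex)
  then show ?thesis by (auto simp: elem_plus_def)
qed

text \<open>The segment from \<open>x\<close> to a point of \<open>elem_plus d T\<close> lies in
  this set except possibly for \<open>x\<close> itself, because all inequalities are strict at the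
  far end. So \<open>x\<close> is a limit point, and a trace at \<open>x\<close> is determined by
  the limit.\<close>

lemma at_within_elem_plus:
  assumes x: "x \<in> convex hull T" "0 \<le> interp T d x" and "elem_plus d T \<noteq> {}"
  shows "at x within elem_plus d T \<noteq> bot"
proof -
  obtain y where y: "y \<in> elem_plus d T" using assms by blast
  have in_plus: "(1 - t) *\<^sub>R x + t *\<^sub>R y \<in> elem_plus d T" if t: "0 < t" "t \<le> 1" for t
  proof -
    have "0 < (1 - t) *\<^sub>R bary T z x + t *\<^sub>R bary T z y" if "z \<in> T" for z
      using x(1) y t that
      by (intro add_nonneg_pos) (auto simp: convex_hull_iff elem_plus_def open_simplex_iff)
    moreover have "0 < (1 - t) *\<^sub>R interp T d x + t *\<^sub>R interp T d y"
      using x(2) y t by (intro add_nonneg_pos) (auto simp: elem_plus_def)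
    ultimately show ?thesis
      by (simp add: elem_plus_def open_simplex_iff P1_convex_combination[OF P1_bary]
          P1_convex_combination[OF P1_interp])
  qed
  have "x \<in> closure (elem_plus d T)"
    unfolding closure_approachable
  proof (intro allI impI)
    fix e :: real assume e: "0 < e"
    \<comment> \<open>Small enough for \<open>t * norm (y - x) < e\<close>; the \<open>+ 1\<close>
      covers \<open>y = x\<close>.\<close>
    define t where "t = min 1 (e / (2 * (norm (y - x) + 1)))"
    have t: "0 < t" "t \<le> 1" using e by (auto simp: t_def add_nonneg_pos)
    have "(1 - t) *\<^sub>R x + t *\<^sub>R y - x = t *\<^sub>R (y - x)" by (simp add: algebra_simps)
    then have "dist ((1 - t) *\<^sub>R x + t *\<^sub>R y) x = t * norm (y - x)" using t by (simp add: dist_norm)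
    also have "\<dots> \<le> e / (2 * (norm (y - x) + 1)) * norm (y - x)"
      by (intro mult_right_mono) (auto simp: t_def)
    also have "\<dots> < e"
    proof -
      have "e * norm (y - x) < e * (2 * (norm (y - x) + 1))"
        using e by (intro mult_strict_left_mono) (auto intro: add_nonneg_pos)
      moreover have "0 < 2 * (norm (y - x) + 1)" by (auto intro: add_nonneg_pos)
      ultimately show ?thesis by (simp add: pos_divide_less_eq)
    qed
    finally show "\<exists>y\<in>elem_plus d T. dist y x < e" using in_plus[OF t] by blast
  qed
  then have "x islimpt elem_plus d T"
    using interior_limit_point[of x "elem_plus d T"] open_elem_plus[of d]
    by (auto simp: closure_def interior_open)
  then show ?thesis by (simp add: trivial_limit_within)
qed

lemma at_within_elem_minus:
  assumes "x \<in> convex hull T" "interp T d x \<le> 0" and "elem_minus d T \<noteq> {}"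
  shows "at x within elem_minus d T \<noteq> bot"
  using at_within_elem_plus[of x "\<lambda>x. - d x"] assms by (simp add: elem_minus_eq interp_minus)

end

text \<open>If \<open>d\<close> vanished at all vertices, \<open>interp T d\<close> would be 0, both
  sides would be empty and every inner trace a default value. The locale also serves for elements
  that \<Gamma> does not cut.\<close>

locale resolved_simplex = regular_simplex T \<rho> for T :: "(real^'n) set" and \<rho> +
  fixes d :: "real^'n \<Rightarrow> real"
  assumes resolved: "\<exists>z\<in>T. d z \<noteq> 0"
begin

lemma simplex_minus_Gam: "open_simplex T - Gam d T = elem_plus d T \<union> elem_minus d T"
  by (auto simp: Gam_def elem_plus_def elem_minus_def)

text \<open>The approach is from a side whose closure contains \<open>x\<close>: that of
  \<open>x\<close> itself if \<open>interp T d x\<close> is nonzero, otherwise that of a vertex with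
  nonzero \<open>d\<close>.\<close>

lemma at_within_off_Gam:
  assumes x: "x \<in> convex hull T"
  shows "at x within (open_simplex T - Gam d T) \<noteq> bot"
proof -
  have "\<exists>y\<in>convex hull T. interp T d y \<noteq> 0 \<and> 0 \<le> interp T d x * interp T d y"
  proof (cases "interp T d x = 0")
    case True
    obtain z where "z \<in> T" "d z \<noteq> 0" using resolved by blast
    then show ?thesis using True T_subset_hull by (intro bexI[of _ z]) (auto simp: interp_vertex)
  next
    case False
    then show ?thesis using x by (intro bexI[of _ x]) auto
  qed
  then obtain y where y: "y \<in> convex hull T" "interp T d y \<noteq> 0" "0 \<le> interp T d x * interp T d y" by blast
  consider "0 < interp T d y" "0 \<le> interp T d x" | "interp T d y < 0" "interp T d x \<le> 0"
    using y by (cases "0 < interp T d y") (auto simp: zero_le_mult_iff)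
  then have "at x within elem_plus d T \<noteq> bot \<or> at x within elem_minus d T \<noteq> bot"
  proof cases
    case 1
    then show ?thesis using at_within_elem_plus[OF x] elem_plus_nonempty[OF y(1)] by auto
  next
    case 2
    then show ?thesis using at_within_elem_minus[OF x] elem_plus_nonempty[OF y(1), of "\<lambda>x. - d x"]
      by (auto simp: elem_minus_eq interp_minus)
  qed
  then show ?thesis
    unfolding simplex_minus_Gam at_within_union by (auto simp: sup_eq_bot_iff)
qed

text \<open>Nothing is asked for on \<open>Gam d T\<close>, where functions of the space have
  unspecified values.\<close>

definition pieces :: "(real^'n \<Rightarrow> 'b) \<Rightarrow> (real^'n \<Rightarrow> 'b) \<Rightarrow> (real^'n \<Rightarrow> 'b) \<Rightarrow> bool" where
  "pieces f fp fm \<longleftrightarrow> (\<forall>x\<in>elem_plus d T. f x = fp x) \<and> (\<forall>x\<in>elem_minus d T. f x = fm x)"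

text \<open>The function glued from \<open>fp\<close> and \<open>fm\<close> is continuous at
  \<open>x\<close>: near \<open>x\<close> it is only one of them if \<open>interp T d x\<close> is
  nonzero, and otherwise both have the same value at \<open>x\<close>.\<close>

lemma inner_trace_pieces:
  fixes f :: "real^'n \<Rightarrow> 'b::t2_space"
  assumes f: "pieces f fp fm" and cont: "isCont fp x" "isCont fm x"
    and x: "x \<in> convex hull T" and eq: "interp T d x = 0 \<Longrightarrow> fp x = fm x"
  shows "inner_trace d T f x = (if 0 < interp T d x then fp x else fm x)"
proof -
  let ?F = "\<lambda>y. if 0 < interp T d y then fp y else fm y"
  have l: "isCont (interp T d) x" by (intro isCont_P1 P1_interp)
  have "isCont ?F x"
    unfolding continuous_at
  proof (rule topological_tendstoI)
    fix S assume S: "open S" "?F x \<in> S"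
    have ev: "fp x \<in> S \<Longrightarrow> \<forall>\<^sub>F y in at x. fp y \<in> S" "fm x \<in> S \<Longrightarrow> \<forall>\<^sub>F y in at x. fm y \<in> S"
      using cont S(1) unfolding continuous_at by (auto dest: topological_tendstoD)
    consider "interp T d x = 0" | "0 < interp T d x" | "interp T d x < 0" by linarith
    then show "\<forall>\<^sub>F y in at x. ?F y \<in> S"
    proof cases
      case 1
      then have "fp x \<in> S" "fm x \<in> S" using S eq by auto
      then show ?thesis using ev by (auto elim: eventually_elim2)
    next
      case 2
      then have "\<forall>\<^sub>F y in at x. 0 < interp T d y"
        using l unfolding continuous_at by (rule order_tendstoD(1)[rotated])
      moreover have "\<forall>\<^sub>F y in at x. fp y \<in> S" using 2 S ev by auto
      ultimately show ?thesis by eventually_elim auto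
    next
      case 3
      then have "\<forall>\<^sub>F y in at x. interp T d y < 0"
        using l unfolding continuous_at by (rule order_tendstoD(2)[rotated])
      moreover have "\<forall>\<^sub>F y in at x. fm y \<in> S" using 3 S ev by auto
      ultimately show ?thesis by eventually_elim auto
    qed
  qed
  then show ?thesis
    unfolding inner_trace_def
  proof (rule trace_from_eq[rotated])
    show "at x within (open_simplex T - Gam d T) \<noteq> bot" by (rule at_within_off_Gam[OF x])
    show "f y = ?F y" if "y \<in> open_simplex T - Gam d T" for y
      using that f unfolding simplex_minus_Gam pieces_def by (auto simp: elem_plus_def elem_minus_def)
  qed
qed

text \<open>At a vertex with \<open>d z = 0\<close> the minus side decides. If there is none, the
  value is the inner trace, and then the two pieces have to agree at \<open>z\<close>; the last
  hypothesis expresses this.\<close>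

lemma nodal_value_pieces:
  fixes f :: "real^'n \<Rightarrow> 'b::t2_space"
  assumes f: "pieces f fp fm" and cont: "isCont fp z" "isCont fm z"
    and z: "z \<in> T" and eq: "elem_minus d T \<noteq> {} \<or> fp z = fm z"
  shows "nodal_value d T f z = (if 0 < d z then fp z else fm z)"
proof (cases "d z = 0 \<and> elem_minus d T \<noteq> {}")
  case True
  then have "trace_from (elem_minus d T) f z = fm z"
    using f z T_subset_hull[OF z] cont
    by (intro trace_from_eq at_within_elem_minus) (auto simp: pieces_def interp_vertex)
  then show ?thesis using True by (simp add: nodal_value_def)
next
  case False
  then have "inner_trace d T f z = (if 0 < interp T d z then fp z else fm z)"
    using eq z by (intro inner_trace_pieces[OF f cont T_subset_hull[OF z]]) (auto simp: interp_vertex)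
  then show ?thesis using False z by (auto simp: nodal_value_def interp_vertex)
qed

end

section \<open>Normal and jumps at the discrete interface\<close>

locale cut_simplex = resolved_simplex T \<rho> d for T :: "(real^'n) set" and \<rho> d +
  fixes xs :: "real^'n"
  assumes xs: "xs \<in> Gam d T"
begin

abbreviation nu :: "real^'n" where "nu \<equiv> normal_h d T"

lemma xs_hull: "xs \<in> convex hull T" and interp_xs: "interp T d xs = 0" and xs_open: "xs \<in> open_simplex T"
  using xs open_simplex_subset by (auto simp: Gam_def)

text \<open>\<open>normal_h\<close> is a definite description, so the normalised gradient
  \<open>n\<close> of \<open>interp T d\<close> has to be shown to be its only solution. The part of
  a solution orthogonal to \<open>n\<close> is tangential to \<open>Gam d T\<close> at
  \<open>xs\<close>, so it is orthogonal to the solution and thereby to itself. This leaves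
  \<open>n\<close> and \<open>- n\<close>, and the last condition fixes the sign.\<close>

lemma
  shows norm_nu: "norm nu = 1"
    and interp_nu: "\<exists>c>0. \<forall>x. interp T d x = c * (nu \<bullet> (x - xs))"
proof -
  obtain g where g: "\<forall>x y. interp T d x - interp T d y = g \<bullet> (x - y)"
    using P1_real_gradient[OF P1_interp] by blast
  have g': "interp T d x = g \<bullet> (x - xs)" for x
    using g[THEN spec, THEN spec, of x xs] interp_xs by simp
  have g0: "g \<noteq> 0"
  proof
    assume "g = 0"
    then have "interp T d z = 0" for z using g' by simp
    then show False using resolved interp_vertex by metis
  qed
  define n where "n = (1 / norm g) *\<^sub>R g"
  have gn: "g = norm g *\<^sub>R n" using g0 by (simp add: n_def)
  have n1: "norm n = 1" using g0 by (simp add: n_def)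
  have l: "interp T d x = norm g * (n \<bullet> (x - xs))" for x
    using g'[of x] gn by (metis inner_scaleR_left)
  have nbh: "\<exists>e>0. \<forall>t. \<bar>t\<bar> < e \<longrightarrow> x + t *\<^sub>R u \<in> open_simplex T" if x: "x \<in> open_simplex T" for x u
  proof -
    obtain e where e: "0 < e" "ball x e \<subseteq> open_simplex T"
      using openE[OF open_open_simplex x] by metis
    have "x + t *\<^sub>R u \<in> open_simplex T" if "\<bar>t\<bar> < e / (norm u + 1)" for t
    proof -
      have "\<bar>t\<bar> * norm u \<le> \<bar>t\<bar> * (norm u + 1)" by (intro mult_left_mono) auto
      also have "\<dots> < e" using that by (simp add: pos_less_divide_eq add_nonneg_pos)
      finally show ?thesis using e by (intro subsetD[OF e(2)]) (simp add: dist_norm)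
    qed
    then show ?thesis using e(1) by (intro exI[of _ "e / (norm u + 1)"]) (auto simp: add_nonneg_pos)
  qed
  let ?P = "\<lambda>n. norm n = 1 \<and> (\<forall>x\<in>Gam d T. \<forall>y\<in>Gam d T. n \<bullet> (y - x) = 0) \<and>
     (\<forall>x\<in>Gam d T. \<exists>e>0. \<forall>t. 0 < t \<and> t < e \<longrightarrow>
        x + t *\<^sub>R n \<in> elem_plus d T \<and> x - t *\<^sub>R n \<in> elem_minus d T)"
  have "nu = n"
    unfolding normal_h_def
  proof (rule the_equality)
    have "n \<bullet> (y - x) = 0" if "x \<in> Gam d T" "y \<in> Gam d T" for x y
    proof -
      have "n \<bullet> (x - xs) = 0" "n \<bullet> (y - xs) = 0" using that l[of x] l[of y] g0 by (auto simp: Gam_def)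
      then show ?thesis by (simp add: inner_diff_right)
    qed
    moreover have "\<exists>e>0. \<forall>t. 0 < t \<and> t < e \<longrightarrow>
        x + t *\<^sub>R n \<in> elem_plus d T \<and> x - t *\<^sub>R n \<in> elem_minus d T" if x: "x \<in> Gam d T" for x
    proof -
      obtain e where e: "0 < e" "\<forall>t. \<bar>t\<bar> < e \<longrightarrow> x + t *\<^sub>R n \<in> open_simplex T"
        using nbh[of x n] x by (auto simp: Gam_def)
      have lt: "interp T d (x + t *\<^sub>R n) = norm g * t" for t
      proof -
        have "n \<bullet> (x - xs) = 0" using x l[of x] g0 by (auto simp: Gam_def)
        moreover have "n \<bullet> n = 1" using n1 by (simp add: dot_square_norm)
        moreover have "x + t *\<^sub>R n - xs = (x - xs) + t *\<^sub>R n" by simp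
        ultimately show ?thesis unfolding l
            by (simp only: inner_add_right inner_scaleR_right add_0_left mult_1_right)
      qed
      have "x + t *\<^sub>R n \<in> elem_plus d T \<and> x - t *\<^sub>R n \<in> elem_minus d T" if "0 < t" "t < e" for t
        using e(2)[THEN spec, of t] e(2)[THEN spec, of "- t"] lt[of t] lt[of "- t"] that g0
        by (auto simp: elem_plus_def elem_minus_def)
      then show ?thesis using e(1) by blast
    qed
    ultimately show "?P n" using n1 by blast
    fix m assume m: "?P m"
    define u where "u = m - (m \<bullet> n) *\<^sub>R n"
    have nn: "n \<bullet> n = 1" using n1 by (simp add: dot_square_norm)
    have nu0: "n \<bullet> u = 0" using nn by (simp add: u_def inner_diff_right inner_commute)
    obtain e where e: "0 < e" "\<forall>t. \<bar>t\<bar> < e \<longrightarrow> xs + t *\<^sub>R u \<in> open_simplex T"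
      using nbh[OF xs_open] by blast
    have "xs + (e / 2) *\<^sub>R u \<in> Gam d T" using e nu0 l[of "xs + (e / 2) *\<^sub>R u"] by (simp add: Gam_def)
    then have "m \<bullet> (xs + (e / 2) *\<^sub>R u - xs) = 0" using m xs by blast
    then have "m \<bullet> u = 0" using e(1) by simp
    then have "u \<bullet> u = 0" using nu0 by (simp add: u_def inner_diff_left)
    then have mn: "m = (m \<bullet> n) *\<^sub>R n" by (simp add: u_def)
    then have "norm m = \<bar>m \<bullet> n\<bar> * norm n" by (metis norm_scaleR)
    then have "\<bar>m \<bullet> n\<bar> = 1" using m n1 by simp
    moreover have "0 < m \<bullet> n"
    proof -
      obtain e where "0 < e" "\<forall>t. 0 < t \<and> t < e \<longrightarrow> xs + t *\<^sub>R m \<in> elem_plus d T" using m xs by blast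
      then have "xs + (e / 2) *\<^sub>R m \<in> elem_plus d T" by simp
      then have "0 < norm g * (e / 2 * (n \<bullet> m))"
          using l[of "xs + (e / 2) *\<^sub>R m"] by (simp add: elem_plus_def)
      then show ?thesis using g0 \<open>0 < e\<close> by (simp add: zero_less_mult_iff inner_commute)
    qed
    ultimately have "m \<bullet> n = 1" by linarith
    then show "m = n" using mn by simp
  qed
  then show "norm nu = 1" "\<exists>c>0. \<forall>x. interp T d x = c * (nu \<bullet> (x - xs))"
    using n1 l g0 by (auto intro!: exI[of _ "norm g"])
qed

text \<open>\<open>xs\<close> lies in the open simplex, so \<open>Gam d T\<close> contains a piece
  of the hyperplane around it. This turns conditions at the points of \<open>Gam d T\<close> into
  equations for all tangential directions.\<close>

lemma Gam_neighbourhood: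
  assumes "nu \<bullet> u = 0" obtains e where "e \<noteq> 0" "xs + e *\<^sub>R u \<in> Gam d T"
proof -
  obtain r where r: "0 < r" "ball xs r \<subseteq> open_simplex T"
    using openE[OF open_open_simplex xs_open] by metis
  have u: "0 < norm u + 1" by (intro add_nonneg_pos) auto
  define e where "e = r / 2 / (norm u + 1)"
  have e: "0 < e" using r u by (simp add: e_def)
  have "e * norm u \<le> e * (norm u + 1)" using e by (intro mult_left_mono) auto
  also have "\<dots> = r / 2" unfolding e_def using u by (intro nonzero_eq_divide_eq[THEN iffD1]) auto
  also have "\<dots> < r" using r by simp
  finally have "xs + e *\<^sub>R u \<in> open_simplex T" using e by (intro subsetD[OF r(2)]) (simp add: dist_norm)
  moreover have "interp T d (xs + e *\<^sub>R u) = 0" using interp_nu assms by auto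
  ultimately show ?thesis using that[of e] e by (simp add: Gam_def)
qed

lemma sides_nonempty: "elem_plus d T \<noteq> {}" "elem_minus d T \<noteq> {}"
proof -
  obtain c where c: "0 < c" "\<forall>x. interp T d x = c * (nu \<bullet> (x - xs))" using interp_nu by blast
  obtain r where r: "0 < r" "ball xs r \<subseteq> open_simplex T"
    using openE[OF open_open_simplex xs_open] by metis
  have "xs + (r / 2) *\<^sub>R nu \<in> ball xs r" "xs - (r / 2) *\<^sub>R nu \<in> ball xs r"
    using r norm_nu by (auto simp: dist_norm)
  then have "xs + (r / 2) *\<^sub>R nu \<in> open_simplex T" "xs - (r / 2) *\<^sub>R nu \<in> open_simplex T"
    using r by blast+
  moreover have "0 < interp T d (xs + (r / 2) *\<^sub>R nu)" "interp T d (xs - (r / 2) *\<^sub>R nu) < 0"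
    using c r norm_nu by (auto simp: dot_square_norm mult_less_0_iff)
  ultimately show "elem_plus d T \<noteq> {}" "elem_minus d T \<noteq> {}"
    by (auto simp: elem_plus_def elem_minus_def)
qed

lemma jump_h_pieces:
  fixes f :: "real^'n \<Rightarrow> 'b::real_normed_vector"
  assumes f: "pieces f fp fm" and cont: "isCont fp x" "isCont fm x" and x: "x \<in> Gam d T"
  shows "jump_h d T f x = fp x - fm x"
proof -
  have xh: "x \<in> convex hull T" "interp T d x = 0" using x open_simplex_subset by (auto simp: Gam_def)
  have "trace_from (elem_plus d T) f x = fp x"
    using f cont xh sides_nonempty
    by (intro trace_from_eq at_within_elem_plus) (auto simp: pieces_def)
  moreover have "trace_from (elem_minus d T) f x = fm x"
    using f cont xh sides_nonempty
    by (intro trace_from_eq at_within_elem_minus) (auto simp: pieces_def)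
  ultimately show ?thesis by (simp add: jump_h_def)
qed

end

section \<open>The local immersed space\<close>

text \<open>The sum dominates the bound from \<open>stress_jump_bound\<close> for the pressure jump
  and, with either viscosity as coefficient of \<open>c\<close>, the one for the velocity. It is 0
  for equal viscosities, when the stress condition forces both jumps to vanish.\<close>

definition jump_const :: "real \<Rightarrow> real \<Rightarrow> real" where
  "jump_const \<mu>p \<mu>m = 2 * \<bar>\<mu>p - \<mu>m\<bar> * (1 + 2 / \<mu>p + 2 / \<mu>m)"

text \<open>The inner product with \<open>n\<close> removes \<open>c\<close> and bounds
  \<open>\<kappa>\<close>; then the equation itself bounds \<open>c\<close>. It is applied with
  \<open>s = A n + A^T n\<close> and \<open>a = norm A\<close>.\<close>

lemma stress_jump_bound:
  fixes c s n :: "'a::real_inner"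
  assumes eq: "\<mu> *\<^sub>R c + \<delta> *\<^sub>R s = \<kappa> *\<^sub>R n" and "c \<bullet> n = 0" "norm n = 1" "norm s \<le> 2 * a" "0 < \<mu>"
  shows "\<bar>\<kappa>\<bar> \<le> 2 * \<bar>\<delta>\<bar> * a" "norm c \<le> 2 * \<bar>\<delta>\<bar> * a * (2 / \<mu>)"
proof -
  have nn: "n \<bullet> n = 1" using assms(3) by (simp add: dot_square_norm)
  have "(\<mu> *\<^sub>R c + \<delta> *\<^sub>R s) \<bullet> n = \<kappa>" unfolding eq using nn by simp
  then have "\<kappa> = \<delta> * (s \<bullet> n)" using assms(2) by (simp add: inner_add_left)
  moreover have "\<bar>s \<bullet> n\<bar> \<le> 2 * a" using Cauchy_Schwarz_ineq2[of s n] assms(3,4) by simp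
  ultimately show k: "\<bar>\<kappa>\<bar> \<le> 2 * \<bar>\<delta>\<bar> * a"
    using mult_left_mono[of "\<bar>s \<bullet> n\<bar>" "2 * a" "\<bar>\<delta>\<bar>"] by (simp add: abs_mult)
  have "\<mu> *\<^sub>R c = \<kappa> *\<^sub>R n - \<delta> *\<^sub>R s" using eq by (simp add: eq_diff_eq)
  then have "norm (\<mu> *\<^sub>R c) \<le> norm (\<kappa> *\<^sub>R n) + norm (\<delta> *\<^sub>R s)" by (metis norm_triangle_ineq4)
  also have "\<dots> \<le> 2 * \<bar>\<delta>\<bar> * a + \<bar>\<delta>\<bar> * (2 * a)"
    using k assms(3,4) by (intro add_mono) (auto intro: mult_left_mono)
  finally have "norm c * \<mu> \<le> 2 * \<bar>\<delta>\<bar> * a * 2" using \<open>0 < \<mu>\<close> by (simp add: mult_ac)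
  then show "norm c \<le> 2 * \<bar>\<delta>\<bar> * a * (2 / \<mu>)" using \<open>0 < \<mu>\<close> by (simp add: field_simps)
qed

context resolved_simplex
begin

lemma pieces_jac:
  assumes "pieces f fp fm" "\<And>x. (fp has_derivative (\<lambda>h. Jp x *v h)) (at x)"
    "\<And>x. (fm has_derivative (\<lambda>h. Jm x *v h)) (at x)"
  shows "pieces (jac f) Jp Jm"
  unfolding pieces_def
proof (intro conjI ballI)
  show "jac f x = Jp x" if "x \<in> elem_plus d T" for x
    by (rule jac_eq[OF open_elem_plus that _ assms(2)]) (use assms(1) in \<open>auto simp: pieces_def\<close>)
  show "jac f x = Jm x" if "x \<in> elem_minus d T" for x
    by (rule jac_eq[OF open_elem_minus that _ assms(3)]) (use assms(1) in \<open>auto simp: pieces_def\<close>)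
qed

lemma pieces_grad:
  assumes "pieces f fp fm" "\<And>x. (fp has_derivative (\<lambda>h. gp \<bullet> h)) (at x)"
    "\<And>x. (fm has_derivative (\<lambda>h. gm \<bullet> h)) (at x)"
  shows "pieces (grad f) (\<lambda>x. gp) (\<lambda>x. gm)"
  unfolding pieces_def
proof (intro conjI ballI)
  show "grad f x = gp" if "x \<in> elem_plus d T" for x
    by (rule grad_eq[OF open_elem_plus that _ assms(2)]) (use assms(1) in \<open>auto simp: pieces_def\<close>)
  show "grad f x = gm" if "x \<in> elem_minus d T" for x
    by (rule grad_eq[OF open_elem_minus that _ assms(3)]) (use assms(1) in \<open>auto simp: pieces_def\<close>)
qed

end

context cut_simplex
begin

lemma IFE_local_structure:
  fixes w :: "real^'n \<Rightarrow> real^'n"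
  assumes IFE: "(w, q) \<in> IFE_local d \<mu>p \<mu>m xs T" and \<mu>: "0 < \<mu>p" "0 < \<mu>m"
  obtains Ap Am ap am c g qp qm where
    "pieces w (\<lambda>x. Ap *v x + ap) (\<lambda>x. Am *v x + am)"
    "pieces q (\<lambda>x. g \<bullet> x + qp) (\<lambda>x. g \<bullet> x + qm)"
    "\<forall>x. (Ap *v x + ap) - (Am *v x + am) = (nu \<bullet> (x - xs)) *\<^sub>R c"
    "Ap - Am = outer c nu"
    "\<bar>qp - qm\<bar> \<le> jump_const \<mu>p \<mu>m * norm Ap" "\<bar>qp - qm\<bar> \<le> jump_const \<mu>p \<mu>m * norm Am"
    "norm c \<le> jump_const \<mu>p \<mu>m * norm Ap" "norm c \<le> jump_const \<mu>p \<mu>m * norm Am"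
proof -
  have P1w: "\<exists>A a. \<forall>x\<in>S. w x = A *v x + a" if "P1_on S w" for S
    using that P1_matrix[where ?'m='n] unfolding P1_on_def by metis
  have "P1_on (elem_plus d T) w" "P1_on (elem_minus d T) w" using IFE by (auto simp: IFE_local_def)
  from P1w[OF this(1)] P1w[OF this(2)] obtain Ap ap Am am where
    w: "\<forall>x\<in>elem_plus d T. w x = Ap *v x + ap" "\<forall>x\<in>elem_minus d T. w x = Am *v x + am"
    by blast
  have P1q: "\<exists>g a. \<forall>x\<in>S. q x = g \<bullet> x + a" if "P1_on S q" for S
    using that P1_inner unfolding P1_on_def by metis
  have "P1_on (elem_plus d T) q" "P1_on (elem_minus d T) q" using IFE by (auto simp: IFE_local_def)
  from P1q[OF this(1)] P1q[OF this(2)] obtain gp qp gm qm where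
    q: "\<forall>x\<in>elem_plus d T. q x = gp \<bullet> x + qp" "\<forall>x\<in>elem_minus d T. q x = gm \<bullet> x + qm"
    by blast
  have pw: "pieces w (\<lambda>x. Ap *v x + ap) (\<lambda>x. Am *v x + am)" using w by (simp add: pieces_def)
  have pq: "pieces q (\<lambda>x. gp \<bullet> x + qp) (\<lambda>x. gm \<bullet> x + qm)" using q by (simp add: pieces_def)
  have pj: "pieces (jac w) (\<lambda>x. Ap) (\<lambda>x. Am)"
    by (rule pieces_jac[OF pw has_derivative_affine has_derivative_affine])
  have pg: "pieces (grad q) (\<lambda>x. gp) (\<lambda>x. gm)"
    by (rule pieces_grad[OF pq has_derivative_affine_inner has_derivative_affine_inner])
  have contA: "isCont (\<lambda>x. A *v x + a) y" for A :: "real^'n^'n" and a y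
    using has_derivative_continuous[OF has_derivative_affine] .
  define M where "M = Ap - Am"
  define c where "c = M *v nu"
  have D: "M *v x + (ap - am) = 0" if "x \<in> Gam d T" for x
  proof -
    have "jump_h d T w x = 0" using IFE that by (auto simp: IFE_local_def)
    then have "(Ap *v x + ap) - (Am *v x + am) = 0"
      using jump_h_pieces[OF pw contA contA that] by simp
    then show ?thesis by (simp add: M_def matrix_vector_mult_diff_rdistrib algebra_simps)
  qed
  have nn: "nu \<bullet> nu = 1" using norm_nu by (simp add: dot_square_norm)
  \<comment> \<open>The jump of \<open>w\<close> is affine and vanishes at \<open>xs\<close> and, in
    every tangential direction, at another point of \<open>Gam d T\<close>. So its matrix
    annihilates tangential vectors.\<close>
  have Mu: "M *v u = (nu \<bullet> u) *\<^sub>R c" for u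
  proof -
    let ?u = "u - (nu \<bullet> u) *\<^sub>R nu"
    have "nu \<bullet> ?u = 0" using nn by (simp add: inner_diff_right)
    then obtain e where e: "e \<noteq> 0" "xs + e *\<^sub>R ?u \<in> Gam d T" by (rule Gam_neighbourhood)
    have "e *\<^sub>R (M *v ?u) = (M *v (xs + e *\<^sub>R ?u) + (ap - am)) - (M *v xs + (ap - am))"
      by (simp add: matrix_vector_right_distrib matrix_vector_mult_scaleR)
    also have "\<dots> = 0" using D[OF e(2)] D[OF xs] by simp
    finally have "M *v ?u = 0" using e(1) by simp
    then show ?thesis by (simp add: c_def matrix_vector_mult_diff_distrib matrix_vector_mult_scaleR)
  qed
  have jump: "(Ap *v x + ap) - (Am *v x + am) = (nu \<bullet> (x - xs)) *\<^sub>R c" for x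
  proof -
    have "(Ap *v x + ap) - (Am *v x + am) = (M *v x + (ap - am)) - (M *v xs + (ap - am))"
      unfolding D[OF xs] by (simp add: M_def matrix_vector_mult_diff_rdistrib)
    also have "\<dots> = M *v (x - xs)" by (simp add: matrix_vector_mult_diff_distrib)
    finally show ?thesis using Mu by simp
  qed
  have outer: "Ap - Am = outer c nu"
    unfolding matrix_eq using Mu by (simp add: M_def outer_mult_vec)
  have "pieces (divg w) (\<lambda>x. trace Ap) (\<lambda>x. trace Am)" using pj by (simp add: pieces_def divg_def)
  then have "jump_h d T (divg w) xs = trace Ap - trace Am"
    by (rule jump_h_pieces) (use xs in auto)
  moreover have "jump_h d T (divg w) xs = 0" using IFE xs by (auto simp: IFE_local_def)
  ultimately have "trace (Ap - Am) = 0" by (simp add: trace_sub)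
  \<comment> \<open>Continuity of the divergence: the trace of the rank-one jump is
    \<open>c \<bullet> nu\<close>.\<close>
  then have cn: "c \<bullet> nu = 0" by (simp add: outer trace_outer)
  have "jump_h d T (grad q) xs = gp - gm"
    by (rule jump_h_pieces[OF pg]) (use xs in auto)
  moreover have "jump_h d T (grad q) xs = 0" using IFE xs by (auto simp: IFE_local_def)
  ultimately have g: "gm = gp" by simp
  let ?S = "\<lambda>A. A *v nu + transpose A *v nu"
  have st: "stress \<mu> w q x *v nu = \<mu> x *\<^sub>R ?S (jac w x) - q x *\<^sub>R nu" for \<mu> x
    by (simp add: stress_def matrix_vector_mult_diff_rdistrib mat_mult_vec scaleR_matrix_vector_assoc[symmetric]
        matrix_vector_mult_add_rdistrib)
  have "pieces (\<lambda>x. stress (mu_h d \<mu>p \<mu>m T) w q x *v nu)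
      (\<lambda>x. \<mu>p *\<^sub>R ?S Ap - (gp \<bullet> x + qp) *\<^sub>R nu) (\<lambda>x. \<mu>m *\<^sub>R ?S Am - (gm \<bullet> x + qm) *\<^sub>R nu)"
    unfolding pieces_def st using pj pq
    by (auto simp: pieces_def mu_h_def elem_plus_def elem_minus_def)
  then have "jump_h d T (\<lambda>x. stress (mu_h d \<mu>p \<mu>m T) w q x *v nu) xs =
      (\<mu>p *\<^sub>R ?S Ap - (gp \<bullet> xs + qp) *\<^sub>R nu) - (\<mu>m *\<^sub>R ?S Am - (gm \<bullet> xs + qm) *\<^sub>R nu)"
    by (rule jump_h_pieces) (use xs in \<open>auto intro!: continuous_intros\<close>)
  moreover have "jump_h d T (\<lambda>x. stress (mu_h d \<mu>p \<mu>m T) w q x *v nu) xs = 0"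
    using IFE by (auto simp: IFE_local_def)
  ultimately have eq: "\<mu>p *\<^sub>R ?S Ap - \<mu>m *\<^sub>R ?S Am = (qp - qm) *\<^sub>R nu"
    unfolding g by (simp add: algebra_simps)
  \<comment> \<open>\<open>(c nu^T + nu c^T) nu = c\<close>, as \<open>nu\<close> is a unit vector
    orthogonal to \<open>c\<close>.\<close>
  have "?S (Ap - Am) = c"
    unfolding outer transpose_outer outer_mult_vec using nn cn by simp
  moreover have "transpose (Ap - Am) = transpose Ap - transpose Am"
      by (simp add: transpose_def vec_eq_iff)
  ultimately have S: "?S Ap = ?S Am + c"
    by (simp add: matrix_vector_mult_diff_rdistrib algebra_simps)
  have Sle: "norm (?S A) \<le> 2 * norm A" for A
    using norm_triangle_ineq[of "A *v nu" "transpose A *v nu"] norm_matrix_vector_mult_le[of A nu]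
      norm_transpose_mult_le[of A nu] norm_nu by simp
  \<comment> \<open>Eliminating the gradient of one side or the other yields a bound in terms of
    each. Both are kept because the controlled side depends on the element.\<close>
  have e1: "\<mu>p *\<^sub>R c + (\<mu>p - \<mu>m) *\<^sub>R ?S Am = (qp - qm) *\<^sub>R nu"
    using eq unfolding S by (simp add: algebra_simps)
  have e2: "\<mu>m *\<^sub>R c + (\<mu>p - \<mu>m) *\<^sub>R ?S Ap = (qp - qm) *\<^sub>R nu"
    using eq unfolding S by (simp add: algebra_simps)
  note b1 = stress_jump_bound[OF e1 cn norm_nu Sle \<mu>(1)]
      and b2 = stress_jump_bound[OF e2 cn norm_nu Sle \<mu>(2)]
  let ?d = "2 * \<bar>\<mu>p - \<mu>m\<bar>"
  have J: "?d * a \<le> jump_const \<mu>p \<mu>m * a" "?d * a * (2 / \<mu>p) \<le> jump_const \<mu>p \<mu>m * a"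
    "?d * a * (2 / \<mu>m) \<le> jump_const \<mu>p \<mu>m * a" if "0 \<le> a" for a
  proof -
    have J: "jump_const \<mu>p \<mu>m * a = ?d * a + ?d * a * (2 / \<mu>p) + ?d * a * (2 / \<mu>m)"
      by (simp add: jump_const_def algebra_simps)
    have "0 \<le> ?d * a" "0 \<le> ?d * a * (2 / \<mu>p)" "0 \<le> ?d * a * (2 / \<mu>m)" using that \<mu> by auto
    then show "?d * a \<le> jump_const \<mu>p \<mu>m * a" "?d * a * (2 / \<mu>p) \<le> jump_const \<mu>p \<mu>m * a"
      "?d * a * (2 / \<mu>m) \<le> jump_const \<mu>p \<mu>m * a" unfolding J by linarith+
  qed
  show ?thesis
  proof (rule that)
    show "pieces q (\<lambda>x. gp \<bullet> x + qp) (\<lambda>x. gp \<bullet> x + qm)" using pq g by simp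
    show "\<forall>x. (Ap *v x + ap) - (Am *v x + am) = (nu \<bullet> (x - xs)) *\<^sub>R c" using jump by blast
    show "\<bar>qp - qm\<bar> \<le> jump_const \<mu>p \<mu>m * norm Ap" using b2(1) J(1)[of "norm Ap"] by simp
    show "\<bar>qp - qm\<bar> \<le> jump_const \<mu>p \<mu>m * norm Am" using b1(1) J(1)[of "norm Am"] by simp
    show "norm c \<le> jump_const \<mu>p \<mu>m * norm Ap" using b2(2) J(3)[of "norm Ap"] by simp
    show "norm c \<le> jump_const \<mu>p \<mu>m * norm Am" using b1(2) J(2)[of "norm Am"] by simp
  qed (fact pw outer)+
qed

end

section \<open>Surface measure of facets and of the discrete interface\<close>

context regular_simplex
begin

lemma frontier_open_simplex:
  "frontier (open_simplex T) = (\<Union>z\<in>T. {x\<in>convex hull T. bary T z x = 0})"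
  unfolding frontier_def closure_open_simplex interior_open[OF open_open_simplex]
  by (fastforce simp: open_simplex_iff convex_hull_iff)

lemma bgrad_nonzero: "z \<in> T \<Longrightarrow> bgrad z \<noteq> 0"
proof
  assume z: "z \<in> T" "bgrad z = 0"
  obtain w where "w \<in> T" "w \<noteq> z" using ex_other_vertex[OF z(1)] .
  then show False using bary_diff[OF z(1), of z w] z by (simp add: bary_vertex)
qed

lemma bary_zero_iff: "z \<in> T \<Longrightarrow> bary T z x = 0 \<longleftrightarrow> bgrad z \<bullet> x = - bary T z 0"
  using bary_diff[of z x 0] by auto

lemma facet_measure:
  assumes N: "CARD('n) \<ge> 2" and z: "z \<in> T" and A: "A \<subseteq> {x. bary T z x = 0}"
    and R: "\<And>x y. x \<in> A \<Longrightarrow> y \<in> A \<Longrightarrow> norm (x - y) \<le> R" "0 \<le> R"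
  shows "hausdorff_outer (CARD('n) - 1) A \<le> ennreal (surf_const CARD('n) * R ^ (CARD('n) - 1))"
  by (rule hausdorff_outer_hyperplane_le[OF N bgrad_nonzero[OF z] _ R])
    (use A bary_zero_iff[OF z] in blast)+

lemma frontier_measure:
  assumes N: "CARD('n) \<ge> 2"
  shows "hausdorff_outer (CARD('n) - 1) (frontier (open_simplex T)) \<le>
    ennreal (real (Suc CARD('n)) * (surf_const CARD('n) * hdiam T ^ (CARD('n) - 1)))"
proof -
  let ?K = "surf_const CARD('n) * hdiam T ^ (CARD('n) - 1)"
  have K: "0 \<le> ?K" using surf_const_nonneg hdiam_pos by (intro mult_nonneg_nonneg) auto
  have "hausdorff_outer (CARD('n) - 1) (frontier (open_simplex T)) \<le>
      (\<Sum>z\<in>T. hausdorff_outer (CARD('n) - 1) {x\<in>convex hull T. bary T z x = 0})"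
    unfolding frontier_open_simplex using N fin by (intro hausdorff_outer_UN_le) auto
  also have "\<dots> \<le> (\<Sum>z\<in>T. ennreal ?K)"
    using N hdiam_pos by (intro sum_mono facet_measure) (auto intro: dist_hull_le)
  also have "\<dots> = ennreal (real (Suc CARD('n)) * ?K)"
    using K card_T by (simp add: ennreal_mult ennreal_of_nat_eq_real_of_nat)
  finally show ?thesis .
qed

lemma open_simplex_face:
  assumes z: "z \<in> T" and x: "x \<in> open_simplex (T - {z})"
  obtains u where "\<And>w. w \<in> T - {z} \<Longrightarrow> 0 < u w" "sum u (T - {z}) = 1" "(\<Sum>w\<in>T - {z}. u w *\<^sub>R w) = x"
    "bary T z x = 0" "x \<in> convex hull T"
proof -
  have "\<not> affine_dependent (T - {z})"
    using affine_independent affine_dependent_subset by (metis Diff_subset)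
  from rel_interior_convex_hull_explicit[OF this] x
  obtain u where u: "\<forall>w\<in>T - {z}. 0 < u w" "sum u (T - {z}) = 1" "(\<Sum>w\<in>T - {z}. u w *\<^sub>R w) = x"
    unfolding open_simplex_def by blast
  have "bary T z x = (\<Sum>w\<in>T - {z}. u w *\<^sub>R bary T z w)"
    using P1_affine_sum[OF P1_bary[OF z] u(2)] u(3) by simp
  also have "\<dots> = 0" by (rule sum.neutral) (use z in \<open>auto simp: bary_vertex\<close>)
  finally have b: "bary T z x = 0" .
  have "x \<in> convex hull (T - {z})"
    using x rel_interior_subset unfolding open_simplex_def by blast
  then have "x \<in> convex hull T" using hull_mono[of "T - {z}" T] by blast
  with u b that show ?thesis by blast
qed

lemma hdiam_face_le:
  assumes "z \<in> T" shows "hdiam (T - {z}) \<le> hdiam T"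
proof -
  have "open_simplex (T - {z}) \<subseteq> convex hull T"
    using open_simplex_face[OF assms] by blast
  then have "hdiam (T - {z}) \<le> diameter (convex hull T)"
    unfolding hdiam_def using bounded_hull by (intro diameter_subset)
  also have "\<dots> = hdiam T"
    unfolding hdiam_def closure_open_simplex[symmetric]
    using bounded_subset[OF bounded_hull open_simplex_subset] by (rule diameter_closure)
  finally show ?thesis .
qed

text \<open>The diameter of the face is used instead of that of T because the face estimate is
  weighted with powers of h_F.\<close>

lemma face_measure:
  assumes N: "CARD('n) \<ge> 2" and z: "z \<in> T"
  shows "hausdorff_outer (CARD('n) - 1) (open_simplex (T - {z})) \<le>
    ennreal (surf_const CARD('n) * hdiam (T - {z}) ^ (CARD('n) - 1))"
proof (rule facet_measure[OF N z])
  have bdd: "bounded (open_simplex (T - {z}))"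
    using open_simplex_face[OF z] by (intro bounded_subset[OF bounded_hull]) blast
  show "norm (x - y) \<le> hdiam (T - {z})" if "x \<in> open_simplex (T - {z})"
      "y \<in> open_simplex (T - {z})" for x y
    using diameter_bounded_bound[OF bdd that] by (simp add: hdiam_def dist_norm)
  show "0 \<le> hdiam (T - {z})" unfolding hdiam_def using bdd by (rule diameter_ge_0)
  show "open_simplex (T - {z}) \<subseteq> {x. bary T z x = 0}" using open_simplex_face[OF z] by blast
qed

end

context cut_simplex
begin

text \<open>If the two hyperplanes were parallel, \<open>interp T d\<close> would vanish on the
  whole facet, and its value at \<open>xs\<close> would be a positive multiple of
  \<open>d z\<close>. As this value is 0, \<open>d\<close> would vanish at all vertices.\<close>

lemma facet_Gam_null:
  assumes N: "CARD('n) \<ge> 2" and z: "z \<in> T"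
  shows "hausdorff_outer (CARD('n) - 1) {x\<in>convex hull T. bary T z x = 0 \<and> interp T d x = 0} = 0"
    (is "hausdorff_outer _ ?A = 0")
proof (cases "?A = {}")
  case True
  then show ?thesis unfolding True using N by (intro hausdorff_outer_empty) simp
next
  case False
  then obtain p where p: "bary T z p = 0" "interp T d p = 0" by blast
  obtain g where g: "\<forall>x y. interp T d x - interp T d y = g \<bullet> (x - y)"
    using P1_real_gradient[OF P1_interp] by blast
  have "\<exists>u. bgrad z \<bullet> u = 0 \<and> g \<bullet> u \<noteq> 0"
  proof (rule ccontr)
    assume "\<not> ?thesis"
    then have *: "g \<bullet> u = 0" if "bgrad z \<bullet> u = 0" for u using that by blast
    have dw: "d w = 0" if w: "w \<in> T" "w \<noteq> z" for w
    proof -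
      have "bgrad z \<bullet> (w - p) = 0" using bary_diff[OF z, of w p] p w z by (simp add: bary_vertex)
      then have "interp T d w = 0" using * g p by (metis diff_zero)
      then show ?thesis using w by (simp add: interp_vertex)
    qed
    have "interp T d xs = (\<Sum>w\<in>T. if w = z then bary T z xs * d z else 0)"
      unfolding interp_def by (rule sum.cong) (use dw in auto)
    also have "\<dots> = bary T z xs * d z" using fin z by simp
    finally have "bary T z xs * d z = 0" using interp_xs by simp
    moreover have "0 < bary T z xs" using xs_open z by (simp add: open_simplex_iff)
    ultimately have "d z = 0" by simp
    then show False using dw resolved by metis
  qed
  then obtain u where u: "bgrad z \<bullet> u = 0" "g \<bullet> u \<noteq> 0" by blast
  have "g \<bullet> x = - interp T d 0" if "interp T d x = 0" for x
    using g[THEN spec, THEN spec, of x 0] that by simp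
  then show ?thesis
    by (intro hausdorff_outer_codim2[OF N bgrad_nonzero[OF z], of _ "- bary T z 0" g "- interp T d 0" u])
      (use u bounded_hull bary_zero_iff[OF z] in \<open>auto intro: bounded_subset\<close>)
qed

lemma frontier_Gam_null:
  assumes N: "CARD('n) \<ge> 2"
  shows "hausdorff_outer (CARD('n) - 1) {x\<in>frontier (open_simplex T). interp T d x = 0} = 0"
proof -
  have "{x\<in>frontier (open_simplex T). interp T d x = 0} =
      (\<Union>z\<in>T. {x\<in>convex hull T. bary T z x = 0 \<and> interp T d x = 0})"
    by (auto simp: frontier_open_simplex)
  then have "hausdorff_outer (CARD('n) - 1) {x\<in>frontier (open_simplex T). interp T d x = 0} \<le>
      (\<Sum>z\<in>T. hausdorff_outer (CARD('n) - 1) {x\<in>convex hull T. bary T z x = 0 \<and> interp T d x = 0})"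
    using N by (simp only:) (intro hausdorff_outer_UN_le[OF _ fin], simp)
  also have "\<dots> = 0" by (rule sum.neutral) (use facet_Gam_null[OF N] in auto)
  finally show ?thesis by simp
qed

lemma nu_nonzero: "nu \<noteq> 0"
  using norm_nu by auto

lemma interp_zero_iff: "interp T d x = 0 \<longleftrightarrow> nu \<bullet> x = nu \<bullet> xs"
  using interp_nu by (auto simp: inner_diff_right)

lemma Gam_measure:
  assumes N: "CARD('n) \<ge> 2"
  shows "hausdorff_outer (CARD('n) - 1) (Gam d T) \<le>
    ennreal (surf_const CARD('n) * hdiam T ^ (CARD('n) - 1))"
  by (rule hausdorff_outer_hyperplane_le[OF N nu_nonzero, of _ "nu \<bullet> xs"])
    (use open_simplex_subset hdiam_pos in \<open>auto simp: Gam_def interp_zero_iff intro!: dist_hull_le\<close>)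

lemma negligible_Gam: "negligible (Gam d T)"
  by (rule negligible_subset[OF negligible_hyperplane[of nu "nu \<bullet> xs"]])
    (use nu_nonzero in \<open>auto simp: Gam_def interp_zero_iff\<close>)

end

section \<open>Control by the gradient and by the value norm\<close>

lemma sum_outer_mult_vec: "(\<Sum>i\<in>I. outer (f i) (g i)) *v u = (\<Sum>i\<in>I. (g i \<bullet> u) *\<^sub>R f i)"
  by (induction I rule: infinite_finite_induct) (auto simp: matrix_vector_mult_add_rdistrib outer_mult_vec)

text \<open>Passes from the operator norm to the Frobenius norm: the matrix is the sum of N rank-one
  matrices, one for each column, of norm at most \<open>B\<close>.\<close>

lemma norm_matrix_le_columns:
  fixes A :: "real^'n^'m"
  assumes "\<And>u. norm (A *v u) \<le> B * norm u"
  shows "norm A \<le> real CARD('n) * B"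
proof -
  have "(\<Sum>j\<in>UNIV. outer (A *v axis j 1) (axis j 1)) *v u = A *v u" for u
  proof -
    have "(\<Sum>j\<in>UNIV. outer (A *v axis j 1) (axis j 1)) *v u = (\<Sum>j\<in>UNIV. A *v (u $ j *s axis j 1))"
      unfolding sum_outer_mult_vec
      by (simp add: inner_axis inner_commute matrix_vector_mult_scaleR scalar_mult_eq_scaleR)
    also have "\<dots> = A *v (\<Sum>j\<in>UNIV. u $ j *s axis j 1)"
      by (simp add: matrix_vector_mul_linear linear_sum)
    finally show ?thesis by (simp add: basis_expansion)
  qed
  then have A: "A = (\<Sum>j\<in>UNIV. outer (A *v axis j 1) (axis j 1))"
    by (intro iffD2[OF matrix_eq] allI) simp
  have "norm (\<Sum>j\<in>UNIV. outer (A *v axis j 1) (axis j 1)) \<le> (\<Sum>j\<in>(UNIV::'n set). B)"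
    using assms[of "axis _ 1"] by (intro sum_norm_le) (simp add: norm_outer)
  then show ?thesis using A by simp
qed

lemma powr_neg_half: "0 < h \<Longrightarrow> h powr (-1/2) = 1 / sqrt h"
  using powr_minus_divide[of h "1/2"] by (simp add: powr_half_sqrt)

text \<open>If \<open>M / 2\<close> is a lower bound on a ball of radius
  \<open>h / (2 * \<rho> * D)\<close>, the L2 norm is at least
  \<open>M * sqrt (h ^ N) / L2_const N \<rho> D\<close>.\<close>

definition L2_const :: "nat \<Rightarrow> real \<Rightarrow> real \<Rightarrow> real" where
  "L2_const N \<rho> D = 2 / sqrt (unit_ball_vol (real N) * (1 / (2 * \<rho> * D)) ^ N)"

text \<open>Three losses are multiplied: the maximum in terms of the L2 norm, the coefficients in
  terms of the maximum, and \<open>1 + J\<close> for the other side. In \<open>value_bound\<close>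
  the factor \<open>1 + N * \<rho>\<close> also turns a slope into a Frobenius norm.\<close>

definition grad_bound :: "nat \<Rightarrow> real \<Rightarrow> real \<Rightarrow> real" where
  "grad_bound N \<rho> J = (1 + J) * (grad_const N \<rho> * L2_const N \<rho> (grad_const N \<rho>))"

definition value_bound :: "nat \<Rightarrow> real \<Rightarrow> real \<Rightarrow> real" where
  "value_bound N \<rho> J =
     (1 + J) * (1 + real N * \<rho>) * (value_const N * L2_const N \<rho> (value_const N))"

definition pressure_bound :: "nat \<Rightarrow> real \<Rightarrow> real" where
  "pressure_bound N \<rho> = (1 + \<rho>) * (value_const N * L2_const N \<rho> (value_const N))"

context resolved_simplex
begin

text \<open>The alternatives correspond to the sign of \<open>interp T d\<close> at the centroid. In
  each of them a region of fixed barycentric shape lies on one side, wherever the interface cuts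
  T.\<close>

lemma big_side:
  obtains z where "z \<in> T" "vertex_region z \<subseteq> elem_plus d T"
  | z where "z \<in> T" "vertex_region z \<subseteq> elem_minus d T"
proof (cases "0 \<le> (\<Sum>z\<in>T. d z)")
  case True
  have "\<exists>z\<in>T. interp T d z \<noteq> 0" "0 \<le> (\<Sum>z\<in>T. interp T d z)"
    using resolved True by (auto simp: interp_vertex)
  then obtain z where "z \<in> T" "\<And>x. x \<in> vertex_region z \<Longrightarrow> 0 < interp T d x"
    using half_simplex[OF P1_interp] by metis
  then show ?thesis using that(1)[of z] by (auto simp: vertex_region_def elem_plus_def)
next
  case False
  have "\<exists>z\<in>T. - interp T d z \<noteq> 0" "0 \<le> (\<Sum>z\<in>T. - interp T d z)"
    using resolved False by (auto simp: interp_vertex sum_negf)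
  then obtain z where "z \<in> T" "\<And>x. x \<in> vertex_region z \<Longrightarrow> 0 < - interp T d x"
    using half_simplex[OF P1_minus[OF P1_interp]] by metis
  then show ?thesis using that(2)[of z] by (auto simp: vertex_region_def elem_minus_def)
qed

lemma has_derivative_interp: "(interp T g has_derivative (\<lambda>h. (\<Sum>z\<in>T. outer (g z) (bgrad z)) *v h)) (at x)"
  for g :: "real^'n \<Rightarrow> real^'m"
proof -
  have "((\<lambda>x. \<Sum>z\<in>T. bary T z x *\<^sub>R g z) has_derivative (\<lambda>h. \<Sum>z\<in>T. (bgrad z \<bullet> h) *\<^sub>R g z)) (at x)"
    by (intro has_derivative_sum has_derivative_scaleR_left has_derivative_bary)
  moreover have "(\<lambda>x. \<Sum>z\<in>T. bary T z x *\<^sub>R g z) = interp T g" by (auto simp: interp_def)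
  ultimately show ?thesis by (simp add: sum_outer_mult_vec)
qed

text \<open>Differentiates the expansion in barycentric coordinates; the form allows comparison with
  the gradient of an interpolant.\<close>

lemma affine_eq_sum_outer:
  fixes A :: "real^'n^'m"
  shows "A = (\<Sum>z\<in>T. outer (A *v z + a) (bgrad z))"
proof -
  have p: "P1 (\<lambda>x. A *v x + a)"
    unfolding P1_def using matrix_vector_mul_linear by blast
  have "A *v u = (\<Sum>z\<in>T. outer (A *v z + a) (bgrad z)) *v u" for u
  proof -
    have "A *v u = (A *v u + a) - (A *v 0 + a)" by simp
    also have "\<dots> = (\<Sum>z\<in>T. (bary T z u - bary T z 0) *\<^sub>R (A *v z + a))"
      using P1_expand[OF p, of u] P1_expand[OF p, of 0]
      by (simp add: sum_subtractf scaleR_left_diff_distrib)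
    also have "\<dots> = (\<Sum>z\<in>T. (bgrad z \<bullet> u) *\<^sub>R (A *v z + a))"
      by (rule sum.cong) (auto simp: bary_diff)
    finally show ?thesis by (simp add: sum_outer_mult_vec)
  qed
  then show ?thesis by (intro iffD2[OF matrix_eq] allI)
qed

lemma norm_sum_outer_bgrad_le:
  fixes f :: "real^'n \<Rightarrow> real^'m"
  assumes "\<And>z. z \<in> T \<Longrightarrow> norm (f z) \<le> B"
  shows "norm (\<Sum>z\<in>T. outer (f z) (bgrad z)) \<le> real (Suc CARD('n)) * \<rho> * (B / hdiam T)"
proof -
  have "norm (\<Sum>z\<in>T. outer (f z) (bgrad z)) \<le> (\<Sum>z\<in>T. B * (\<rho> / hdiam T))"
  proof (rule sum_norm_le)
    fix z assume z: "z \<in> T"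
    show "norm (outer (f z) (bgrad z)) \<le> B * (\<rho> / hdiam T)"
      unfolding norm_outer
      using assms[OF z] norm_bgrad_le[OF z] order_trans[OF norm_ge_zero assms[OF z]]
      by (intro mult_mono) auto
  qed
  then show ?thesis using card_T by (simp add: mult_ac)
qed

lemma norm_interp_le:
  fixes f :: "real^'n \<Rightarrow> 'b::real_normed_vector"
  assumes "\<And>z. z \<in> T \<Longrightarrow> norm (f z) \<le> B" and x: "x \<in> convex hull T"
  shows "norm (interp T f x) \<le> B"
proof -
  have "norm (interp T f x) \<le> (\<Sum>z\<in>T. bary T z x * B)"
    unfolding interp_def using assms x
    by (intro sum_norm_le) (auto simp: convex_hull_iff intro: mult_left_mono)
  also have "\<dots> = B" by (simp add: sum_distrib_right[symmetric] bary_sum)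
  finally show ?thesis .
qed

lemma hull_subset_cball: "z \<in> T \<Longrightarrow> convex hull T \<subseteq> cball z (hdiam T)"
  using dist_hull_le[OF T_subset_hull] by (auto simp: dist_norm)

end

section \<open>Coefficients of an immersed pair bounded by L2 norms\<close>

context cut_simplex
begin

lemma L2vol_pieces_ge:
  assumes f: "pieces f fp fm" and cont: "continuous_on UNIV fp" "continuous_on UNIV fm"
    and S: "S = elem_plus d T \<and> F = fp \<or> S = elem_minus d T \<and> F = fm"
    and ball: "ball x0 r \<subseteq> S" "0 \<le> r" and m: "\<And>x. x \<in> ball x0 r \<Longrightarrow> m \<le> norm (F x)" "0 \<le> m"
  shows "m * sqrt (unit_ball_vol CARD('n) * r ^ CARD('n)) \<le> L2vol (open_simplex T) f"
proof -
  have bdd: "bounded (elem_plus d T)" "bounded (elem_minus d T)"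
    using bounded_subset[OF bounded_hull open_simplex_subset]
    by (auto simp: elem_plus_def elem_minus_def intro: bounded_subset)
  have disj: "elem_plus d T \<inter> elem_minus d T = {}" "elem_minus d T \<inter> elem_plus d T = {}"
    by (auto simp: elem_plus_def elem_minus_def)
  have sub: "elem_plus d T \<union> elem_minus d T \<subseteq> open_simplex T"
      "elem_minus d T \<union> elem_plus d T \<subseteq> open_simplex T"
    by (auto simp: elem_plus_def elem_minus_def)
  have "open_simplex T - (elem_plus d T \<union> elem_minus d T) = Gam d T"
    "open_simplex T - (elem_minus d T \<union> elem_plus d T) = Gam d T"
    by (auto simp: elem_plus_def elem_minus_def Gam_def)
  then have neg: "negligible (open_simplex T - (elem_plus d T \<union> elem_minus d T))"
    "negligible (open_simplex T - (elem_minus d T \<union> elem_plus d T))"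
    using negligible_Gam by auto
  from S show ?thesis
  proof
    assume S: "S = elem_plus d T \<and> F = fp"
    show ?thesis
      by (rule L2vol_ge[OF open_elem_plus open_elem_minus bdd disj(1) sub(1) neg(1), of f fp fm x0 r m])
        (use S f cont ball m in \<open>auto simp: pieces_def\<close>)
  next
    assume S: "S = elem_minus d T \<and> F = fm"
    show ?thesis
      by (rule L2vol_ge[OF open_elem_minus open_elem_plus bdd(2,1) disj(2) sub(2) neg(2), of f fm fp x0 r m])
        (use S f cont ball m in \<open>auto simp: pieces_def\<close>)
  qed
qed

lemma L2vol_pieces_max:
  assumes f: "pieces f fp fm" and cont: "continuous_on UNIV fp" "continuous_on UNIV fm"
    and S: "S = elem_plus d T \<and> F = fp \<or> S = elem_minus d T \<and> F = fm"
    and ball: "ball x0 (hdiam T / (2 * \<rho> * D)) \<subseteq> S" "1 \<le> D"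
    and m: "\<And>x. x \<in> ball x0 (hdiam T / (2 * \<rho> * D)) \<Longrightarrow> M / 2 \<le> norm (F x)" "0 \<le> M"
  shows "M \<le> L2_const CARD('n) \<rho> D * (L2vol (open_simplex T) f / sqrt (hdiam T ^ CARD('n)))"
proof -
  let ?k = "unit_ball_vol (real CARD('n)) * (1 / (2 * \<rho> * D)) ^ CARD('n)"
  have pos: "0 < \<rho>" "0 < D" "0 < hdiam T" using rho_ge_1 \<open>1 \<le> D\<close> hdiam_pos by auto
  then have k: "0 < ?k" by (intro mult_pos_pos zero_less_power) auto
  have "M / 2 * sqrt (unit_ball_vol (real CARD('n)) * (hdiam T / (2 * \<rho> * D)) ^ CARD('n))
      \<le> L2vol (open_simplex T) f"
    by (rule L2vol_pieces_ge[OF f cont S ball(1) _ m(1)]) (use pos m in auto)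
  also have "sqrt (unit_ball_vol (real CARD('n)) * (hdiam T / (2 * \<rho> * D)) ^ CARD('n)) =
      sqrt ?k * sqrt (hdiam T ^ CARD('n))"
    by (simp add: real_sqrt_mult[symmetric] power_divide power_one_over)
  finally have "M * (sqrt ?k * sqrt (hdiam T ^ CARD('n))) \<le> 2 * L2vol (open_simplex T) f" by simp
  then show ?thesis using k pos by (simp add: L2_const_def field_simps)
qed

end

text \<open>Keeps the consequences of the interface conditions, in which the viscosities survive
  only through \<open>J\<close>. Both sides share \<open>\<beta>\<close> and the pressure gradient
  \<open>g\<close>, and the jump bounds hold with either gradient, so each side controls the
  other.\<close>

locale ife_pair = cut_simplex T \<rho> d xs for T :: "(real^'n) set" and \<rho> d xs +
  fixes v :: "real^'n \<Rightarrow> real^'n" and q :: "real^'n \<Rightarrow> real" and \<beta> :: "real^'n"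
    and Ap Am :: "real^'n^'n" and ap am c g :: "real^'n" and qp qm J :: real
  assumes dim_ge_2: "CARD('n) \<ge> 2"
    and v: "pieces (\<lambda>x. v x - bubble T x *\<^sub>R \<beta>) (\<lambda>x. Ap *v x + ap) (\<lambda>x. Am *v x + am)"
    and q: "pieces q (\<lambda>x. g \<bullet> x + qp) (\<lambda>x. g \<bullet> x + qm)"
    and jump: "\<forall>x. (Ap *v x + ap) - (Am *v x + am) = (nu \<bullet> (x - xs)) *\<^sub>R c"
    and outer_jump: "Ap - Am = outer c nu"
    and J: "\<bar>qp - qm\<bar> \<le> J * norm Ap" "\<bar>qp - qm\<bar> \<le> J * norm Am"
      "norm c \<le> J * norm Ap" "norm c \<le> J * norm Am" "0 \<le> J"
begin

abbreviation "h \<equiv> hdiam T"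
abbreviation "pp \<equiv> \<lambda>x. Ap *v x + ap"
abbreviation "pm \<equiv> \<lambda>x. Am *v x + am"
abbreviation "H \<equiv> Hsemi 1 (open_simplex T) v"
abbreviation "hN \<equiv> sqrt (h ^ CARD('n))"

lemma hN_pos: "0 < hN" using hdiam_pos by simp

lemma H_eq: "H = L2vol (open_simplex T) (jac v)" by (simp add: Hsemi_def)

lemma H_nonneg: "0 \<le> H" unfolding H_eq by (rule L2norm_nonneg)

lemma P1_p: "P1 pp" "P1 pm"
  unfolding P1_def using matrix_vector_mul_linear by blast+

lemma cont_p: "isCont pp x" "isCont pm x" "continuous_on S pp" "continuous_on S pm"
  using isCont_P1 continuous_on_P1 P1_p by blast+

lemma isCont_bubble: "isCont (bubble T) x"
  using continuous_on_bubble[of UNIV] by (simp add: continuous_on_eq_continuous_at)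

lemma v_pieces: "pieces v (\<lambda>x. pp x + bubble T x *\<^sub>R \<beta>) (\<lambda>x. pm x + bubble T x *\<^sub>R \<beta>)"
  using v unfolding pieces_def by (metis diff_add_cancel)

abbreviation "Jp \<equiv> \<lambda>x. Ap + outer \<beta> (bubble_grad x)"
abbreviation "Jm \<equiv> \<lambda>x. Am + outer \<beta> (bubble_grad x)"

lemma has_derivative_bubble_affine:
  "((\<lambda>x. (A *v x + a) + bubble T x *\<^sub>R \<beta>) has_derivative (\<lambda>h. (A + outer \<beta> (bubble_grad x)) *v h)) (at x)"
  for A :: "real^'n^'n"
proof -
  have "((\<lambda>x. (A *v x + a) + bubble T x *\<^sub>R \<beta>) has_derivative (\<lambda>h. A *v h
      + (bubble_grad x \<bullet> h) *\<^sub>R \<beta>)) (at x)"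
    by (intro has_derivative_add has_derivative_affine has_derivative_scaleR_left has_derivative_bubble)
  then show ?thesis by (simp add: matrix_vector_mult_add_rdistrib outer_mult_vec)
qed

lemma jac_pieces: "pieces (jac v) Jp Jm"
  by (rule pieces_jac[OF v_pieces has_derivative_bubble_affine has_derivative_bubble_affine])

lemma continuous_on_outer_bubble_grad: "continuous_on S (\<lambda>x. outer \<beta> (bubble_grad x))"
proof -
  have "continuous_on S (\<lambda>x. bubble_grad x)"
    unfolding bubble_grad_def
    by (intro continuous_intros continuous_on_P1 P1_bary) auto
  then show ?thesis unfolding outer_def by (intro continuous_intros) auto
qed

lemma norm_jac_le:
  assumes "x \<in> convex hull T" "norm A \<le> B" "norm \<beta> \<le> B * h"
  shows "norm (A + outer \<beta> (bubble_grad x)) \<le> B * (1 + real (Suc CARD('n)) * \<rho>)"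
proof -
  have "norm (A + outer \<beta> (bubble_grad x)) \<le> norm A + norm \<beta> * norm (bubble_grad x)"
    using norm_triangle_ineq[of A "outer \<beta> (bubble_grad x)"] by (simp add: norm_outer)
  also have "\<dots> \<le> B + (B * h) * (real (Suc CARD('n)) * (\<rho> / h))"
    using assms norm_bubble_grad_le[OF assms(1)] order_trans[OF norm_ge_zero assms(3)]
    by (intro add_mono mult_mono) auto
  also have "\<dots> = B * (1 + real (Suc CARD('n)) * \<rho>)" using hdiam_pos by (simp add: field_simps)
  finally show ?thesis .
qed

lemma norm_other_side: "norm Am \<le> (1 + J) * norm Ap" "norm Ap \<le> (1 + J) * norm Am"
proof -
  have n: "norm (outer c nu) = norm c" by (simp add: norm_outer norm_nu)
  have "Am = Ap - outer c nu" "Ap = Am + outer c nu" using outer_jump by (auto simp: algebra_simps)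
  then show "norm Am \<le> (1 + J) * norm Ap" "norm Ap \<le> (1 + J) * norm Am"
    using norm_triangle_ineq4[of Ap "outer c nu"] norm_triangle_ineq[of Am "outer c nu"] n J(3,4)
    by (simp_all add: algebra_simps)
qed

lemma L2_const_nonneg: "1 \<le> D \<Longrightarrow> 0 \<le> L2_const CARD('n) \<rho> D"
  using rho_ge_1 by (auto simp: L2_const_def)

lemma bounds_nonneg: "0 \<le> grad_bound CARD('n) \<rho> J" "0 \<le> value_bound CARD('n) \<rho> J"
  "0 \<le> pressure_bound CARD('n) \<rho>"
  using J(5) grad_const_ge(2) value_const_ge(2) rho_ge_1 L2_const_nonneg
  by (auto simp: grad_bound_def value_bound_def pressure_bound_def intro!: mult_nonneg_nonneg)

text \<open>\<open>W\<close> is a mean size of the gradient, the volume of T being removed by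
  \<open>hN\<close>. \<open>key\<close> is applied to the side that \<open>big_side\<close> offers;
  the jump bounds in terms of that side give the rest.\<close>

lemma gradient_control:
  defines "W \<equiv> H / hN"
  shows "norm \<beta> \<le> grad_bound CARD('n) \<rho> J * W * h" "norm Ap \<le> grad_bound CARD('n) \<rho> J * W"
      "norm Am \<le> grad_bound CARD('n) \<rho> J * W"
    "norm c \<le> grad_bound CARD('n) \<rho> J * W" "\<bar>qp - qm\<bar> \<le> grad_bound CARD('n) \<rho> J * W"
proof -
  let ?D = "grad_const CARD('n) \<rho>" and ?L = "L2_const CARD('n) \<rho> (grad_const CARD('n) \<rho>)"
  have D: "1 \<le> ?D" "1 / margin CARD('n) \<le> 2 * ?D" by (rule grad_const_ge)+
  have cont: "continuous_on S Jp" "continuous_on S Jm" for S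
    by (intro continuous_intros continuous_on_outer_bubble_grad)+
  have key: "norm \<beta> \<le> ?D * (?L * W) * h \<and> norm A \<le> ?D * (?L * W)"
    if z: "z \<in> T" "vertex_region z \<subseteq> S"
      and S: "S = elem_plus d T \<and> A = Ap \<or> S = elem_minus d T \<and> A = Am" for z S A
  proof -
    let ?F = "\<lambda>x. A + outer \<beta> (bubble_grad x)"
    obtain x1 M where M: "0 \<le> M" "\<And>x. x \<in> core z \<Longrightarrow> norm (?F x) \<le> M"
        "ball x1 (h / (2 * \<rho> * ?D)) \<subseteq> vertex_region z"
        "\<And>y. y \<in> ball x1 (h / (2 * \<rho> * ?D)) \<Longrightarrow> M / 2 \<le> norm (?F y)"
    proof (rule core_max[OF z(1) D(2), of ?F])
      show "continuous_on (core z) ?F" by (intro continuous_intros continuous_on_outer_bubble_grad)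
      show "norm (?F x - ?F y) \<le> ?D * (\<rho> / h) * M * norm (x - y)"
        if "0 \<le> M" "\<And>x. x \<in> core z \<Longrightarrow> norm (?F x) \<le> M" "x \<in> convex hull T" "y \<in> convex hull T" for M x y
        by (rule core_grad_bounds(3)[OF z(1) that(1,2) that(3,4)])
    qed blast
    have "M \<le> ?L * (L2vol (open_simplex T) (jac v) / hN)"
      by (rule L2vol_pieces_max[OF jac_pieces cont, of S ?F x1 ?D])
        (use S M z D in auto)
    then have le: "M \<le> ?L * W" by (simp only: W_def H_eq)
    have "norm \<beta> \<le> ?D * h * M" "norm A \<le> ?D * M"
      using core_grad_bounds(1,2)[OF z(1) M(1,2)] by auto
    moreover have "?D * h * M \<le> ?D * h * (?L * W)" "?D * M \<le> ?D * (?L * W)"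
      using le D hdiam_pos by (intro mult_left_mono; simp)+
    ultimately show ?thesis by (simp add: mult_ac)
  qed
  let ?B = "?D * (?L * W)"
  have aW: "grad_bound CARD('n) \<rho> J * W = (1 + J) * ?B" by (simp add: grad_bound_def)
  have W: "0 \<le> W" using H_nonneg hN_pos by (simp add: W_def)
  have B0: "0 \<le> ?B" using W D L2_const_nonneg[OF D(1)] by auto
  have B1: "?B \<le> grad_bound CARD('n) \<rho> J * W" "J * ?B \<le> grad_bound CARD('n) \<rho> J * W" unfolding aW
      using B0 J(5) by (auto simp: algebra_simps)
  have *: "norm \<beta> \<le> ?B * h \<and> norm Ap \<le> grad_bound CARD('n) \<rho> J * W \<and> norm Am
      \<le> grad_bound CARD('n) \<rho> J * W \<and> norm c
          \<le> grad_bound CARD('n) \<rho> J * W \<and> \<bar>qp - qm\<bar> \<le> grad_bound CARD('n) \<rho> J * W"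
  proof (rule big_side)
    fix z assume "z \<in> T" "vertex_region z \<subseteq> elem_plus d T"
    then have k: "norm \<beta> \<le> ?B * h" "norm Ap \<le> ?B" using key by blast+
    have "(1 + J) * norm Ap \<le> grad_bound CARD('n) \<rho> J * W" "J * norm Ap \<le> J * ?B"
      unfolding aW using k(2) J(5) by (intro mult_left_mono; simp)+
    then show ?thesis using k B1 norm_other_side(1) J(1,3) by linarith
  next
    fix z assume "z \<in> T" "vertex_region z \<subseteq> elem_minus d T"
    then have k: "norm \<beta> \<le> ?B * h" "norm Am \<le> ?B" using key by blast+
    have "(1 + J) * norm Am \<le> grad_bound CARD('n) \<rho> J * W" "J * norm Am \<le> J * ?B"
      unfolding aW using k(2) J(5) by (intro mult_left_mono; simp)+
    then show ?thesis using k B1 norm_other_side(2) J(2,4) by linarith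
  qed
  have "?B * h \<le> grad_bound CARD('n) \<rho> J * W * h" using B1 hdiam_pos by (intro mult_right_mono) auto
  then show "norm \<beta> \<le> grad_bound CARD('n) \<rho> J * W * h" "norm Ap \<le> grad_bound CARD('n) \<rho> J * W"
      "norm Am \<le> grad_bound CARD('n) \<rho> J * W"
    "norm c \<le> grad_bound CARD('n) \<rho> J * W" "\<bar>qp - qm\<bar> \<le> grad_bound CARD('n) \<rho> J * W" using * by linarith+
qed

text \<open>The \<open>/ h * h\<close> in the first bound matches the hypotheses of
  \<open>norm_jac_le\<close>, where one quantity \<open>B\<close> bounds the matrix and
  \<open>B * h\<close> the bubble coefficient.\<close>

lemma value_control:
  defines "Y \<equiv> L2vol (open_simplex T) v / hN"
  shows "norm \<beta> \<le> value_bound CARD('n) \<rho> J * Y / h * h" "norm Ap \<le> value_bound CARD('n) \<rho> J * Y / h"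
      "norm Am \<le> value_bound CARD('n) \<rho> J * Y / h"
proof -
  let ?D = "value_const CARD('n)" and ?L = "L2_const CARD('n) \<rho> (value_const CARD('n))"
  have D: "1 \<le> ?D" "1 / margin CARD('n) \<le> 2 * ?D" by (rule value_const_ge)+
  have cont: "continuous_on S (\<lambda>x. (A *v x + b) + bubble T x *\<^sub>R \<beta>)" for S and A :: "real^'n^'n" and b
    by (rule has_derivative_continuous_on) (rule has_derivative_at_withinI[OF has_derivative_bubble_affine])
  have key: "norm \<beta> \<le> ?D * (?L * Y) \<and> norm A \<le> real CARD('n) * (?D * (\<rho> / h) * (?L * Y))"
    if z: "z \<in> T" "vertex_region z \<subseteq> S"
      and S: "S = elem_plus d T \<and> A = Ap \<and> b = ap \<or> S = elem_minus d T \<and> A = Am \<and> b = am" for z S A b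
  proof -
    let ?p = "\<lambda>x. A *v x + b"
    let ?F = "\<lambda>x. ?p x + bubble T x *\<^sub>R \<beta>"
    have p: "P1 ?p" using S P1_p by auto
    obtain x1 M where M: "0 \<le> M" "\<And>x. x \<in> core z \<Longrightarrow> norm (?F x) \<le> M"
        "ball x1 (h / (2 * \<rho> * ?D)) \<subseteq> vertex_region z"
        "\<And>y. y \<in> ball x1 (h / (2 * \<rho> * ?D)) \<Longrightarrow> M / 2 \<le> norm (?F y)"
    proof (rule core_max[OF z(1) D(2), of ?F])
      show "continuous_on (core z) ?F" by (rule cont)
      show "norm (?F x - ?F y) \<le> ?D * (\<rho> / h) * M * norm (x - y)"
        if "0 \<le> M" "\<And>x. x \<in> core z \<Longrightarrow> norm (?F x) \<le> M" "x \<in> convex hull T" "y \<in> convex hull T" for M x y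
        by (rule core_value_bounds(4)[OF z(1) p that(1,2) that(3,4)])
    qed blast
    have "M \<le> ?L * (L2vol (open_simplex T) v / hN)"
      by (rule L2vol_pieces_max[OF v_pieces cont cont, of S ?F x1 ?D])
        (use S M z D in auto)
    then have le: "M \<le> ?L * Y" by (simp add: Y_def)
    have "norm \<beta> \<le> ?D * M" by (rule core_value_bounds(1)[OF z(1) p M(1,2)])
    also have "\<dots> \<le> ?D * (?L * Y)" using le D by (intro mult_left_mono) auto
    finally have b: "norm \<beta> \<le> ?D * (?L * Y)" .
    have "norm (A *v u) \<le> ?D * (\<rho> / h) * (?L * Y) * norm u" for u
    proof -
      have "norm (A *v u) = norm (?p (0 + u) - ?p 0)" by simp
      also have "\<dots> \<le> ?D * (\<rho> / h) * M * norm u" by (rule core_value_bounds(3)[OF z(1) p M(1,2)])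
      also have "\<dots> \<le> ?D * (\<rho> / h) * (?L * Y) * norm u"
        using le D hdiam_pos rho_ge_1 by (intro mult_right_mono mult_left_mono) auto
      finally show ?thesis .
    qed
    then show ?thesis using b norm_matrix_le_columns by blast
  qed
  let ?B = "(1 + real CARD('n) * \<rho>) * (?D * (?L * Y)) / h"
  have aY: "value_bound CARD('n) \<rho> J * Y / h = (1 + J) * ?B" by (simp add: value_bound_def)
  have Y: "0 \<le> Y" unfolding Y_def using L2norm_nonneg hN_pos by (intro divide_nonneg_pos)
  have B00: "0 \<le> ?D * (?L * Y)" using Y D L2_const_nonneg[OF D(1)] by auto
  have \<rho>: "0 \<le> real CARD('n) * \<rho>" using rho_ge_1 by auto
  have B0: "0 \<le> ?B" using B00 \<rho> hdiam_pos by auto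
  have B1: "?D * (?L * Y) \<le> ?B * h" "real CARD('n) * (?D * (\<rho> / h) * (?L * Y)) \<le> ?B"
  proof -
    have "0 \<le> real CARD('n) * \<rho> * (?D * (?L * Y))" using B00 \<rho> by (rule mult_nonneg_nonneg[rotated])
    then have "?D * (?L * Y) \<le> (1 + real CARD('n) * \<rho>) * (?D * (?L * Y))" by (simp only: distrib_right)
    also have "\<dots> = ?B * h" using hdiam_pos by simp
    finally show "?D * (?L * Y) \<le> ?B * h" .
    have "real CARD('n) * (?D * (\<rho> / h) * (?L * Y)) = (real CARD('n) * \<rho>) * (?D * (?L * Y)) / h"
      by simp
    also have "\<dots> \<le> ?B" using B00 hdiam_pos by (intro divide_right_mono mult_right_mono) auto
    finally show "real CARD('n) * (?D * (\<rho> / h) * (?L * Y)) \<le> ?B" .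
  qed
  have B2: "?B \<le> value_bound CARD('n) \<rho> J * Y / h" unfolding aY
      using mult_right_mono[OF _ B0, of 1 "1 + J"] J(5) by linarith
  have *: "norm \<beta> \<le> ?B * h \<and> norm Ap \<le> value_bound CARD('n) \<rho> J * Y / h \<and> norm Am
      \<le> value_bound CARD('n) \<rho> J * Y / h"
  proof (rule big_side)
    fix z assume "z \<in> T" "vertex_region z \<subseteq> elem_plus d T"
    then have k: "norm \<beta> \<le> ?B * h" "norm Ap \<le> ?B"
      using key[of z "elem_plus d T" Ap ap] B1 by auto
    have "(1 + J) * norm Ap \<le> value_bound CARD('n) \<rho> J * Y / h"
      unfolding aY using k(2) J(5) by (intro mult_left_mono) auto
    then show ?thesis using k B2 norm_other_side(1) by linarith
  next
    fix z assume "z \<in> T" "vertex_region z \<subseteq> elem_minus d T"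
    then have k: "norm \<beta> \<le> ?B * h" "norm Am \<le> ?B"
      using key[of z "elem_minus d T" Am am] B1 by auto
    have "(1 + J) * norm Am \<le> value_bound CARD('n) \<rho> J * Y / h"
      unfolding aY using k(2) J(5) by (intro mult_left_mono) auto
    then show ?thesis using k B2 norm_other_side(2) by linarith
  qed
  have "?B * h \<le> value_bound CARD('n) \<rho> J * Y / h * h" using B2 hdiam_pos by (intro mult_right_mono) auto
  then show "norm \<beta> \<le> value_bound CARD('n) \<rho> J * Y / h * h"
      "norm Ap \<le> value_bound CARD('n) \<rho> J * Y / h" "norm Am \<le> value_bound CARD('n) \<rho> J * Y / h"
    using * by linarith+
qed

text \<open>A pressure is the case \<open>\<beta> = 0\<close> of \<open>core_value_bounds\<close>.
  The slope spreads the bound at \<open>core_point z\<close> over T, a distance of at most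
  \<open>hdiam T\<close>, which gives the factor \<open>1 + \<rho>\<close>; passing to the other
  side costs the jump.\<close>

lemma pressure_control:
  assumes x: "x \<in> convex hull T"
  defines "Y \<equiv> L2vol (open_simplex T) q / hN"
  shows "\<bar>g \<bullet> x + qp\<bar> \<le> pressure_bound CARD('n) \<rho> * Y + \<bar>qp - qm\<bar>"
      "\<bar>g \<bullet> x + qm\<bar> \<le> pressure_bound CARD('n) \<rho> * Y + \<bar>qp - qm\<bar>"
proof -
  let ?D = "value_const CARD('n)" and ?L = "L2_const CARD('n) \<rho> (value_const CARD('n))"
  have D: "1 \<le> ?D" "1 / margin CARD('n) \<le> 2 * ?D" by (rule value_const_ge)+
  have p: "P1 (\<lambda>x. g \<bullet> x + k)" for k :: real
    unfolding P1_def by (intro exI[of _ "\<lambda>x. g \<bullet> x"] exI[of _ k])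
      (auto intro: bounded_linear.linear bounded_linear_inner_right)
  have key: "\<bar>g \<bullet> x + k\<bar> \<le> pressure_bound CARD('n) \<rho> * Y"
    if z: "z \<in> T" "vertex_region z \<subseteq> S"
      and S: "S = elem_plus d T \<and> k = qp \<or> S = elem_minus d T \<and> k = qm" for z S k
  proof -
    let ?F = "\<lambda>x. g \<bullet> x + k"
    have bub: "?F y = ?F y + bubble T y *\<^sub>R 0" for y by simp
    obtain x1 M where M: "0 \<le> M" "\<And>x. x \<in> core z \<Longrightarrow> norm (?F x) \<le> M"
        "ball x1 (h / (2 * \<rho> * ?D)) \<subseteq> vertex_region z"
        "\<And>y. y \<in> ball x1 (h / (2 * \<rho> * ?D)) \<Longrightarrow> M / 2 \<le> norm (?F y)"
    proof (rule core_max[OF z(1) D(2), of ?F])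
      show "continuous_on (core z) ?F" by (rule continuous_on_P1[OF p])
      show "norm (?F x - ?F y) \<le> ?D * (\<rho> / h) * M * norm (x - y)"
        if "0 \<le> M" "\<And>x. x \<in> core z \<Longrightarrow> norm (?F x) \<le> M" "x \<in> convex hull T" "y \<in> convex hull T" for M x y
        using core_value_bounds(4)[OF z(1) p that(1), of k 0 x y] that by simp
    qed blast
    have "M \<le> ?L * (L2vol (open_simplex T) q / hN)"
      by (rule L2vol_pieces_max[OF q continuous_on_P1[OF p] continuous_on_P1[OF p], of S ?F x1 ?D])
        (use S M z D in auto)
    then have le: "M \<le> ?L * Y" by (simp add: Y_def)
    have x0: "core_point z \<in> convex hull T" using core_point_in_core core_subset_hull[OF z(1)] by blast
    have "\<bar>?F x\<bar> \<le> norm (?F (core_point z))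
        + norm (?F (core_point z + (x - core_point z)) - ?F (core_point z))"
      by simp
    also have "\<dots> \<le> ?D * M + ?D * (\<rho> / h) * M * norm (x - core_point z)"
    proof (rule add_mono)
      have M': "norm (?F y + bubble T y *\<^sub>R 0) \<le> M" if "y \<in> core z" for y using M(2)[OF that] by simp
      show "norm (?F (core_point z)) \<le> ?D * M"
        by (rule core_value_bounds(2)[OF z(1) p M(1) M'])
      show "norm (?F (core_point z + (x - core_point z)) - ?F (core_point z))
          \<le> ?D * (\<rho> / h) * M * norm (x - core_point z)"
        by (rule core_value_bounds(3)[OF z(1) p M(1) M'])
    qed
    also have "\<dots> \<le> ?D * M + ?D * (\<rho> / h) * M * h"
      using dist_hull_le[OF x x0] D M(1) rho_ge_1 hdiam_pos by (intro add_left_mono mult_left_mono) auto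
    also have "\<dots> = (1 + \<rho>) * ?D * M" using hdiam_pos by (simp add: field_simps)
    also have "\<dots> \<le> (1 + \<rho>) * ?D * (?L * Y)" using le D rho_ge_1 by (intro mult_left_mono) auto
    finally show ?thesis by (simp add: pressure_bound_def mult_ac)
  qed
  have "\<bar>g \<bullet> x + qp\<bar> \<le> pressure_bound CARD('n) \<rho> * Y + \<bar>qp - qm\<bar> \<and> \<bar>g \<bullet> x + qm\<bar>
      \<le> pressure_bound CARD('n) \<rho> * Y + \<bar>qp - qm\<bar>"
  proof (rule big_side)
    fix z assume "z \<in> T" "vertex_region z \<subseteq> elem_plus d T"
    then have "\<bar>g \<bullet> x + qp\<bar> \<le> pressure_bound CARD('n) \<rho> * Y" using key by blast
    then show ?thesis by linarith
  next
    fix z assume "z \<in> T" "vertex_region z \<subseteq> elem_minus d T"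
    then have "\<bar>g \<bullet> x + qm\<bar> \<le> pressure_bound CARD('n) \<rho> * Y" using key by blast
    then show ?thesis by linarith
  qed
  then show "\<bar>g \<bullet> x + qp\<bar> \<le> pressure_bound CARD('n) \<rho> * Y + \<bar>qp - qm\<bar>"
      "\<bar>g \<bullet> x + qm\<bar> \<le> pressure_bound CARD('n) \<rho> * Y + \<bar>qp - qm\<bar>" by auto
qed

end

section \<open>Element estimates\<close>

context resolved_simplex
begin

lemma P1_eq_zero_on_open:
  fixes p :: "real^'n \<Rightarrow> 'b::real_normed_vector"
  assumes p: "P1 p" and U: "open U" "U \<noteq> {}" and zero: "\<And>x. x \<in> U \<Longrightarrow> p x = 0"
  shows "p y = 0"
proof -
  obtain x where x: "x \<in> U" using U by blast
  then obtain e where e: "0 < e" "ball x e \<subseteq> U" using openE[OF U(1)] by metis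
  obtain L k where L: "linear L" "\<And>x. p x = L x + k" using p by (auto simp: P1_def)
  define s where "s = e / 2 / (norm (y - x) + 1)"
  have pos: "0 < norm (y - x) + 1" by (intro add_nonneg_pos) auto
  have s: "0 < s" using e pos by (simp add: s_def)
  have "s * norm (y - x) \<le> s * (norm (y - x) + 1)" using s by (intro mult_left_mono) auto
  also have "\<dots> = e / 2" unfolding s_def using pos by (intro nonzero_eq_divide_eq[THEN iffD1]) auto
  also have "\<dots> < e" using e by simp
  finally have "x + s *\<^sub>R (y - x) \<in> U" using s by (intro subsetD[OF e(2)]) (simp add: dist_norm)
  then have "p (x + s *\<^sub>R (y - x)) = 0" "p x = 0" using zero x by auto
  moreover have "p (x + s *\<^sub>R (y - x)) - p x = s *\<^sub>R (p y - p x)"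
    by (simp add: L(2) linear_add[OF L(1)] linear_cmul[OF L(1)] linear_diff[OF L(1)])
  ultimately have "s *\<^sub>R (p y - p x) = 0" by simp
  then show ?thesis using s \<open>p x = 0\<close> by simp
qed

lemma P1_ext_eq:
  fixes p :: "real^'n \<Rightarrow> 'b::real_normed_vector"
  assumes p: "P1 p" and U: "open U" "U \<noteq> {}" and f: "\<And>x. x \<in> U \<Longrightarrow> f x = p x"
  shows "P1_ext U f = p"
  unfolding P1_ext_def
proof (rule the_equality)
  show "P1 p \<and> (\<forall>x\<in>U. f x = p x)" using p f by blast
  fix r assume r: "P1 r \<and> (\<forall>x\<in>U. f x = r x)"
  have "r y - p y = 0" for y
  proof (rule P1_eq_zero_on_open[OF P1_diff U])
    show "P1 r" "P1 p" using r p by blast+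
    show "r x - p x = 0" if "x \<in> U" for x using r f[OF that] that by simp
  qed
  then show "r = p" by (simp add: fun_eq_iff)
qed

text \<open>A second difference along a short segment parallel to an edge vanishes for
  \<open>p\<close>, while for the bubble it is nonzero at interior points of T.\<close>

lemma bubble_not_P1:
  fixes p :: "real^'n \<Rightarrow> 'b::real_normed_vector"
  assumes p: "P1 p" and U: "open U" "U \<noteq> {}" "U \<subseteq> open_simplex T"
    and eq: "\<And>x. x \<in> U \<Longrightarrow> bubble T x *\<^sub>R \<gamma> = p x"
  shows "\<gamma> = 0"
proof -
  obtain x where x: "x \<in> U" using U by blast
  then obtain e where e: "0 < e" "ball x e \<subseteq> U" using openE[OF U(1)] by metis
  obtain z where z: "z \<in> T" using resolved by blast
  obtain w where w: "w \<in> T" "w \<noteq> z" using ex_other_vertex[OF z] .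
  define s where "s = e / 2 / norm (z - w)"
  have s: "0 < s" "s * norm (z - w) < e" using e w by (auto simp: s_def)
  have pts: "x + s *\<^sub>R (z - w) \<in> U" "x - s *\<^sub>R (z - w) \<in> U"
    using s by (auto intro!: subsetD[OF e(2)] simp: dist_norm)
  have "p (x + s *\<^sub>R (z - w)) - p x = p (x - s *\<^sub>R (z - w) + s *\<^sub>R (z - w)) - p (x - s *\<^sub>R (z - w))"
    by (rule P1_add_diff[OF p])
  then have "p (x + s *\<^sub>R (z - w)) - 2 *\<^sub>R p x + p (x - s *\<^sub>R (z - w)) = 0"
    by (simp add: scaleR_2 algebra_simps)
  then have "(bubble T (x + s *\<^sub>R (z - w)) - 2 * bubble T x + bubble T (x - s *\<^sub>R (z - w))) *\<^sub>R \<gamma> = 0"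
    using eq[OF x] eq[OF pts(1)] eq[OF pts(2)]
    by (simp only: scaleR_left_distrib scaleR_left_diff_distrib scaleR_scaleR[symmetric])
  moreover have "0 < (\<Prod>u\<in>T - {z, w}. bary T u x)"
    using x U(3) by (intro prod_pos) (auto simp: open_simplex_iff)
  ultimately show ?thesis
    using bubble_second_difference[of z w x s] z w s(1) by auto
qed

text \<open>On a face both neighbouring elements are compared to the linear interpolant of the common
  nodal values, which the bubble does not see.\<close>

lemma face_trace:
  fixes f :: "real^'n \<Rightarrow> 'b::real_normed_vector"
  assumes f: "pieces f (\<lambda>x. rp x + bubble T x *\<^sub>R \<gamma>) (\<lambda>x. rm x + bubble T x *\<^sub>R \<gamma>)"
    and r: "P1 rp" "P1 rm" and B: "\<And>w. w \<in> T \<Longrightarrow> norm (rp w - rm w) \<le> B"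
    and ne: "elem_minus d T \<noteq> {} \<or> rp = rm" and z: "z \<in> T"
    and u: "\<And>w. w \<in> T - {z} \<Longrightarrow> 0 \<le> u w" "sum u (T - {z}) = 1" "(\<Sum>w\<in>T - {z}. u w *\<^sub>R w) = x"
    and x: "x \<in> open_simplex (T - {z})" and off: "interp T d x \<noteq> 0 \<or> rp = rm"
  shows "norm (inner_trace d T f x - (\<Sum>w\<in>T - {z}. u w *\<^sub>R nodal_value d T f w)) \<le> B"
proof -
  have bub: "isCont (bubble T) y" for y
    using continuous_on_bubble[of UNIV] by (simp add: continuous_on_eq_continuous_at)
  have cont: "isCont (\<lambda>x. p x + bubble T x *\<^sub>R \<gamma>) y" if "P1 p" for p y
    by (intro continuous_intros isCont_P1 that bub)
  have xh: "x \<in> convex hull T" "bary T z x = 0"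
    using open_simplex_face[OF z x] by blast+
  \<comment> \<open>The piece that the trace at \<open>x\<close> sees; the bubble vanishes on the
    face. The trace is thus the interpolant of the vertex values of \<open>s\<close>, and only
    vertices whose nodal value comes from the other piece contribute.\<close>
  define s where "s = (if 0 < interp T d x then rp else rm)"
  have "inner_trace d T f x = s x"
    using inner_trace_pieces[OF f cont[OF r(1)] cont[OF r(2)] xh(1)] off bubble_zero[OF z xh(2)]
    by (auto simp: s_def)
  also have "\<dots> = (\<Sum>w\<in>T - {z}. u w *\<^sub>R s w)"
    using P1_affine_sum[of s u "T - {z}"] r u by (auto simp: s_def)
  finally have "inner_trace d T f x - (\<Sum>w\<in>T - {z}. u w *\<^sub>R nodal_value d T f w) =
      (\<Sum>w\<in>T - {z}. u w *\<^sub>R (s w - nodal_value d T f w))"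
    by (simp add: sum_subtractf scaleR_right_diff_distrib)
  also have "norm \<dots> \<le> (\<Sum>w\<in>T - {z}. u w * B)"
  proof (rule sum_norm_le)
    fix w assume w: "w \<in> T - {z}"
    have "nodal_value d T f w = (if 0 < d w then rp w else rm w)"
      using nodal_value_pieces[OF f cont[OF r(1)] cont[OF r(2)], of w] w ne by (auto simp: bubble_vertex)
    moreover have "norm (rm w - rp w) \<le> B" "norm (rp w - rm w) \<le> B" "0 \<le> B"
      using B[of w] w order_trans[OF norm_ge_zero B[of w]] by (auto simp: norm_minus_commute)
    ultimately have "norm (s w - nodal_value d T f w) \<le> B" by (auto simp: s_def)
    then show "norm (u w *\<^sub>R (s w - nodal_value d T f w)) \<le> u w * B"
      using u(1)[OF w] by (simp add: mult_left_mono)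
  qed
  also have "\<dots> = B" using u(2) by (simp add: sum_distrib_right[symmetric])
  finally show ?thesis .
qed

end

text \<open>A product of sums: the constant of each single estimate is a product of three factors,
  which are dominated one by one in \<open>elem_const_ge\<close>.\<close>

definition elem_const :: "nat \<Rightarrow> real \<Rightarrow> real \<Rightarrow> real" where
  "elem_const N \<rho> J = (grad_bound N \<rho> J + value_bound N \<rho> J + pressure_bound N \<rho>) *
     (1 + real (Suc N) * \<rho>) *
     (1 + sqrt (unit_ball_vol (real N)) + sqrt (real (Suc N) * surf_const N))"

context ife_pair
begin

lemma elem_const_ge:
  assumes "0 \<le> x" "x \<le> grad_bound CARD('n) \<rho> J
      + value_bound CARD('n) \<rho> J + pressure_bound CARD('n) \<rho>" "0 \<le> y"
          "y \<le> (1 + real (Suc CARD('n)) * \<rho>)" "0 \<le> w"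
              "w \<le> 1 + sqrt (unit_ball_vol (real CARD('n)))
                  + sqrt (real (Suc CARD('n)) * surf_const CARD('n))"
  shows "x * y * w \<le> elem_const CARD('n) \<rho> J"
  unfolding elem_const_def using assms by (intro mult_mono mult_nonneg_nonneg) auto

lemma s_nonneg: "0 \<le> sqrt (unit_ball_vol (real CARD('n)))"
    "0 \<le> sqrt (real (Suc CARD('n)) * surf_const CARD('n))" "0 \<le> sqrt (surf_const CARD('n))"
        "sqrt (surf_const CARD('n)) \<le> sqrt (real (Suc CARD('n)) * surf_const CARD('n))"
            "1 \<le> (1 + real (Suc CARD('n)) * \<rho>)"
proof -
  have "1 * surf_const CARD('n) \<le> real (Suc CARD('n)) * surf_const CARD('n)"
    using surf_const_nonneg by (intro mult_right_mono) auto
  then show "sqrt (surf_const CARD('n)) \<le> sqrt (real (Suc CARD('n)) * surf_const CARD('n))" by simp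
qed (use surf_const_nonneg rho_ge_1 in auto)

text \<open>Surface measure scales like \<open>h ^ (N - 1)\<close> and volume like
  \<open>h ^ N\<close>; the ratio of their square roots is the power -1/2 in the trace
  estimates.\<close>

lemma sqrt_h_powers: "sqrt (h ^ (CARD('n) - 1)) = hN * h powr (-1/2)"
    "h powr (1/2) * sqrt (h ^ (CARD('n) - 1)) = hN"
proof -
  have "h ^ CARD('n) = h * h ^ (CARD('n) - 1)"
      using dim_ge_2 by (metis One_nat_def Suc_pred power_Suc zero_less_card_finite)
  then have eq: "hN = sqrt h * sqrt (h ^ (CARD('n) - 1))" by (simp add: real_sqrt_mult)
  show "h powr (1/2) * sqrt (h ^ (CARD('n) - 1)) = hN"
    using eq hdiam_pos by (simp add: powr_half_sqrt)
  show "sqrt (h ^ (CARD('n) - 1)) = hN * h powr (-1/2)"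
    using eq hdiam_pos powr_neg_half[OF hdiam_pos] by simp
qed

text \<open>Where the boundary meets \<Gamma>_h the trace may be a default value; that set is
  null.\<close>

lemma L2surf_frontier_le:
  fixes f :: "real^'n \<Rightarrow> 'b::real_normed_vector"
  assumes f: "pieces f fp fm" and cont: "\<And>x. isCont fp x" "\<And>x. isCont fm x"
    and B: "\<And>x. x \<in> convex hull T \<Longrightarrow> norm (fp x) \<le> B" "\<And>x. x \<in> convex hull T \<Longrightarrow> norm (fm x) \<le> B"
  shows "L2surf (frontier (open_simplex T)) (inner_trace d T f)
      \<le> B * sqrt (real (Suc CARD('n)) * surf_const CARD('n)) * (hN * h powr (-1/2))"
proof -
  let ?K = "real (Suc CARD('n)) * (surf_const CARD('n) * h ^ (CARD('n) - 1))"
  have "L2surf (frontier (open_simplex T)) (inner_trace d T f) \<le> B * sqrt ?K"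
  proof (rule L2surf_le[OF dim_ge_2 frontier_measure[OF dim_ge_2] frontier_Gam_null[OF dim_ge_2]])
    fix x assume x: "x \<in> frontier (open_simplex T)"
        "x \<notin> {x \<in> frontier (open_simplex T). interp T d x = 0}"
    then have "x \<in> convex hull T" by (auto simp: frontier_open_simplex)
    then show "norm (inner_trace d T f x) \<le> B"
      using inner_trace_pieces[OF f cont] x B by auto
  next
    show "0 \<le> B" using order_trans[OF norm_ge_zero B(1)[OF xs_hull]] .
    show "0 \<le> ?K" using surf_const_nonneg hdiam_pos by (intro mult_nonneg_nonneg) auto
  qed
  also have "sqrt ?K = sqrt (real (Suc CARD('n)) * surf_const CARD('n)) * sqrt (h ^ (CARD('n) - 1))"
    by (simp only: real_sqrt_mult[symmetric] mult.assoc)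
  finally show ?thesis unfolding sqrt_h_powers by (simp only: mult.assoc)
qed

lemma L2surf_Gam_le:
  fixes f :: "real^'n \<Rightarrow> 'b::real_normed_vector"
  assumes "\<And>x. x \<in> Gam d T \<Longrightarrow> norm (f x) \<le> B" "0 \<le> B"
  shows "L2surf (Gam d T) f \<le> B * sqrt (surf_const CARD('n)) * sqrt (h ^ (CARD('n) - 1))"
proof -
  have "L2surf (Gam d T) f \<le> B * sqrt (surf_const CARD('n) * h ^ (CARD('n) - 1))"
    by (rule L2surf_le[OF dim_ge_2 Gam_measure[OF dim_ge_2], of "{}"])
      (use assms dim_ge_2 surf_const_nonneg hdiam_pos in \<open>auto simp: hausdorff_outer_empty\<close>)
  then show ?thesis by (simp add: real_sqrt_mult mult.assoc)
qed

lemma L2vol_pieces_le: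
  fixes f :: "real^'n \<Rightarrow> 'b::real_normed_vector"
  assumes f: "pieces f fp fm"
    and B: "\<And>x. x \<in> convex hull T \<Longrightarrow> norm (fp x) \<le> B" "\<And>x. x \<in> convex hull T \<Longrightarrow> norm (fm x) \<le> B"
  shows "L2vol (open_simplex T) f \<le> B * sqrt (unit_ball_vol (real CARD('n))) * hN"
proof -
  obtain z where z: "z \<in> T" using resolved by blast
  have "L2vol (open_simplex T) f \<le> B * sqrt (unit_ball_vol CARD('n) * h ^ CARD('n))"
  proof (rule L2vol_le[of _ z h "Gam d T"])
    show "open_simplex T \<subseteq> cball z h" using open_simplex_subset hull_subset_cball[OF z] by blast
    show "negligible (Gam d T)" by (rule negligible_Gam)
    fix x assume x: "x \<in> open_simplex T" "x \<notin> Gam d T"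
    then have "x \<in> elem_plus d T \<or> x \<in> elem_minus d T" using simplex_minus_Gam by blast
    then show "norm (f x) \<le> B" using f B x open_simplex_subset by (auto simp: pieces_def)
  qed (use hdiam_pos order_trans[OF norm_ge_zero B(1)[OF xs_hull]] in auto)
  then show ?thesis by (simp add: real_sqrt_mult mult.assoc)
qed

abbreviation "W \<equiv> H / hN"

lemma W_nonneg: "0 \<le> W" using H_nonneg hN_pos by simp

lemma cancel_hN: "x / hN * hN = x"
proof -
  have "hN \<noteq> 0" using hN_pos by (rule less_imp_neq[symmetric])
  then show ?thesis by (rule iffD1[OF nonzero_eq_divide_eq refl])
qed

lemma W_hN: "W * hN = H" by (rule cancel_hN)

lemma jac_bound:
  assumes "x \<in> convex hull T"
  shows "norm (Jp x) \<le> grad_bound CARD('n) \<rho> J * W * (1 + real (Suc CARD('n)) * \<rho>)"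
      "norm (Jm x) \<le> grad_bound CARD('n) \<rho> J * W * (1 + real (Suc CARD('n)) * \<rho>)"
  using norm_jac_le[OF assms gradient_control(2,1)] norm_jac_le[OF assms gradient_control(3,1)] by auto

lemma isCont_J: "isCont Jp x" "isCont Jm x"
  using continuous_on_outer_bubble_grad[of UNIV]
  by (auto simp: continuous_on_eq_continuous_at intro!: continuous_intros)

section \<open>The estimates on one cut element\<close>

lemma trace_jac_estimate:
  "L2surf (frontier (open_simplex T)) (inner_trace d T (jac v))
      \<le> elem_const CARD('n) \<rho> J * h powr (-1/2) * H"
proof -
  let ?Cg = "grad_bound CARD('n) \<rho> J" and ?E = "1 + real (Suc CARD('n)) * \<rho>"
      and ?ss = "sqrt (real (Suc CARD('n)) * surf_const CARD('n))"
  have "L2surf (frontier (open_simplex T)) (inner_trace d T (jac v))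
      \<le> ?Cg * W * ?E * ?ss * (hN * h powr (-1/2))"
    by (rule L2surf_frontier_le[OF jac_pieces isCont_J jac_bound])
  also have "\<dots> = (?Cg * ?E * ?ss) * (h powr (-1/2) * (W * hN))" by (simp only: mult_ac)
  also have "\<dots> \<le> elem_const CARD('n) \<rho> J * (h powr (-1/2) * (W * hN))"
    by (intro mult_right_mono elem_const_ge)
      (use bounds_nonneg s_nonneg H_nonneg W_hN in auto)
  finally show ?thesis unfolding W_hN by (simp only: mult.assoc)
qed

lemma inverse_estimate: "H \<le> elem_const CARD('n) \<rho> J * inverse h * L2vol (open_simplex T) v"
proof -
  let ?E = "1 + real (Suc CARD('n)) * \<rho>" and ?sv = "sqrt (unit_ball_vol (real CARD('n)))"
      and ?Cv = "value_bound CARD('n) \<rho> J"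
  let ?Y = "L2vol (open_simplex T) v / hN"
  have "L2vol (open_simplex T) (jac v) \<le> (?Cv * ?Y / h * ?E) * ?sv * hN"
    by (rule L2vol_pieces_le[OF jac_pieces])
      (use norm_jac_le[OF _ value_control(2,1)] norm_jac_le[OF _ value_control(3,1)] in auto)
  also have "\<dots> = (?Cv * ?E * ?sv) * (inverse h * (?Y * hN))" by (simp only: divide_inverse mult_ac)
  also have "?Y * hN = L2vol (open_simplex T) v" by (rule cancel_hN)
  also have "(?Cv * ?E * ?sv) * (inverse h * L2vol (open_simplex T) v)
      \<le> elem_const CARD('n) \<rho> J * (inverse h * L2vol (open_simplex T) v)"
    by (intro mult_right_mono elem_const_ge)
      (use bounds_nonneg s_nonneg hdiam_pos in \<open>auto simp: L2norm_nonneg intro!: mult_nonneg_nonneg\<close>)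
  finally show ?thesis unfolding H_eq by (simp only: mult.assoc)
qed

abbreviation "nod \<equiv> \<lambda>z. if 0 < d z then pp z else pm z"

lemma pp_minus_pm:
  assumes "x \<in> convex hull T" shows "norm (pp x - pm x) \<le> h * norm c"
proof -
  have "pp x - pm x = (nu \<bullet> (x - xs)) *\<^sub>R c" using jump by blast
  moreover have "\<bar>nu \<bullet> (x - xs)\<bar> \<le> h"
    using Cauchy_Schwarz_ineq2[of nu "x - xs"] dist_hull_le[OF assms xs_hull] norm_nu by simp
  ultimately show ?thesis by (simp add: mult_right_mono)
qed

lemma nod_bound:
  assumes "z \<in> T" shows "norm (pp z - nod z) \<le> h * norm c" "norm (pm z - nod z) \<le> h * norm c"
  using pp_minus_pm[OF T_subset_hull[OF assms]] hdiam_pos by (auto simp: norm_minus_commute)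

lemma nodal_interp_cong:
  "(\<And>z. z \<in> T \<Longrightarrow> nodal_value d T f z = k z) \<Longrightarrow> nodal_interp d T f = interp T k"
  by (auto simp: interp_def fun_eq_iff intro: sum.cong)

lemma nodal_interp_v: "nodal_interp d T v = interp T nod"
proof (rule nodal_interp_cong)
  fix z assume z: "z \<in> T"
  have cont: "isCont (\<lambda>x. pp x + bubble T x *\<^sub>R \<beta>) z" "isCont (\<lambda>x. pm x + bubble T x *\<^sub>R \<beta>) z"
    by (intro continuous_intros isCont_bubble cont_p)+
  show "nodal_value d T v z = nod z"
    using nodal_value_pieces[OF v_pieces cont z] sides_nonempty z by (simp add: bubble_vertex)
qed

lemma nodal_interp_linear: "nodal_interp d T (\<lambda>x. v x - bubble T x *\<^sub>R \<beta>) = interp T nod"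
proof (rule nodal_interp_cong)
  fix z assume z: "z \<in> T"
  show "nodal_value d T (\<lambda>x. v x - bubble T x *\<^sub>R \<beta>) z = nod z"
    using nodal_value_pieces[OF v cont_p(1,2) z] sides_nonempty by simp
qed

text \<open>The error is affine, hence the interpolant of its own vertex values. Each of these is 0
  or, up to sign, the difference of the two pieces at the vertex, which is at most
  \<open>h * norm c\<close>. In the gradient the factor \<open>\<rho> / h\<close> from
  \<open>bgrad\<close> cancels \<open>h\<close>.\<close>

lemma interp_error:
  assumes p: "(A, k) = (Ap, ap) \<or> (A, k) = (Am, am)"
  shows "x \<in> convex hull T \<Longrightarrow> norm ((A *v x + k) - interp T nod x) \<le> h * norm c"
    and "((\<lambda>x. (A *v x + k) - interp T nod x) has_derivative
      (\<lambda>u. (\<Sum>z\<in>T. outer ((A *v z + k) - nod z) (bgrad z)) *v u)) (at x)"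
    and "norm (\<Sum>z\<in>T. outer ((A *v z + k) - nod z) (bgrad z)) \<le> real (Suc CARD('n)) * \<rho> * norm c"
proof -
  have P1: "P1 (\<lambda>x. A *v x + k)" using p P1_p by auto
  have eq: "(\<lambda>x. (A *v x + k) - interp T nod x) = interp T (\<lambda>z. (A *v z + k) - nod z)"
  proof
    fix x
    have e: "A *v x + k = (\<Sum>z\<in>T. bary T z x *\<^sub>R (A *v z + k))" by (rule P1_expand[OF P1])
    show "(A *v x + k) - interp T nod x = interp T (\<lambda>z. (A *v z + k) - nod z) x"
      unfolding e by (simp only: interp_def scaleR_right_diff_distrib sum_subtractf)
  qed
  have b: "norm ((A *v z + k) - nod z) \<le> h * norm c" if "z \<in> T" for z
    using nod_bound[OF that] p by auto
  show "norm ((A *v x + k) - interp T nod x) \<le> h * norm c" if "x \<in> convex hull T"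
    using norm_interp_le[OF b that] fun_cong[OF eq, of x] by simp
  show "((\<lambda>x. (A *v x + k) - interp T nod x) has_derivative
      (\<lambda>u. (\<Sum>z\<in>T. outer ((A *v z + k) - nod z) (bgrad z)) *v u)) (at x)"
    unfolding eq by (rule has_derivative_interp)
  show "norm (\<Sum>z\<in>T. outer ((A *v z + k) - nod z) (bgrad z)) \<le> real (Suc CARD('n)) * \<rho> * norm c"
    using norm_sum_outer_bgrad_le[OF b] hdiam_pos by simp
qed

lemma interp_stability: "Hsemi 1 (open_simplex T) (nodal_interp d T v) \<le> elem_const CARD('n) \<rho> J * H"
proof -
  let ?Cg = "grad_bound CARD('n) \<rho> J" and ?E = "1 + real (Suc CARD('n)) * \<rho>"
      and ?sv = "sqrt (unit_ball_vol (real CARD('n)))"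
  let ?G = "\<Sum>z\<in>T. outer (nod z) (bgrad z)"
  have "jac (interp T nod) x = ?G" for x
    by (rule jac_eq[OF open_UNIV _ _ has_derivative_interp]) auto
  then have "pieces (jac (interp T nod)) (\<lambda>x. ?G) (\<lambda>x. ?G)" by (simp add: pieces_def)
  moreover have "norm ?G \<le> ?Cg * W * ?E"
  proof -
    \<comment> \<open>The gradient of the interpolant is that of the minus piece less that of its
      interpolation error, and \<open>W\<close> controls both.\<close>
    have G: "?G = Am - (\<Sum>z\<in>T. outer (pm z - nod z) (bgrad z))"
    proof -
      have "?G *v u = Am *v u - (\<Sum>z\<in>T. outer (pm z - nod z) (bgrad z)) *v u" for u
      proof -
        have e: "Am *v u = (\<Sum>z\<in>T. (bgrad z \<bullet> u) *\<^sub>R pm z)"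
          using arg_cong[OF affine_eq_sum_outer[of Am am], of "\<lambda>A. A *v u"]
          by (simp only: sum_outer_mult_vec)
        show ?thesis
          unfolding e by (simp only: sum_outer_mult_vec scaleR_right_diff_distrib sum_subtractf) simp
      qed
      then show ?thesis
        by (intro iffD2[OF matrix_eq] allI) (simp add: matrix_vector_mult_diff_rdistrib)
    qed
    have "norm ?G \<le> norm Am + norm (\<Sum>z\<in>T. outer (pm z - nod z) (bgrad z))"
      unfolding G by (rule norm_triangle_ineq4)
    also have "\<dots> \<le> ?Cg * W + real (Suc CARD('n)) * \<rho> * (?Cg * W)"
      using interp_error(3)[of Am am] gradient_control(3,4) rho_ge_1
        mult_left_mono[OF gradient_control(4), of "real (Suc CARD('n)) * \<rho>"]
      by (intro add_mono) auto
    finally show ?thesis by (simp only: ring_distribs mult_ac mult_1_left mult_1_right)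
  qed
  ultimately have "L2vol (open_simplex T) (jac (interp T nod)) \<le> ?Cg * W * ?E * ?sv * hN"
    by (intro L2vol_pieces_le) auto
  also have "\<dots> = (?Cg * ?E * ?sv) * (W * hN)" by (simp only: mult_ac)
  also have "\<dots> \<le> elem_const CARD('n) \<rho> J * (W * hN)"
    by (intro mult_right_mono elem_const_ge)
      (use bounds_nonneg s_nonneg H_nonneg W_hN in auto)
  finally show ?thesis unfolding W_hN nodal_interp_v by (simp add: Hsemi_def)
qed

text \<open>For two admissible coefficients, the difference times the bubble is affine on the
  nonempty open plus side, so the difference is 0.\<close>

lemma bubble_coeff_eq: "bubble_coeff d T v = \<beta>"
  unfolding bubble_coeff_def
proof (rule the_equality)
  show "P1_on (elem_plus d T) (\<lambda>x. v x - bubble T x *\<^sub>R \<beta>) \<and>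
      P1_on (elem_minus d T) (\<lambda>x. v x - bubble T x *\<^sub>R \<beta>)"
    using v P1_p unfolding P1_on_def pieces_def by blast
  fix \<gamma> assume "P1_on (elem_plus d T) (\<lambda>x. v x - bubble T x *\<^sub>R \<gamma>) \<and>
      P1_on (elem_minus d T) (\<lambda>x. v x - bubble T x *\<^sub>R \<gamma>)"
  then obtain r where r: "P1 r" "\<forall>x\<in>elem_plus d T. v x - bubble T x *\<^sub>R \<gamma> = r x"
    by (auto simp: P1_on_def)
  have "\<gamma> - \<beta> = 0"
  proof (rule bubble_not_P1[OF P1_diff[OF P1_p(1) r(1)] open_elem_plus sides_nonempty(1)])
    show "elem_plus d T \<subseteq> open_simplex T" by (auto simp: elem_plus_def)
    fix x assume "x \<in> elem_plus d T"
    then have "v x - bubble T x *\<^sub>R \<beta> = pp x" "v x - bubble T x *\<^sub>R \<gamma> = r x"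
      using v r by (auto simp: pieces_def)
    then have "pp x - r x = (v x - bubble T x *\<^sub>R \<beta>) - (v x - bubble T x *\<^sub>R \<gamma>)" by (simp only:)
    then show "bubble T x *\<^sub>R (\<gamma> - \<beta>) = pp x - r x" by (simp add: scaleR_right_diff_distrib)
  qed
  then show "\<gamma> = \<beta>" by simp
qed

text \<open>The bubble cancels, so the error of \<open>IhB\<close> is the nodal interpolation error
  of the linear part.\<close>

lemma error_eq: "v x - IhB d T v x = (v x - bubble T x *\<^sub>R \<beta>) - interp T nod x"
proof -
  have "linear_part d T v = (\<lambda>x. v x - bubble T x *\<^sub>R \<beta>)"
    by (auto simp: linear_part_def bubble_part_def bubble_coeff_eq)
  then show ?thesis
    using nodal_interp_linear by (simp add: IhB_def bubble_part_def bubble_coeff_eq)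
qed

lemma error_pieces: "pieces (\<lambda>x. v x - IhB d T v x) (\<lambda>x. pp x - interp T nod x) (\<lambda>x. pm x - interp T nod x)"
  using v unfolding error_eq pieces_def by simp

lemma interp_bubble_estimate:
  assumes m: "m \<in> {0, 1}"
  shows "h powr (1/2) * L2surf (Gam d T) (inner_trace d T (\<lambda>x. v x - IhB d T v x))
      + h ^ m * Hsemi m (open_simplex T) (\<lambda>x. v x - IhB d T v x) \<le> elem_const CARD('n) \<rho> J * h * H"
proof -
  let ?Cg = "grad_bound CARD('n) \<rho> J" and ?E = "1 + real (Suc CARD('n)) * \<rho>"
      and ?sv = "sqrt (unit_ball_vol (real CARD('n)))"
          and ?ss = "sqrt (real (Suc CARD('n)) * surf_const CARD('n))"
  let ?e = "\<lambda>x. v x - IhB d T v x" and ?sg = "sqrt (surf_const CARD('n))"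
  let ?G = "\<lambda>p. \<Sum>z\<in>T. outer (p z - nod z) (bgrad z)"
  have hc: "h * norm c \<le> h * (?Cg * W)" using gradient_control(4) hdiam_pos by (intro mult_left_mono) auto
  have CW: "0 \<le> ?Cg * W" using bounds_nonneg W_nonneg by (intro mult_nonneg_nonneg)
  have surf: "L2surf (Gam d T) (inner_trace d T ?e) \<le> h * (?Cg * W) * ?sg * sqrt (h ^ (CARD('n) - 1))"
  proof (rule L2surf_Gam_le)
    fix x assume "x \<in> Gam d T"
    then have x: "x \<in> convex hull T" "interp T d x = 0" using open_simplex_subset by (auto simp: Gam_def)
    \<comment> \<open>The difference of the pieces is a multiple of
      \<open>nu \<bullet> (x - xs)\<close>, which is 0 on the interface, so the inner trace exists
      there.\<close>
    have eq: "pp x = pm x"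
    proof -
      obtain k where "0 < k" "\<forall>x. interp T d x = k * (nu \<bullet> (x - xs))" using interp_nu by blast
      then have "nu \<bullet> (x - xs) = 0" using x(2) by auto
      then show ?thesis using jump by (metis eq_iff_diff_eq_0 scaleR_zero_left)
    qed
    have "isCont (\<lambda>y. p y - interp T nod y) x" if "P1 p" for p
      by (intro continuous_intros isCont_P1 that P1_interp)
    then have "inner_trace d T ?e x = pm x - interp T nod x"
      using inner_trace_pieces[OF error_pieces _ _ x(1)] x(2) P1_p eq by auto
    then show "norm (inner_trace d T ?e x) \<le> h * (?Cg * W)"
      using interp_error(1)[of Am am x] x(1) hc by simp
  qed (rule mult_nonneg_nonneg[OF less_imp_le[OF hdiam_pos] CW])
  have "h powr (1/2) * L2surf (Gam d T) (inner_trace d T ?e) \<le>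
      h powr (1/2) * (h * (?Cg * W) * ?sg * sqrt (h ^ (CARD('n) - 1)))"
    using surf by (rule mult_left_mono) simp
  also have "\<dots> = (h powr (1/2) * sqrt (h ^ (CARD('n) - 1))) * (h * (?Cg * W) * ?sg)"
      by (simp only: mult_ac)
  also have "\<dots> = (?Cg * 1 * ?sg) * (h * (W * hN))"
      unfolding sqrt_h_powers(2) by (simp only: mult_ac mult_1_left)
  finally have surf': "h powr (1/2) * L2surf (Gam d T) (inner_trace d T ?e) \<le> ?Cg * 1 * ?sg * (h * H)"
    unfolding W_hN .
  have vol0: "L2vol (open_simplex T) ?e \<le> (h * (?Cg * W)) * ?sv * hN"
    by (rule L2vol_pieces_le[OF error_pieces])
      (use interp_error(1)[of Ap ap] interp_error(1)[of Am am] hc in \<open>auto intro: order_trans\<close>)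
  have "pieces (jac ?e) (\<lambda>x. ?G pp) (\<lambda>x. ?G pm)"
    by (rule pieces_jac[OF error_pieces]; rule interp_error(2)) simp_all
  moreover have "real (Suc CARD('n)) * \<rho> * norm c \<le> real (Suc CARD('n)) * \<rho> * (?Cg * W)"
    using gradient_control(4) rho_ge_1 by (intro mult_left_mono) auto
  ultimately have vol1: "L2vol (open_simplex T) (jac ?e)
      \<le> (real (Suc CARD('n)) * \<rho> * (?Cg * W)) * ?sv * hN"
    using interp_error(3)[of Ap ap] interp_error(3)[of Am am]
    by (intro L2vol_pieces_le) (auto intro: order_trans)
  have "h ^ m * Hsemi m (open_simplex T) ?e \<le> (?Cg * ?E * ?sv) * (h * H)"
  proof (cases "m = 0")
    case True
    have "L2vol (open_simplex T) ?e \<le> (?Cg * 1 * ?sv) * (h * (W * hN))"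
      using vol0 by (simp only: mult_ac mult_1_left)
    also have "\<dots> \<le> (?Cg * ?E * ?sv) * (h * (W * hN))"
      using bounds_nonneg s_nonneg hdiam_pos H_nonneg unfolding W_hN
      by (intro mult_right_mono mult_left_mono) auto
    finally show ?thesis unfolding W_hN using True by (simp add: Hsemi_def)
  next
    case False
    then have m1: "m = 1" using m by auto
    have "h * L2vol (open_simplex T) (jac ?e) \<le> h * ((real (Suc CARD('n)) * \<rho> * (?Cg * W)) * ?sv * hN)"
      using vol1 hdiam_pos by (intro mult_left_mono) auto
    also have "\<dots> = (?Cg * (real (Suc CARD('n)) * \<rho>) * ?sv) * (h * (W * hN))" by (simp only: mult_ac)
    also have "\<dots> \<le> (?Cg * ?E * ?sv) * (h * (W * hN))"
      using bounds_nonneg s_nonneg hdiam_pos H_nonneg unfolding W_hN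
      by (intro mult_right_mono mult_left_mono) auto
    finally show ?thesis unfolding W_hN using m1 by (simp add: Hsemi_def)
  qed
  moreover have "?Cg * 1 * ?sg * (h * H) \<le> ?Cg * ?E * ?ss * (h * H)"
    using bounds_nonneg s_nonneg hdiam_pos H_nonneg
    by (intro mult_right_mono mult_mono) (auto intro!: mult_nonneg_nonneg)
  \<comment> \<open>The surface and the volume term consume different summands of the last factor of
    \<open>elem_const\<close>.\<close>
  moreover have "?Cg * ?E * ?ss * (h * H) + ?Cg * ?E * ?sv * (h * H) = (?Cg * ?E * (?sv + ?ss)) * (h * H)"
    by (simp only: distrib_left distrib_right add.commute)
  moreover have "(?Cg * ?E * (?sv + ?ss)) * (h * H) \<le> elem_const CARD('n) \<rho> J * (h * H)"
    by (intro mult_right_mono elem_const_ge)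
      (use bounds_nonneg s_nonneg H_nonneg hdiam_pos in auto)
  ultimately show ?thesis using surf' by (simp only: mult.assoc)
qed

lemma P1_q: "P1 (\<lambda>x. g \<bullet> x + k)"
  unfolding P1_def by (intro exI[of _ "\<lambda>x. g \<bullet> x"] exI[of _ k])
    (auto intro: bounded_linear.linear bounded_linear_inner_right)

lemma ext_jump_eq: "ext_jump d T q x = qp - qm"
proof -
  have "P1_ext (elem_plus d T) q = (\<lambda>x. g \<bullet> x + qp)"
    by (rule P1_ext_eq[OF P1_q open_elem_plus sides_nonempty(1)]) (use q in \<open>auto simp: pieces_def\<close>)
  moreover have "P1_ext (elem_minus d T) q = (\<lambda>x. g \<bullet> x + qm)"
    by (rule P1_ext_eq[OF P1_q open_elem_minus sides_nonempty(2)]) (use q in \<open>auto simp: pieces_def\<close>)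
  ultimately show ?thesis by (simp add: ext_jump_def)
qed

lemma pressure_jump_estimate: "L2surf (Gam d T) (ext_jump d T q)
    \<le> elem_const CARD('n) \<rho> J * h powr (-1/2) * H"
proof -
  let ?Cg = "grad_bound CARD('n) \<rho> J" and ?sg = "sqrt (surf_const CARD('n))"
  have "L2surf (Gam d T) (ext_jump d T q) \<le> (?Cg * W) * ?sg * sqrt (h ^ (CARD('n) - 1))"
    by (rule L2surf_Gam_le) (use gradient_control(5) bounds_nonneg W_nonneg in \<open>auto simp: ext_jump_eq\<close>)
  also have "\<dots> = (?Cg * 1 * ?sg) * (h powr (-1/2) * (W * hN))"
    unfolding sqrt_h_powers by (simp only: mult_ac mult_1_left)
  also have "\<dots> \<le> elem_const CARD('n) \<rho> J * (h powr (-1/2) * (W * hN))"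
  proof (intro mult_right_mono elem_const_ge)
    show "?sg \<le> 1 + sqrt (unit_ball_vol (real CARD('n)))
        + sqrt (real (Suc CARD('n)) * surf_const CARD('n))"
      using s_nonneg(1,4) by linarith
  qed (use bounds_nonneg s_nonneg H_nonneg W_hN in auto)
  finally show ?thesis unfolding W_hN by (simp only: mult.assoc)
qed

lemma pressure_trace_estimate:
  "L2surf (frontier (open_simplex T)) (inner_trace d T q)
    \<le> elem_const CARD('n) \<rho> J * h powr (-1/2) * (L2vol (open_simplex T) q + H)"
proof -
  let ?Cg = "grad_bound CARD('n) \<rho> J" and ?ss = "sqrt (real (Suc CARD('n)) * surf_const CARD('n))"
      and ?Cp = "pressure_bound CARD('n) \<rho>"
  let ?Q = "L2vol (open_simplex T) q"
  have Q: "0 \<le> ?Q" by (rule L2norm_nonneg)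
  have "L2surf (frontier (open_simplex T)) (inner_trace d T q) \<le>
      (?Cp * (?Q / hN) + ?Cg * W) * ?ss * (hN * h powr (-1/2))"
  proof (rule L2surf_frontier_le[OF q isCont_P1[OF P1_q] isCont_P1[OF P1_q]])
    fix x assume "x \<in> convex hull T"
    note * = pressure_control[OF this] gradient_control(5)
    show "norm (g \<bullet> x + qp) \<le> ?Cp * (?Q / hN) + ?Cg * W"
      "norm (g \<bullet> x + qm) \<le> ?Cp * (?Q / hN) + ?Cg * W"
      unfolding real_norm_def using * by linarith+
  qed
  also have "\<dots> = (?Cp * (?Q / hN * hN) + ?Cg * (W * hN)) * ?ss * h powr (-1/2)"
    by (simp only: ring_distribs mult_ac)
  also have "?Q / hN * hN = ?Q" by (rule cancel_hN)
  also have "(?Cp * ?Q + ?Cg * (W * hN)) * ?ss * h powr (-1/2) \<le>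
      ((?Cg + ?Cp) * (?Q + H)) * ?ss * h powr (-1/2)"
    unfolding W_hN using bounds_nonneg s_nonneg H_nonneg Q
    by (intro mult_right_mono) (auto simp: algebra_simps intro!: add_nonneg_nonneg mult_nonneg_nonneg)
  also have "\<dots> = ((?Cg + ?Cp) * 1 * ?ss) * (h powr (-1/2) * (?Q + H))" by (simp only: mult_ac mult_1_left)
  also have "\<dots> \<le> elem_const CARD('n) \<rho> J * (h powr (-1/2) * (?Q + H))"
    by (intro mult_right_mono elem_const_ge)
      (use bounds_nonneg s_nonneg H_nonneg Q in auto)
  finally show ?thesis by (simp only: mult.assoc)
qed

end

section \<open>Faces and interface resolution\<close>

lemma cartesian_mesh_finite:
  fixes \<T> :: "(real^'n) set set"
  assumes "cartesian_mesh a b \<T>"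
  shows "finite \<T>" and "T \<in> \<T> \<Longrightarrow> finite T \<and> card T \<le> Suc CARD('n)"
proof -
  obtain X :: "'n \<Rightarrow> nat \<Rightarrow> real" and m D where
    T: "\<T> = {kuhn_simplex X k D is | k is. (\<forall>i. k i < m i) \<and> distinct is \<and> set is = UNIV}"
    using assms unfolding cartesian_mesh_def by blast
  have "{k::'n \<Rightarrow> nat. \<forall>i. k i < m i} = PiE UNIV (\<lambda>i. {..<m i})" by (auto simp: PiE_def)
  moreover have "finite (PiE (UNIV::'n set) (\<lambda>i. {..<m i}))" by (intro finite_PiE) auto
  ultimately have 1: "finite {k::'n \<Rightarrow> nat. \<forall>i. k i < m i}" by simp
  have "{is::'n list. distinct is \<and> set is = UNIV} \<subseteq> {xs. set xs \<subseteq> UNIV \<and> length xs = CARD('n)}"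
    using distinct_card by fastforce
  moreover have "finite {xs::'n list. set xs \<subseteq> UNIV \<and> length xs = CARD('n)}"
    by (rule finite_lists_length_eq) simp
  ultimately have 2: "finite {is::'n list. distinct is \<and> set is = UNIV}" by (rule finite_subset)
  have "\<T> = (\<lambda>(k, is). kuhn_simplex X k D is) `
      ({k. \<forall>i. k i < m i} \<times> {is. distinct is \<and> set is = UNIV})"
    unfolding T by auto
  then show "finite \<T>" using finite_cartesian_product[OF 1 2] by simp
  show "finite T \<and> card T \<le> Suc CARD('n)" if "T \<in> \<T>"
  proof -
    obtain k "is" where "T = kuhn_simplex X k D is" using \<open>T \<in> \<T>\<close> T by blast
    then show ?thesis
      unfolding kuhn_simplex_def using card_image_le[of "{0..CARD('n)}"] by auto
  qed
qed

text \<open>Whichever partial derivative of a local level-set function is nonzero, such an element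
  has an edge in that direction.\<close>

definition has_axis_edges :: "(real^'n) set \<Rightarrow> bool" where
  "has_axis_edges T \<longleftrightarrow> (\<forall>i. \<exists>y\<in>T. \<exists>s. s \<noteq> 0 \<and> y + s *\<^sub>R axis i 1 \<in> T)"

text \<open>The path through the vertices changes one coordinate at a time. The step at the position
  of \<open>i\<close> in \<open>is\<close> has direction \<open>axis i 1\<close> and nonzero length
  because the grid is strictly increasing.\<close>

lemma cartesian_mesh_axis_edges:
  fixes \<T> :: "(real^'n) set set"
  assumes "cartesian_mesh a b \<T>" "T \<in> \<T>"
  shows "has_axis_edges T"
  unfolding has_axis_edges_def
proof
  fix i :: 'n
  obtain X :: "'n \<Rightarrow> nat \<Rightarrow> real" and m D where
    X: "\<And>i. strict_mono_on {0..m i} (X i)" and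
    T: "\<T> = {kuhn_simplex X k D is | k is. (\<forall>i. k i < m i) \<and> distinct is \<and> set is = UNIV}"
    using assms(1) unfolding cartesian_mesh_def by blast
  obtain k "is" where k: "T = kuhn_simplex X k D is" "\<forall>i. k i < m i" "distinct is" "set is = UNIV"
    using assms(2) T by blast
  have len: "length is = CARD('n)" using distinct_card[OF k(3)] k(4) by simp
  obtain j where j: "j < length is" "is ! j = i" using k(4) by (metis UNIV_I in_set_conv_nth)
  define v where "v j = (\<chi> i. X i (if (i \<in> set (take j is)) \<noteq> (i \<in> D) then Suc (k i) else k i))" for j
  have vT: "v l \<in> T" if "l \<le> CARD('n)" for l
    unfolding k(1) kuhn_simplex_def v_def using that by auto
  have tk: "set (take (Suc j) is) = insert i (set (take j is))"
    using j by (simp add: take_Suc_conv_app_nth)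
  have nin: "i \<notin> set (take j is)"
    using j k(3) by (metis distinct_take not_distinct_conv_prefix take_Suc_conv_app_nth)
  define s where "s = v (Suc j) $ i - v j $ i"
  have "v (Suc j) = v j + s *\<^sub>R axis i 1"
    by (auto simp: vec_eq_iff v_def s_def tk axis_def)
  moreover have "s \<noteq> 0"
  proof -
    have "X i (k i) < X i (Suc (k i))"
      using X[of i] k(2) by (intro strict_mono_onD[of "{0..m i}"
          "X i"]) (auto simp: Suc_le_eq less_imp_le)
    then show ?thesis using nin by (auto simp: s_def v_def tk)
  qed
  ultimately show "\<exists>y\<in>T. \<exists>s. s \<noteq> 0 \<and> y + s *\<^sub>R axis i 1 \<in> T"
    using vT[of j] vT[of "Suc j"] j len by (metis Suc_leI less_imp_le)
qed

text \<open>If both ends of an edge of direction \<open>e\<^sub>i\<close> lie on a level set, the \<open>i\<close>-th partial derivative vanishes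
  somewhere in between; for a small element with all vertices on \<open>\<Gamma>\<close> this contradicts the nonzero gradient.\<close>

lemma vertices_off_hypersurface:
  fixes \<Gamma> :: "(real^'n) set"
  assumes "compact \<Gamma>" "C2_hypersurface \<Gamma>"
  shows "\<exists>e>0. \<forall>T. has_axis_edges T \<longrightarrow> (\<forall>x\<in>T. \<forall>y\<in>T. dist x y < e) \<longrightarrow> (\<exists>z\<in>T. z \<notin> \<Gamma>)"
proof -
  have local: "\<exists>r>0. \<forall>T. has_axis_edges T \<longrightarrow> T \<subseteq> ball x r \<longrightarrow> (\<exists>z\<in>T. z \<notin> \<Gamma>)" if x: "x \<in> \<Gamma>" for x
  proof -
    have "\<exists>U (\<phi> :: real^'n \<Rightarrow> real) g H. open U \<and> x \<in> U \<and>
        (\<forall>y\<in>U. (\<phi> has_derivative (\<lambda>h. g y \<bullet> h)) (at y)) \<and>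
        (\<forall>y\<in>U. (g has_derivative (\<lambda>h. H y *v h)) (at y)) \<and>
        continuous_on U H \<and> (\<forall>y\<in>U. g y \<noteq> 0) \<and> \<Gamma> \<inter> U = {y\<in>U. \<phi> y = 0}"
      using assms(2) x unfolding C2_hypersurface_def by blast
    then obtain U and \<phi> :: "real^'n \<Rightarrow> real" and g
        and H :: "real^'n \<Rightarrow> real^'n^'n" where U: "open U" "x \<in> U"
      and phi: "\<And>y. y \<in> U \<Longrightarrow> (\<phi> has_derivative (\<lambda>h. g y \<bullet> h)) (at y)"
      and g: "\<And>y. y \<in> U \<Longrightarrow> (g has_derivative (\<lambda>h. H y *v h)) (at y)"
      and g0: "\<And>y. y \<in> U \<Longrightarrow> g y \<noteq> 0" and level: "\<Gamma> \<inter> U = {y\<in>U. \<phi> y = 0}" by blast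
    obtain i where i: "g x $ i \<noteq> 0" using g0[OF U(2)] by (auto simp: vec_eq_iff)
    have "continuous_on U g"
      by (rule has_derivative_continuous_on, rule has_derivative_at_withinI, erule g)
    then have "continuous_on U (\<lambda>y. g y $ i)" by (intro continuous_intros)
    then have "open (U \<inter> (\<lambda>y. g y $ i) -` (- {0}))"
      using continuous_open_preimage[OF _ U(1), of "\<lambda>y. g y $ i" "- {0}"] by auto
    moreover have "x \<in> U \<inter> (\<lambda>y. g y $ i) -` (- {0})" using i U by simp
    ultimately obtain r where r: "0 < r" "ball x r \<subseteq> U \<inter> (\<lambda>y. g y $ i) -` (- {0})"
      by (meson openE)
    have "\<exists>z\<in>T. z \<notin> \<Gamma>" if T: "has_axis_edges T" "T \<subseteq> ball x r" for T
    proof (rule ccontr)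
      assume "\<not> ?thesis"
      then have TG: "T \<subseteq> \<Gamma>" by blast
      obtain y s where y: "y \<in> T" "s \<noteq> 0" "y + s *\<^sub>R axis i 1 \<in> T"
        using T(1) unfolding has_axis_edges_def by blast
      let ?e = "axis i 1 :: real^'n"
      have seg: "y + t *\<^sub>R (s *\<^sub>R ?e) \<in> ball x r" if "0 \<le> t" "t \<le> 1" for t
      proof -
        have "y + t *\<^sub>R (s *\<^sub>R ?e) = (1 - t) *\<^sub>R y + t *\<^sub>R (y + s *\<^sub>R ?e)"
          by (simp add: algebra_simps)
        also have "\<dots> \<in> ball x r"
          using y T(2) that by (intro convexD_alt[OF convex_ball]) auto
        finally show ?thesis .
      qed
      define f where "f t = \<phi> (y + t *\<^sub>R (s *\<^sub>R ?e))" for t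
      have der: "(f has_derivative (\<lambda>h. g (y + t *\<^sub>R (s *\<^sub>R ?e)) \<bullet> (h *\<^sub>R (s *\<^sub>R ?e)))) (at t)"
        if "0 \<le> t" "t \<le> 1" for t
      proof -
        have in_U: "y + t *\<^sub>R (s *\<^sub>R ?e) \<in> U" using seg[OF that] r(2) by blast
        have "((\<lambda>t. y + t *\<^sub>R (s *\<^sub>R ?e)) has_derivative (\<lambda>h. h *\<^sub>R (s *\<^sub>R ?e))) (at t)"
          by (auto intro!: derivative_eq_intros)
        from has_derivative_compose[OF this phi[OF in_U]] show ?thesis unfolding f_def .
      qed
      have ends: "f 0 = 0" "f 1 = 0"
      proof -
        have "y \<in> \<Gamma> \<inter> U" "y + s *\<^sub>R ?e \<in> \<Gamma> \<inter> U" using y TG T(2) r(2) by blast+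
        then show "f 0 = 0" "f 1 = 0" unfolding level by (auto simp: f_def)
      qed
      have "\<exists>t\<in>{0<..<1}. f 1 - f 0 = g (y + t *\<^sub>R (s *\<^sub>R ?e)) \<bullet> ((1 - 0) *\<^sub>R (s *\<^sub>R ?e))"
        by (rule mvt_simple[of 0 1 f "\<lambda>t h. g (y + t *\<^sub>R (s *\<^sub>R ?e)) \<bullet> (h *\<^sub>R (s *\<^sub>R ?e))"])
          (simp, rule has_derivative_at_withinI, erule (1) der)
      then obtain t where t: "0 < t" "t < 1" "g (y + t *\<^sub>R (s *\<^sub>R ?e)) \<bullet> (s *\<^sub>R ?e) = 0"
        using ends by auto
      then have "g (y + t *\<^sub>R (s *\<^sub>R ?e)) $ i = 0" using y(2) by (simp add: inner_axis)
      moreover have "y + t *\<^sub>R (s *\<^sub>R ?e) \<in> ball x r" using seg t by simp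
      ultimately show False using r(2) by auto
    qed
    then show ?thesis using r(1) by blast
  qed
  \<comment> \<open>Balls with the local property cover the compact \<Gamma>; a Lebesgue number of
    this cover is the uniform \<open>e\<close>.\<close>
  define \<G> where "\<G> = {ball x r | x r. \<forall>T. has_axis_edges T \<longrightarrow> T \<subseteq> ball x r \<longrightarrow> (\<exists>z\<in>T. z \<notin> \<Gamma>)}"
  have cover: "\<Gamma> \<subseteq> \<Union>\<G>"
  proof
    fix x assume "x \<in> \<Gamma>"
    then obtain r where "0 < r" "\<forall>T. has_axis_edges T \<longrightarrow> T \<subseteq> ball x r \<longrightarrow> (\<exists>z\<in>T. z \<notin> \<Gamma>)"
      using local by blast
    then have "ball x r \<in> \<G>" "x \<in> ball x r" by (auto simp: \<G>_def)
    then show "x \<in> \<Union>\<G>" by blast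
  qed
  have op: "open G" if "G \<in> \<G>" for G using that by (auto simp: \<G>_def)
  have "\<exists>e>0. \<forall>x\<in>\<Gamma>. \<exists>G\<in>\<G>. ball x e \<subseteq> G"
    by (rule Heine_Borel_lemma[OF assms(1) cover op]) blast+
  then obtain e where e: "0 < e" "\<And>x. x \<in> \<Gamma> \<Longrightarrow> \<exists>G\<in>\<G>. ball x e \<subseteq> G" by blast
  show ?thesis
  proof (intro exI[of _ e] conjI allI impI e(1))
    fix T :: "(real^'n) set"
    assume T: "has_axis_edges T" "\<forall>x\<in>T. \<forall>y\<in>T. dist x y < e"
    obtain y where y: "y \<in> T" using T(1) unfolding has_axis_edges_def by blast
    show "\<exists>z\<in>T. z \<notin> \<Gamma>"
    proof (cases "y \<in> \<Gamma>")
      case True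
      then obtain x r where "ball y e \<subseteq> ball x r"
          "\<forall>T. has_axis_edges T \<longrightarrow> T \<subseteq> ball x r \<longrightarrow> (\<exists>z\<in>T. z \<notin> \<Gamma>)"
        using e(2) unfolding \<G>_def by blast
      moreover have "T \<subseteq> ball y e" using T(2) y by auto
      ultimately show ?thesis using T(1) by blast
    qed (use y in blast)
  qed
qed

text \<open>\<open>infdist\<close> to the empty set is 0, so \<Gamma> has to be seen to be nonempty:
  it is the frontier of a nonempty bounded set. As it is closed, distance 0 means
  membership.\<close>

lemma signed_dist_zero_iff:
  fixes \<Gamma> :: "(real^'n) set"
  assumes "C2_interface (box a b) \<Gamma> \<Omega>m"
  shows "signed_dist \<Omega>m \<Gamma> x = 0 \<longleftrightarrow> x \<in> \<Gamma>"
proof -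
  have "\<Omega>m \<noteq> {}" "bounded \<Omega>m" "frontier \<Omega>m = \<Gamma>" "compact \<Gamma>"
    using assms bounded_subset[OF bounded_box] by (auto simp: C2_interface_def)
  then have "\<Gamma> \<noteq> {}" "closed \<Gamma>"
    using frontier_eq_empty[of \<Omega>m] not_bounded_UNIV compact_imp_closed by auto
  then show ?thesis using in_closed_iff_infdist_zero by (auto simp: signed_dist_def)
qed

text \<open>A condition on a single element, so that the two neighbours of a face can be treated
  separately, each cut or uncut. The nodal values are those from T itself; \<open>Z\<close> absorbs
  the part of \<Gamma>_h on the face.\<close>

definition face_close ::
  "(real^'n \<Rightarrow> real) \<Rightarrow> (real^'n) set \<Rightarrow> (real^'n) set \<Rightarrow> (real^'n \<Rightarrow> 'b::real_normed_vector) \<Rightarrow> real \<Rightarrow> bool" where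
  "face_close d T F f B \<longleftrightarrow> (\<exists>Z. hausdorff_outer (CARD('n) - 1) Z = 0 \<and>
     (\<forall>x\<in>open_simplex F - Z. \<forall>u. (\<forall>w\<in>F. 0 \<le> u w) \<and> sum u F = 1 \<and> (\<Sum>w\<in>F. u w *\<^sub>R w) = x \<longrightarrow>
        norm (inner_trace d T f x - (\<Sum>w\<in>F. u w *\<^sub>R nodal_value d T f w)) \<le> B))"

lemma face_jump_le:
  fixes f :: "real^'n \<Rightarrow> 'b::real_normed_vector"
  assumes N: "CARD('n) \<ge> 2" and T1: "regular_simplex T1 \<rho>" "z \<in> T1" "F = T1 - {z}"
    and close: "face_close d T1 F f B1" "face_close d T2 F f B2"
    and nodal: "\<And>w. w \<in> F \<Longrightarrow> nodal_value d T1 f w = nodal_value d T2 f w"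
    and B: "0 \<le> B1 + B2"
  shows "L2surf (open_simplex F) (face_jump d T1 T2 f) \<le>
    (B1 + B2) * sqrt (surf_const CARD('n) * hdiam F ^ (CARD('n) - 1))"
proof -
  interpret regular_simplex T1 \<rho> by (rule T1)
  obtain Z1 where Z1: "hausdorff_outer (CARD('n) - 1) Z1 = 0"
    "\<forall>x\<in>open_simplex F - Z1. \<forall>u. (\<forall>w\<in>F. 0 \<le> u w) \<and> sum u F = 1 \<and> (\<Sum>w\<in>F. u w *\<^sub>R w) = x \<longrightarrow>
      norm (inner_trace d T1 f x - (\<Sum>w\<in>F. u w *\<^sub>R nodal_value d T1 f w)) \<le> B1"
    using close(1) unfolding face_close_def by (elim exE conjE)
  obtain Z2 where Z2: "hausdorff_outer (CARD('n) - 1) Z2 = 0"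
    "\<forall>x\<in>open_simplex F - Z2. \<forall>u. (\<forall>w\<in>F. 0 \<le> u w) \<and> sum u F = 1 \<and> (\<Sum>w\<in>F. u w *\<^sub>R w) = x \<longrightarrow>
      norm (inner_trace d T2 f x - (\<Sum>w\<in>F. u w *\<^sub>R nodal_value d T2 f w)) \<le> B2"
    using close(2) unfolding face_close_def by (elim exE conjE)
  have "hausdorff_outer (CARD('n) - 1) (Z1 \<union> Z2) \<le> 0 + 0"
    using hausdorff_outer_Un_le[of "CARD('n) - 1" Z1 Z2] N Z1(1) Z2(1) by simp
  then have Z: "hausdorff_outer (CARD('n) - 1) (Z1 \<union> Z2) = 0" by simp
  show ?thesis
  proof (rule L2surf_le[OF N _ Z _ B])
    show "hausdorff_outer (CARD('n) - 1) (open_simplex F)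
        \<le> ennreal (surf_const CARD('n) * hdiam F ^ (CARD('n) - 1))"
      unfolding T1(3) by (rule face_measure[OF N T1(2)])
    have "bounded (open_simplex F)"
      using open_simplex_face[OF T1(2)] unfolding T1(3) by (intro bounded_subset[OF bounded_hull]) blast
    then have "0 \<le> hdiam F" unfolding hdiam_def by (rule diameter_ge_0)
    then show "0 \<le> surf_const CARD('n) * hdiam F ^ (CARD('n) - 1)"
      using surf_const_nonneg by simp
    fix x assume x: "x \<in> open_simplex F" "x \<notin> Z1 \<union> Z2"
    obtain u where u: "\<And>w. w \<in> F \<Longrightarrow> 0 < u w" "sum u F = 1" "(\<Sum>w\<in>F. u w *\<^sub>R w) = x"
      unfolding T1(3) by (rule open_simplex_face[OF T1(2) x(1)[unfolded T1(3)]]) blast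
    have u0: "\<And>w. w \<in> F \<Longrightarrow> 0 \<le> u w" using u(1) by (rule less_imp_le)
    let ?I = "\<lambda>T. \<Sum>w\<in>F. u w *\<^sub>R nodal_value d T f w"
    have "?I T1 = ?I T2" using nodal by (intro sum.cong) auto
    then have "face_jump d T1 T2 f x = (inner_trace d T1 f x - ?I T1) - (inner_trace d T2 f x - ?I T2)"
      by (simp add: face_jump_def)
    also have "norm \<dots> \<le> norm (inner_trace d T1 f x - ?I T1) + norm (inner_trace d T2 f x - ?I T2)"
      by (rule norm_triangle_ineq4)
    also have "\<dots> \<le> B1 + B2"
      using Z1(2)[THEN bspec, of x, THEN spec, of u] Z2(2)[THEN bspec, of x, THEN spec, of u] x u0 u(2,3)
      by (intro add_mono) simp_all
    finally show "norm (face_jump d T1 T2 f x) \<le> B1 + B2" .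
  qed
qed

context resolved_simplex
begin

text \<open>One affine function serves as both pieces, whatever the sign of
  \<open>interp T d\<close>, so the deviation is 0.\<close>

lemma face_close_uncut:
  fixes f :: "real^'n \<Rightarrow> 'b::real_normed_vector"
  assumes N: "CARD('n) \<ge> 2" and f: "P1_on (open_simplex T) (\<lambda>x. f x - bubble T x *\<^sub>R \<gamma>)" and z: "z \<in> T"
  shows "face_close d T (T - {z}) f 0"
proof -
  obtain p where p: "P1 p" "\<And>x. x \<in> open_simplex T \<Longrightarrow> f x - bubble T x *\<^sub>R \<gamma> = p x"
    using f unfolding P1_on_def by blast
  have "f x = p x + bubble T x *\<^sub>R \<gamma>" if "x \<in> open_simplex T" for x
    using p(2)[OF that] by (metis diff_add_cancel)
  then have pieces: "pieces f (\<lambda>x. p x + bubble T x *\<^sub>R \<gamma>) (\<lambda>x. p x + bubble T x *\<^sub>R \<gamma>)"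
    by (auto simp: pieces_def elem_plus_def elem_minus_def)
  show ?thesis
    unfolding face_close_def
    using face_trace[OF pieces p(1) p(1), of 0 z] z N
    by (intro exI[of _ "{}"]) (auto simp: hausdorff_outer_empty)
qed

end

context ife_pair
begin

lemma face_close_cut:
  fixes f :: "real^'n \<Rightarrow> 'b::real_normed_vector"
  assumes f: "pieces f (\<lambda>x. rp x + bubble T x *\<^sub>R \<gamma>) (\<lambda>x. rm x + bubble T x *\<^sub>R \<gamma>)"
    and r: "P1 rp" "P1 rm" and B: "\<And>w. w \<in> T \<Longrightarrow> norm (rp w - rm w) \<le> B" and z: "z \<in> T"
  shows "face_close d T (T - {z}) f B"
  unfolding face_close_def
proof (intro exI conjI ballI allI impI)
  show "hausdorff_outer (CARD('n) - 1) {x\<in>convex hull T. bary T z x = 0 \<and> interp T d x = 0} = 0"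
    by (rule facet_Gam_null[OF dim_ge_2 z])
  fix x u
  assume x: "x \<in> open_simplex (T - {z}) - {x\<in>convex hull T. bary T z x = 0 \<and> interp T d x = 0}"
    and u: "(\<forall>w\<in>T - {z}. 0 \<le> u w) \<and> sum u (T - {z}) = 1 \<and> (\<Sum>w\<in>T - {z}. u w *\<^sub>R w) = x"
  have "x \<in> convex hull T" "bary T z x = 0" using open_simplex_face[OF z] x by blast+
  then have "interp T d x \<noteq> 0" using x by blast
  then show "norm (inner_trace d T f x - (\<Sum>w\<in>T - {z}. u w *\<^sub>R nodal_value d T f w)) \<le> B"
    using face_trace[OF f r B _ z, of u x] sides_nonempty x u by blast
qed

lemma face_close_cut_v: "z \<in> T \<Longrightarrow> face_close d T (T - {z}) v (h * (grad_bound CARD('n) \<rho> J * W))"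
proof (rule face_close_cut[OF v_pieces P1_p])
  fix w assume "w \<in> T"
  then have "norm (pp w - pm w) \<le> h * norm c" by (intro pp_minus_pm T_subset_hull)
  also have "\<dots> \<le> h * (grad_bound CARD('n) \<rho> J * W)"
    using gradient_control(4) hdiam_pos by (intro mult_left_mono) auto
  finally show "norm (pp w - pm w) \<le> h * (grad_bound CARD('n) \<rho> J * W)" .
qed

lemma face_close_cut_q: "z \<in> T \<Longrightarrow> face_close d T (T - {z}) q (grad_bound CARD('n) \<rho> J * W)"
  by (rule face_close_cut[of q "\<lambda>x. g \<bullet> x + qp" 0 "\<lambda>x. g \<bullet> x + qm", OF _ P1_q P1_q])
    (use q gradient_control(5) in auto)

lemma W_square: "(grad_bound CARD('n) \<rho> J * W)\<^sup>2 * h ^ CARD('n) = (grad_bound CARD('n) \<rho> J)\<^sup>2 * H\<^sup>2"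
proof -
  have "h ^ CARD('n) = hN\<^sup>2" using hdiam_pos by simp
  then have "(grad_bound CARD('n) \<rho> J * W)\<^sup>2 * h ^ CARD('n) = (grad_bound CARD('n) \<rho> J * (W * hN))\<^sup>2"
    by (simp only: power_mult_distrib mult_ac)
  then show ?thesis unfolding W_hN by (simp only: power_mult_distrib)
qed

end

lemma sum_square_le: "(x + y)\<^sup>2 \<le> 2 * (x\<^sup>2 + y\<^sup>2)" for x y :: real
  using zero_le_power2[of "x - y"] by (simp add: power2_eq_square algebra_simps)

text \<open>With \<open>k1\<close>, \<open>k2\<close> as gradient sizes, the powers are
  \<open>hF * hF ^ (N - 1) = hF ^ N <= h1 ^ N\<close> for the pressure and
  \<open>h1 ^ 2 * hF ^ (N - 2) <= h1 ^ N\<close> for the velocity; the latter is why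
  \<open>2 <= N\<close>. The 4 is a 2 from \<open>sum_square_le\<close> times 2 for the two
  terms.\<close>

lemma face_jump_scaling:
  fixes hF h1 h2 k1 k2 :: real
  assumes h: "0 \<le> hF" "hF \<le> h1" "hF \<le> h2" and N: "2 \<le> N" and K: "0 \<le> K"
    and k: "0 \<le> k1" "0 \<le> k2" "k1\<^sup>2 * h1 ^ N \<le> G * s1" "k2\<^sup>2 * h2 ^ N \<le> G * s2"
    and Lq: "0 \<le> Lq" "Lq \<le> (k1 + k2) * sqrt (K * hF ^ (N - 1))"
    and Lv: "0 \<le> Lv" "Lv \<le> (h1 * k1 + h2 * k2) * sqrt (K * hF ^ (N - 1))"
  shows "hF * Lq\<^sup>2 + inverse hF * Lv\<^sup>2 \<le> 4 * K * G * (s1 + s2)"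
proof -
  obtain m where m: "N = Suc (Suc m)" using N by (metis Suc_le_D numeral_2_eq_2 Suc_le_mono)
  have KF: "0 \<le> K * hF ^ Suc m" using K h by simp
  have sq: "L\<^sup>2 \<le> 2 * (x\<^sup>2 + y\<^sup>2) * (K * hF ^ Suc m)"
      if "0 \<le> L" "L \<le> (x + y) * sqrt (K * hF ^ (N - 1))" for L x y
  proof -
    have "L\<^sup>2 \<le> ((x + y) * sqrt (K * hF ^ (N - 1)))\<^sup>2" using that by (intro power_mono) auto
    also have "\<dots> = (x + y)\<^sup>2 * (K * hF ^ Suc m)" using KF m by (simp add: power_mult_distrib)
    also have "\<dots> \<le> 2 * (x\<^sup>2 + y\<^sup>2) * (K * hF ^ Suc m)" using KF by (intro mult_right_mono sum_square_le)
    finally show ?thesis .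
  qed
  have "hF * Lq\<^sup>2 \<le> hF * (2 * (k1\<^sup>2 + k2\<^sup>2) * (K * hF ^ Suc m))"
    using sq[OF Lq] h by (intro mult_left_mono) auto
  also have "\<dots> = 2 * K * (k1\<^sup>2 * hF ^ N + k2\<^sup>2 * hF ^ N)" unfolding m by (simp add: algebra_simps)
  also have "\<dots> \<le> 2 * K * (k1\<^sup>2 * h1 ^ N + k2\<^sup>2 * h2 ^ N)"
    using h K by (intro mult_left_mono add_mono power_mono) auto
  also have "\<dots> \<le> 2 * K * (G * s1 + G * s2)" using k K by (intro mult_left_mono add_mono) auto
  finally have 1: "hF * Lq\<^sup>2 \<le> 2 * K * (G * s1 + G * s2)" .
  \<comment> \<open>Only an inequality, because \<open>hF = 0\<close> is allowed here and
    \<open>inverse 0 = 0\<close>.\<close>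
  have le: "inverse hF * hF ^ Suc m \<le> hF ^ m" using h(1) by (cases "hF = 0") auto
  have "inverse hF * Lv\<^sup>2 \<le> inverse hF * (2 * ((h1 * k1)\<^sup>2 + (h2 * k2)\<^sup>2) * (K * hF ^ Suc m))"
    using sq[OF Lv] h by (intro mult_left_mono) auto
  also have "\<dots> = 2 * K * ((h1 * k1)\<^sup>2 + (h2 * k2)\<^sup>2) * (inverse hF * hF ^ Suc m)" by (simp only: mult_ac)
  also have "\<dots> \<le> 2 * K * ((h1 * k1)\<^sup>2 + (h2 * k2)\<^sup>2) * hF ^ m" using le K by (intro mult_left_mono) auto
  also have "\<dots> = 2 * K * ((h1 * k1)\<^sup>2 * hF ^ m + (h2 * k2)\<^sup>2 * hF ^ m)" by (simp add: algebra_simps)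
  also have "\<dots> \<le> 2 * K * ((h1 * k1)\<^sup>2 * h1 ^ m + (h2 * k2)\<^sup>2 * h2 ^ m)"
    using h K by (intro mult_left_mono add_mono power_mono) auto
  also have "\<dots> = 2 * K * (k1\<^sup>2 * h1 ^ N + k2\<^sup>2 * h2 ^ N)"
    unfolding m by (simp add: power2_eq_square algebra_simps)
  also have "\<dots> \<le> 2 * K * (G * s1 + G * s2)" using k K by (intro mult_left_mono add_mono) auto
  finally have 2: "inverse hF * Lv\<^sup>2 \<le> 2 * K * (G * s1 + G * s2)" .
  show ?thesis using add_mono[OF 1 2] by (simp add: algebra_simps)
qed

section \<open>Estimates on the mesh\<close>

lemma jump_const_nonneg: "0 < \<mu>p \<Longrightarrow> 0 < \<mu>m \<Longrightarrow> 0 \<le> jump_const \<mu>p \<mu>m"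
  by (auto simp: jump_const_def intro!: mult_nonneg_nonneg add_nonneg_nonneg)

definition element_bounds ::
  "(real^'n \<Rightarrow> real) \<Rightarrow> real \<Rightarrow> (real^'n) set \<Rightarrow> (real^'n \<Rightarrow> real^'n) \<Rightarrow> (real^'n \<Rightarrow> real) \<Rightarrow> bool" where
  "element_bounds d C T v q \<longleftrightarrow>
    L2surf (frontier (open_simplex T)) (inner_trace d T (jac v))
      \<le> C * hdiam T powr (-1/2) * Hsemi 1 (open_simplex T) v \<and>
    Hsemi 1 (open_simplex T) v
      \<le> C * inverse (hdiam T) * L2vol (open_simplex T) v \<and>
    Hsemi 1 (open_simplex T) (nodal_interp d T v)
      \<le> C * Hsemi 1 (open_simplex T) v \<and>
    (\<forall>m\<in>{0, 1}.
      hdiam T powr (1/2) * L2surf (Gam d T) (inner_trace d T (\<lambda>x. v x - IhB d T v x))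
        + hdiam T ^ m * Hsemi m (open_simplex T) (\<lambda>x. v x - IhB d T v x)
      \<le> C * hdiam T * Hsemi 1 (open_simplex T) v) \<and>
    L2surf (Gam d T) (ext_jump d T q)
      \<le> C * hdiam T powr (-1/2) * Hsemi 1 (open_simplex T) v \<and>
    L2surf (frontier (open_simplex T)) (inner_trace d T q)
      \<le> C * hdiam T powr (-1/2) *
          (L2vol (open_simplex T) q + Hsemi 1 (open_simplex T) v)"

definition face_bounds ::
  "(real^'n \<Rightarrow> real) \<Rightarrow> real \<Rightarrow> (real^'n) set set \<Rightarrow> (real^'n) set \<Rightarrow> (real^'n) set \<Rightarrow> (real^'n) set \<Rightarrow>
    (real^'n \<Rightarrow> real^'n) \<Rightarrow> (real^'n \<Rightarrow> real) \<Rightarrow> bool" where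
  "face_bounds d C \<T> F T1 T2 v q \<longleftrightarrow>
    hdiam F * (L2surf (open_simplex F) (face_jump d T1 T2 q))\<^sup>2
      + inverse (hdiam F) * (L2surf (open_simplex F) (face_jump d T1 T2 v))\<^sup>2
    \<le> C * (\<Sum>T'\<in>face_elems \<T> F. (Hsemi 1 (open_simplex T') v)\<^sup>2)"

definition face_const :: "nat \<Rightarrow> real \<Rightarrow> real \<Rightarrow> real" where
  "face_const N \<rho> J = 4 * surf_const N * (grad_bound N \<rho> J)\<^sup>2"

lemma face_const_nonneg: "0 \<le> face_const N \<rho> J"
  by (simp add: face_const_def surf_const_nonneg)

context cut_simplex
begin

lemma ex_ife_pair:
  assumes "CARD('n) \<ge> 2" "0 < \<mu>p" "0 < \<mu>m"
    and "((\<lambda>x. v x - bubble T x *\<^sub>R \<beta>), q) \<in> IFE_local d \<mu>p \<mu>m xs T"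
  shows "\<exists>Ap Am ap am c g qp qm. ife_pair T \<rho> d xs v q \<beta> Ap Am ap am c g qp qm (jump_const \<mu>p \<mu>m)"
proof (rule IFE_local_structure[OF assms(4,2,3)])
  fix Ap Am ap am c g qp qm
  assume *: "pieces (\<lambda>x. v x - bubble T x *\<^sub>R \<beta>) (\<lambda>x. Ap *v x + ap) (\<lambda>x. Am *v x + am)"
    "pieces q (\<lambda>x. g \<bullet> x + qp) (\<lambda>x. g \<bullet> x + qm)"
    "\<forall>x. (Ap *v x + ap) - (Am *v x + am) = (nu \<bullet> (x - xs)) *\<^sub>R c" "Ap - Am = outer c nu"
    "\<bar>qp - qm\<bar> \<le> jump_const \<mu>p \<mu>m * norm Ap" "\<bar>qp - qm\<bar> \<le> jump_const \<mu>p \<mu>m * norm Am"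
    "norm c \<le> jump_const \<mu>p \<mu>m * norm Ap" "norm c \<le> jump_const \<mu>p \<mu>m * norm Am"
  have "ife_pair T \<rho> d xs v q \<beta> Ap Am ap am c g qp qm (jump_const \<mu>p \<mu>m)"
    by unfold_locales (fact assms(1) * jump_const_nonneg[OF assms(2,3)])+
  then show ?thesis by blast
qed

lemma element_estimates:
  assumes "CARD('n) \<ge> 2" "0 < \<mu>p" "0 < \<mu>m"
    and "((\<lambda>x. v x - bubble T x *\<^sub>R \<beta>), q) \<in> IFE_local d \<mu>p \<mu>m xs T"
    and C: "elem_const CARD('n) \<rho> (jump_const \<mu>p \<mu>m) \<le> C"
  shows "element_bounds d C T v q"
proof -
  obtain Ap Am ap am c g qp qm where
    "ife_pair T \<rho> d xs v q \<beta> Ap Am ap am c g qp qm (jump_const \<mu>p \<mu>m)"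
    using ex_ife_pair[OF assms(1-4)] by blast
  then interpret I: ife_pair T \<rho> d xs v q \<beta> Ap Am ap am c g qp qm "jump_const \<mu>p \<mu>m" .
  have mono: "x \<le> C * y * w"
    if "x \<le> elem_const CARD('n) \<rho> (jump_const \<mu>p \<mu>m) * y * w" "0 \<le> y" "0 \<le> w" for x y w
    using that(1) mult_right_mono[OF mult_right_mono[OF C that(2)] that(3)] by linarith
  have mono1: "x \<le> C * w"
    if "x \<le> elem_const CARD('n) \<rho> (jump_const \<mu>p \<mu>m) * w" "0 \<le> w" for x w
    using that(1) mult_right_mono[OF C that(2)] by linarith
  have Q: "0 \<le> L2vol (open_simplex T) q" "0 \<le> L2vol (open_simplex T) v" by (rule L2norm_nonneg)+
  have h: "0 \<le> hdiam T" "0 \<le> inverse (hdiam T)" using hdiam_pos by auto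
  show ?thesis
    unfolding element_bounds_def
    by (intro conjI ballI mono[OF I.trace_jac_estimate] mono[OF I.inverse_estimate]
        mono1[OF I.interp_stability] mono[OF I.interp_bubble_estimate] mono[OF I.pressure_jump_estimate]
        mono[OF I.pressure_trace_estimate] add_nonneg_nonneg powr_ge_zero I.H_nonneg Q h)
qed

end

text \<open>The witness is \<open>grad_bound * W\<close> on a cut element and 0 on an uncut one. It
  serves both pressure and velocity, whose deviations differ by the length \<open>hdiam T\<close>;
  the last bound is \<open>W_square\<close>.\<close>

lemma ex_face_bound:
  fixes T :: "(real^'n) set"
  assumes N: "CARD('n) \<ge> 2" "0 < \<mu>p" "0 < \<mu>m" and T: "resolved_simplex T \<rho> d" and F: "z \<in> T"
    and cut: "T \<in> cut_by \<Gamma> \<T> \<Longrightarrow> xs T \<in> Gam d T" and "T \<in> \<T>"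
    and VQ: "(v, q) \<in> VQ_space d \<Gamma> \<mu>p \<mu>m xs \<T>"
  shows "\<exists>\<kappa>\<ge>0. face_close d T (T - {z}) q \<kappa> \<and> face_close d T (T - {z}) v (hdiam T * \<kappa>) \<and>
    \<kappa>\<^sup>2 * hdiam T ^ CARD('n) \<le> (grad_bound CARD('n) \<rho> (jump_const \<mu>p \<mu>m))\<^sup>2 * (Hsemi 1 (open_simplex T) v)\<^sup>2"
proof -
  interpret resolved_simplex T \<rho> d by (rule T)
  show ?thesis
  proof (cases "T \<in> cut_by \<Gamma> \<T>")
    case True
    interpret cut_simplex T \<rho> d "xs T" using cut[OF True] by unfold_locales
    obtain \<beta> where "((\<lambda>x. v x - bubble T x *\<^sub>R \<beta>), q) \<in> IFE_local d \<mu>p \<mu>m (xs T) T"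
      using VQ True unfolding VQ_space_def by blast
    from ex_ife_pair[OF N this] obtain Ap Am ap am c g qp qm where
      "ife_pair T \<rho> d (xs T) v q \<beta> Ap Am ap am c g qp qm (jump_const \<mu>p \<mu>m)" by blast
    then interpret I: ife_pair T \<rho> d "xs T" v q \<beta> Ap Am ap am c g qp qm "jump_const \<mu>p \<mu>m" .
    show ?thesis
      using I.face_close_cut_q[OF F] I.face_close_cut_v[OF F] I.W_square I.bounds_nonneg(1) I.W_nonneg
      by (intro exI[of _ "grad_bound CARD('n) \<rho> (jump_const \<mu>p \<mu>m) * (Hsemi 1 (open_simplex T) v / sqrt (hdiam T ^ CARD('n)))"]
          conjI mult_nonneg_nonneg) (simp_all only: order_refl)
  next
    case False
    then obtain \<beta> where "P1_on (open_simplex T) (\<lambda>x. v x - bubble T x *\<^sub>R \<beta>)" "P1_on (open_simplex T) q"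
      using VQ \<open>T \<in> \<T>\<close> unfolding VQ_space_def by blast
    \<comment> \<open>The pressure has no bubble part, hence the coefficient 0 for it.\<close>
    then have "face_close d T (T - {z}) v 0" "face_close d T (T - {z}) q 0"
      using face_close_uncut[OF N(1) _ F] face_close_uncut[OF N(1) _ F, of q 0] by simp_all
    then show ?thesis by (intro exI[of _ 0]) simp
  qed
qed

text \<open>F may stem from another element than T. It contains N of the N+1 vertices of T, so
  exactly one is left over.\<close>

lemma face_elem_vertex:
  fixes T :: "(real^'n) set"
  assumes "F \<in> faces \<T>" "T \<in> face_elems \<T> F" and card: "\<And>T. T \<in> \<T> \<Longrightarrow> finite T \<and> card T = Suc CARD('n)"
  obtains z where "z \<in> T" "F = T - {z}"
proof -
  obtain T0 x where T0: "F = T0 - {x}" "T0 \<in> \<T>" "x \<in> T0" using assms(1) by (auto simp: faces_def)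
  have T: "T \<in> \<T>" "F \<subseteq> T" using assms(2) by (auto simp: face_elems_def)
  have "finite F" "card F = CARD('n)" using T0 card[OF T0(2)] by auto
  then have "card (T - F) = 1" using card[OF T(1)] T(2) by (simp add: card_Diff_subset)
  then obtain z where "T - F = {z}" by (rule card_1_singletonE)
  then show ?thesis using that[of z] T(2) by blast
qed

lemma mesh_bounds:
  fixes a b :: "real^'n" and \<Gamma> \<Omega>m :: "(real^'n) set"
  assumes N: "CARD('n) \<ge> 2" and interface: "C2_interface (box a b) \<Gamma> \<Omega>m"
    and d_def: "d = signed_dist \<Omega>m \<Gamma>"
    and h0: "\<forall>T. has_axis_edges T \<longrightarrow> (\<forall>x\<in>T. \<forall>y\<in>T. dist x y < h0) \<longrightarrow> (\<exists>z\<in>T. z \<notin> \<Gamma>)"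
    and \<mu>: "0 < \<mu>p" "0 < \<mu>m"
    and C: "0 < C" "elem_const CARD('n) \<rho> (jump_const \<mu>p \<mu>m) \<le> C"
        "face_const CARD('n) \<rho> (jump_const \<mu>p \<mu>m) \<le> C"
    and mesh: "cartesian_mesh a b \<T>" "shape_regular \<rho> \<T>" "mesh_size \<T> < h0"
    and xs: "\<forall>T\<in>cut_by \<Gamma> \<T>. Gam d T \<noteq> {} \<and> xs T \<in> Gam d T"
    and VQ: "(v, q) \<in> VQ_space d \<Gamma> \<mu>p \<mu>m xs \<T>"
  shows "T \<in> cut_by \<Gamma> \<T> \<Longrightarrow> element_bounds d C T v q"
    and "F \<in> faces \<T> \<Longrightarrow> T1 \<in> face_elems \<T> F \<Longrightarrow> T2 \<in> face_elems \<T> F \<Longrightarrow> T1 \<noteq> T2 \<Longrightarrow>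
      face_bounds d C \<T> F T1 T2 v q"
proof -
  let ?J = "jump_const \<mu>p \<mu>m"
  note mesh_fin = cartesian_mesh_finite[OF mesh(1)]
  have regular: "regular_simplex T \<rho>" if "T \<in> \<T>" for T
    using mesh_fin(2)[OF that] mesh(2) that by unfold_locales (auto simp: shape_regular_def)
  \<comment> \<open>The threshold enters here: the vertices of T are closer to each other than
    \<open>h0\<close>, so one of them is off \<Gamma> and has nonzero \<open>d\<close>.\<close>
  have resolved: "resolved_simplex T \<rho> d" if T: "T \<in> \<T>" for T
  proof -
    interpret regular_simplex T \<rho> by (rule regular[OF T])
    have "hdiam T \<le> mesh_size \<T>" unfolding mesh_size_def using mesh_fin(1) T by (intro Max_ge) auto
    then have "dist x y < h0" if "x \<in> T" "y \<in> T" for x y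
      using dist_hull_le[OF T_subset_hull T_subset_hull, OF that] mesh(3) by (simp add: dist_norm)
    then have "\<exists>z\<in>T. z \<notin> \<Gamma>" using h0 cartesian_mesh_axis_edges[OF mesh(1) T] by blast
    then have "\<exists>z\<in>T. d z \<noteq> 0" unfolding d_def using signed_dist_zero_iff[OF interface] by blast
    then show ?thesis by unfold_locales
  qed
  show "element_bounds d C T v q" if T: "T \<in> cut_by \<Gamma> \<T>"
  proof -
    have "T \<in> \<T>" using T by (simp add: cut_by_def)
    then interpret resolved_simplex T \<rho> d by (rule resolved)
    interpret cut_simplex T \<rho> d "xs T" using xs T by unfold_locales blast
    obtain \<beta> where "((\<lambda>x. v x - bubble T x *\<^sub>R \<beta>), q) \<in> IFE_local d \<mu>p \<mu>m (xs T) T"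
      using VQ T unfolding VQ_space_def by blast
    then show ?thesis by (rule element_estimates[OF N \<mu> _ C(2)])
  qed
  show "face_bounds d C \<T> F T1 T2 v q"
    if F: "F \<in> faces \<T>" and T1: "T1 \<in> face_elems \<T> F" and T2: "T2 \<in> face_elems \<T> F"
      and ne: "T1 \<noteq> T2"
  proof -
    have T12: "T1 \<in> \<T>" "T2 \<in> \<T>" using T1 T2 by (auto simp: face_elems_def)
    interpret R1: regular_simplex T1 \<rho> by (rule regular[OF T12(1)])
    interpret R2: regular_simplex T2 \<rho> by (rule regular[OF T12(2)])
    have card: "finite T \<and> card T = Suc CARD('n)" if "T \<in> \<T>" for T
      using regular_simplex.card_T[OF regular[OF that]] mesh_fin(2)[OF that] by simp
    obtain z1 where z1: "z1 \<in> T1" "F = T1 - {z1}" by (rule face_elem_vertex[OF F T1 card])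
    obtain z2 where z2: "z2 \<in> T2" "F = T2 - {z2}" by (rule face_elem_vertex[OF F T2 card])
    have cut: "xs T \<in> Gam d T" if "T \<in> cut_by \<Gamma> \<T>" for T using xs that by blast
    obtain k1 where k1: "0 \<le> k1" "face_close d T1 F q k1" "face_close d T1 F v (hdiam T1 * k1)"
        "k1\<^sup>2 * hdiam T1 ^ CARD('n) \<le> (grad_bound CARD('n) \<rho> ?J)\<^sup>2 * (Hsemi 1 (open_simplex T1) v)\<^sup>2"
      using ex_face_bound[OF N \<mu> resolved[OF T12(1)] z1(1) cut T12(1) VQ] unfolding z1(2) by blast
    obtain k2 where k2: "0 \<le> k2" "face_close d T2 F q k2" "face_close d T2 F v (hdiam T2 * k2)"
        "k2\<^sup>2 * hdiam T2 ^ CARD('n) \<le> (grad_bound CARD('n) \<rho> ?J)\<^sup>2 * (Hsemi 1 (open_simplex T2) v)\<^sup>2"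
      using ex_face_bound[OF N \<mu> resolved[OF T12(2)] z2(1) cut T12(2) VQ] unfolding z2(2) by blast
    have nodal: "nodal_value d T1 v w = nodal_value d T2 v w"
        "nodal_value d T1 q w = nodal_value d T2 q w"
      if "w \<in> F" for w
    proof -
      have "w \<in> T1" "w \<in> T2" "w \<in> nodes \<T>" using that z1 z2 T12 by (auto simp: nodes_def)
      then show "nodal_value d T1 v w = nodal_value d T2 v w"
          "nodal_value d T1 q w = nodal_value d T2 q w"
        using VQ T12 unfolding VQ_space_def by blast+
    qed
    have hF: "hdiam F \<le> hdiam T1" "hdiam F \<le> hdiam T2"
      using R1.hdiam_face_le[OF z1(1)] R2.hdiam_face_le[OF z2(1)] z1(2) z2(2) by auto
    have "bounded (open_simplex F)"
      using R1.open_simplex_face[OF z1(1)] unfolding z1(2)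
      by (intro bounded_subset[OF R1.bounded_hull]) blast
    then have hF0: "0 \<le> hdiam F" unfolding hdiam_def by (rule diameter_ge_0)
    have h12: "0 \<le> hdiam T1 * k1 + hdiam T2 * k2"
      using R1.hdiam_pos R2.hdiam_pos k1 k2 by (intro add_nonneg_nonneg mult_nonneg_nonneg) auto
    have "hdiam F * (L2surf (open_simplex F) (face_jump d T1 T2 q))\<^sup>2
        + inverse (hdiam F) * (L2surf (open_simplex F) (face_jump d T1 T2 v))\<^sup>2
      \<le> 4 * surf_const CARD('n) * (grad_bound CARD('n) \<rho> ?J)\<^sup>2 *
        ((Hsemi 1 (open_simplex T1) v)\<^sup>2 + (Hsemi 1 (open_simplex T2) v)\<^sup>2)"
    proof (rule face_jump_scaling[OF hF0 hF N surf_const_nonneg k1(1) k2(1) k1(4) k2(4)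
          L2norm_nonneg _ L2norm_nonneg])
      show "L2surf (open_simplex F) (face_jump d T1 T2 q) \<le>
          (k1 + k2) * sqrt (surf_const CARD('n) * hdiam F ^ (CARD('n) - 1))"
        using k1(1) k2(1) nodal by (intro face_jump_le[OF N regular[OF T12(1)] z1 k1(2) k2(2)]) auto
      show "L2surf (open_simplex F) (face_jump d T1 T2 v) \<le>
          (hdiam T1 * k1 + hdiam T2 * k2) * sqrt (surf_const CARD('n) * hdiam F ^ (CARD('n) - 1))"
        using h12 nodal by (intro face_jump_le[OF N regular[OF T12(1)] z1 k1(3) k2(3)]) auto
    qed
    also have "\<dots> = face_const CARD('n) \<rho> ?J *
        ((Hsemi 1 (open_simplex T1) v)\<^sup>2 + (Hsemi 1 (open_simplex T2) v)\<^sup>2)"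
      by (simp add: face_const_def)
    \<comment> \<open>As \<open>T1\<close> and \<open>T2\<close> differ, the sum over the set has
      both terms; it is then enlarged to all of \<open>face_elems \<T> F\<close>.\<close>
    also have "\<dots> \<le> C * (\<Sum>T'\<in>{T1, T2}. (Hsemi 1 (open_simplex T') v)\<^sup>2)"
      using C(3) ne by (simp add: mult_right_mono)
    also have "\<dots> \<le> C * (\<Sum>T'\<in>face_elems \<T> F. (Hsemi 1 (open_simplex T') v)\<^sup>2)"
    proof (intro mult_left_mono sum_mono2)
      show "finite (face_elems \<T> F)" using mesh_fin(1) by (simp add: face_elems_def)
    qed (use T1 T2 C(1) in auto)
    finally show ?thesis unfolding face_bounds_def .
  qed
qed

lemma mesh_estimates:
  fixes a b :: "real^'n" and \<Gamma> \<Omega>m :: "(real^'n) set" and \<rho> :: real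
  assumes N: "CARD('n) \<ge> 2" and interface: "C2_interface (box a b) \<Gamma> \<Omega>m"
  defines "d \<equiv> signed_dist \<Omega>m \<Gamma>"
  shows "\<exists>h0>0. \<forall>\<mu>p>0. \<forall>\<mu>m>0. \<exists>C>0. \<forall>\<T> xs.
     cartesian_mesh a b \<T> \<and> shape_regular \<rho> \<T> \<and> mesh_size \<T> < h0 \<and>
     (\<forall>T\<in>cut_by \<Gamma> \<T>. Gam d T \<noteq> {} \<and> xs T \<in> Gam d T) \<longrightarrow>
     (\<forall>(v, q)\<in>VQ_space d \<Gamma> \<mu>p \<mu>m xs \<T>.
       (\<forall>T\<in>cut_by \<Gamma> \<T>. element_bounds d C T v q) \<and>
       (\<forall>F\<in>cut_by \<Gamma> (faces \<T>). \<forall>T1\<in>face_elems \<T> F. \<forall>T2\<in>face_elems \<T> F. T1 \<noteq> T2 \<longrightarrow>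
          face_bounds d C \<T> F T1 T2 v q))"
proof -
  have "compact \<Gamma>" "C2_hypersurface \<Gamma>" using interface by (auto simp: C2_interface_def)
  then obtain h0 where h0: "0 < h0"
      "\<forall>T. has_axis_edges T \<longrightarrow> (\<forall>x\<in>T. \<forall>y\<in>T. dist x y < h0) \<longrightarrow> (\<exists>z\<in>T. z \<notin> \<Gamma>)"
    using vertices_off_hypersurface by blast
  \<comment> \<open>Since \<open>\<rho>\<close> is an arbitrary real here, the sign of
    \<open>elem_const\<close> is open; the absolute value and the 1 make \<open>C\<close> positive
    all the same.\<close>
  define C where "C \<mu>p \<mu>m = 1 + \<bar>elem_const CARD('n) \<rho> (jump_const \<mu>p \<mu>m)\<bar> +
    face_const CARD('n) \<rho> (jump_const \<mu>p \<mu>m)" for \<mu>p \<mu>m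
  have C: "0 < C \<mu>p \<mu>m" "elem_const CARD('n) \<rho> (jump_const \<mu>p \<mu>m) \<le> C \<mu>p \<mu>m"
    "face_const CARD('n) \<rho> (jump_const \<mu>p \<mu>m) \<le> C \<mu>p \<mu>m" for \<mu>p \<mu>m
    using face_const_nonneg[of "CARD('n)" \<rho> "jump_const \<mu>p \<mu>m"] by (auto simp: C_def)
  note bounds = mesh_bounds[OF N interface d_def[THEN meta_eq_to_obj_eq] h0(2) _ _ C]
  show ?thesis
  proof (rule exI[of _ h0], intro conjI allI impI h0(1), goal_cases)
    case (1 \<mu>p \<mu>m)
    show ?case
      by (rule exI[of _ "C \<mu>p \<mu>m"], intro conjI allI impI ballI C(1); clarify)
        (intro conjI ballI impI; rule bounds[OF 1]; (assumption | force simp: cut_by_def))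
  qed
qed

theorem lemma4p1:
  fixes a b :: "real^'n" and \<Gamma> \<Omega>m :: "(real^'n) set" and \<rho> :: real
  assumes "CARD('n) = 2 \<or> CARD('n) = 3"
    and "\<forall>i. a $ i < b $ i"
    and "C2_interface (box a b) \<Gamma> \<Omega>m"
  defines "d \<equiv> signed_dist \<Omega>m \<Gamma>"
  shows "\<exists>h0>0. \<forall>\<mu>p>0. \<forall>\<mu>m>0. \<exists>C>0. \<forall>\<T> xs.
     cartesian_mesh a b \<T> \<and> shape_regular \<rho> \<T> \<and> mesh_size \<T> < h0 \<and>
     (\<forall>T\<in>cut_by \<Gamma> \<T>. Gam d T \<noteq> {} \<and> xs T \<in> Gam d T) \<longrightarrow>
     (\<forall>(v, q)\<in>VQ_space d \<Gamma> \<mu>p \<mu>m xs \<T>.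
       (\<forall>T\<in>cut_by \<Gamma> \<T>.
          L2surf (frontier (open_simplex T)) (inner_trace d T (jac v))
            \<le> C * hdiam T powr (-1/2) * Hsemi 1 (open_simplex T) v \<and>
          Hsemi 1 (open_simplex T) v
            \<le> C * inverse (hdiam T) * L2vol (open_simplex T) v \<and>
          Hsemi 1 (open_simplex T) (nodal_interp d T v)
            \<le> C * Hsemi 1 (open_simplex T) v \<and>
          (\<forall>m\<in>{0, 1}.
            hdiam T powr (1/2) * L2surf (Gam d T) (inner_trace d T (\<lambda>x. v x - IhB d T v x))
              + hdiam T ^ m * Hsemi m (open_simplex T) (\<lambda>x. v x - IhB d T v x)
            \<le> C * hdiam T * Hsemi 1 (open_simplex T) v) \<and>
          L2surf (Gam d T) (ext_jump d T q)
            \<le> C * hdiam T powr (-1/2) * Hsemi 1 (open_simplex T) v \<and>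
          L2surf (frontier (open_simplex T)) (inner_trace d T q)
            \<le> C * hdiam T powr (-1/2) *
                (L2vol (open_simplex T) q + Hsemi 1 (open_simplex T) v)) \<and>
       (\<forall>F\<in>cut_by \<Gamma> (faces \<T>). \<forall>T1\<in>face_elems \<T> F. \<forall>T2\<in>face_elems \<T> F. T1 \<noteq> T2 \<longrightarrow>
          hdiam F * (L2surf (open_simplex F) (face_jump d T1 T2 q))\<^sup>2
            + inverse (hdiam F) * (L2surf (open_simplex F) (face_jump d T1 T2 v))\<^sup>2
          \<le> C * (\<Sum>T'\<in>face_elems \<T> F. (Hsemi 1 (open_simplex T') v)\<^sup>2)))"
proof -
  have "CARD('n) \<ge> 2" using assms(1) by auto
  from mesh_estimates[OF this assms(3), of \<rho>] show ?thesis
    unfolding element_bounds_def face_bounds_def d_def .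
qed

end
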